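(* Let $n$ be a positive integer with $n\equiv 3\pmod 4$. (1) $3H(n)$ is odd if and only if $n=p^{4a+1}m^2$, where $p$ is a prime and $m,a$ are integers with $(m,p)=1$ and $a\ge 0$. (2) $3H(n)\equiv 2\pmod 4$ if and only if $n=p_1^{4a+1}p_2^{4b+1}m^2$, where $p_1,p_2$ are primes with $\left(\frac{p_1}{p_2}\right)=-1$, $(m,p_1p_2)=1$, and $a,b\ge 0$ are integers.
   Context: $H(N)$ is the Hurwitz class number: $H(N)=0$ if $N\equiv1,2\pmod 4$; $H(0)=-1/12$; and for $N>0$, $N\equiv 0,3\pmod 4$, $H(N)$ is the number of $\mathrm{SL}_2(\mathbb Z)$-classes of positive definite binary quadratic forms of discriminant $-N$, where classes containing a multiple of $x^2+y^2$ or of $x^2+xy+y^2$ are counted with weight $1/2$ or $1/3$ respectively. (Here $3H(n)$ is an integer.) $\left(\frac{\cdot}{\cdot}\right)$ denotes the Kronecker symbol. *)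

theory Defs
  imports Complex_Main "HOL-Number_Theory.Number_Theory"
begin

text \<open>The triple \<open>(a, b, c)\<close> stands for the form \<open>a x^2 + b x y + c y^2\<close>;
  imprimitive forms are allowed.\<close>

type_synonym bqf = "int \<times> int \<times> int"

definition bqf_eval :: "bqf \<Rightarrow> 'a::comm_ring_1 \<Rightarrow> 'a \<Rightarrow> 'a" where
  "bqf_eval f x y = (case f of (a, b, c) \<Rightarrow> of_int a * x^2 + of_int b * x * y + of_int c * y^2)"

definition bqf_discr :: "bqf \<Rightarrow> int" where
  "bqf_discr f = (case f of (a, b, c) \<Rightarrow> b^2 - 4 * a * c)"

definition bqf_pos_def :: "bqf \<Rightarrow> bool" where
  "bqf_pos_def f \<longleftrightarrow> (\<forall>x y :: real. (x, y) \<noteq> (0, 0) \<longrightarrow> bqf_eval f x y > 0)"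

definition bqf_SL2_equiv :: "bqf \<Rightarrow> bqf \<Rightarrow> bool" where
  "bqf_SL2_equiv f g \<longleftrightarrow>
     (\<exists>p q r s :: int. p * s - q * r = 1 \<and>
        (\<forall>x y :: int. bqf_eval g x y = bqf_eval f (p * x + q * y) (r * x + s * y)))"

definition pos_def_forms :: "int \<Rightarrow> bqf set" where
  "pos_def_forms D = {f. bqf_pos_def f \<and> bqf_discr f = D}"

definition form_classes :: "int \<Rightarrow> bqf set set" where
  "form_classes D =
     pos_def_forms D // {(f, g). f \<in> pos_def_forms D \<and> g \<in> pos_def_forms D \<and> bqf_SL2_equiv f g}"

definition class_weight :: "bqf set \<Rightarrow> rat" where
  "class_weight C =
     (if \<exists>k. (k, 0, k) \<in> C then 1/2
      else if \<exists>k. (k, k, k) \<in> C then 1/3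
      else 1)"

text \<open>For \<open>N < 0\<close> the value is 0, since a form of positive discriminant is indefinite.\<close>

definition hurwitz_class_number :: "int \<Rightarrow> rat" where
  "hurwitz_class_number N =
     (if N mod 4 \<in> {1, 2} then 0
      else if N = 0 then -1/12
      else (\<Sum>C\<in>form_classes (-N). class_weight C))"

text \<open>The library's \<^const>\<open>Legendre\<close> is not the Kronecker symbol at the prime 2, where it never
  takes the value \<open>-1\<close>.\<close>

definition kronecker_prime :: "int \<Rightarrow> int \<Rightarrow> int" where
  "kronecker_prime a p =
     (if p = 2 then (if even a then 0 else if a mod 8 \<in> {1, 7} then 1 else -1)
      else Legendre a p)"

definition kronecker :: "int \<Rightarrow> int \<Rightarrow> int" where
  "kronecker a n =
     (if n = 0 then (if \<bar>a\<bar> = 1 then 1 else 0)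
      else (if n < 0 \<and> a < 0 then -1 else 1) *
           (\<Prod>p\<in>prime_factors n. kronecker_prime a p ^ multiplicity p n))"

end

theory Submission
  imports Defs "HOL-Algebra.Sylow" "HOL-Algebra.Multiplicative_Group"
    "HOL-Computational_Algebra.Squarefree"
begin

text \<open>
  Write \<open>R(n)\<close> for the number of classes of forms of discriminant \<open>-n\<close>; then \<open>3H(n)\<close> is
  \<open>3R(n)\<close>, minus 2 if \<open>n\<close> is three times a square.

  Inversion \<open>(a,b,c) \<mapsto> (a,-b,c)\<close> acts on reduced forms, and since \<open>n \<equiv> 3 (mod 4)\<close> its fixed
  points correspond to the factorizations \<open>n = uv\<close> with \<open>u < v\<close>. So \<open>R(n)\<close> has the parity of
  half the number of divisors of \<open>n\<close>, which gives part (1).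

  For part (2), restricting forms to sublattices of prime index \<open>l\<close> relates \<open>R(l^2 N)\<close>, \<open>R(N)\<close> and
  \<open>R(N/l^2)\<close>; modulo 4 this settles the case of a single prime of odd
  exponent and reduces the others to squarefree \<open>n\<close>, where all forms are primitive
  and their classes form a group whose 2-torsion is counted by the ambiguous forms. If \<open>n\<close> has at
  least three prime factors, the order of the 2-torsion is divisible by 4. If \<open>n = pq\<close>, the
  2-torsion has order 2, generated by the class of the ideal of norm \<open>p\<close>, so 4 divides \<open>R(n)\<close> iff
  this class is a square. That is equivalent to the solvability of \<open>p x^2 + q y^2 = z^2\<close>, which
  by Legendre's theorem and quadratic reciprocity means that \<open>p\<close> is a square modulo \<open>q\<close>.
\<close>

text \<open>Modulo 4, \<open>3H(n)\<close> is \<open>-R(n)\<close> unless \<open>n\<close> is three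
  times a square. The correction 2 then comes from the form \<open>(k,k,k)\<close>, the only kind in
  odd discriminant with automorphisms other than plus and minus the identity. These automorphisms
  also disturb the count over sublattices. That count is needed in their presence only for
  \<open>l = 3\<close>, and there the two effects cancel modulo 4.

  Discriminants with square factors have imprimitive forms and no group of all classes, so the group
  argument is kept for squarefree \<open>n\<close>. The rest is a descent: two successive steps give
  \<open>R(l^4 N) + l R(N) = (l+1) R(l^2 N)\<close>, which modulo 4 becomes
  \<open>R(l^4 N) = R(N)\<close> as soon as the class numbers are even or \<open>l\<close> is 3
  modulo 4. Hence exponents matter modulo 4, and the family treated by induction has to be one in
  which \<open>R\<close> is even throughout.

  The class group is built from lattices in the complex numbers up to scaling. Products of sets are
  associative and commutative by themselves, conjugation gives inverses, and the composed form is
  read off from a basis of the product.\<close>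

lemma mod4_3_odd: "[n = 3] (mod 4) \<Longrightarrow> odd (n::int)"
  by (simp add: cong_def) presburger

section \<open>Integral substitutions and equivalence of forms\<close>

definition bqf_act :: "bqf \<Rightarrow> int \<Rightarrow> int \<Rightarrow> int \<Rightarrow> int \<Rightarrow> bqf" where
  "bqf_act f p q r s = (case f of (a, b, c) \<Rightarrow>
     (a*p^2 + b*p*r + c*r^2, 2*a*p*q + b*(p*s + q*r) + 2*c*r*s, a*q^2 + b*q*s + c*s^2))"

lemma bqf_act_simp:
  "bqf_act (a,b,c) p q r s =
     (a*p^2 + b*p*r + c*r^2, 2*a*p*q + b*(p*s + q*r) + 2*c*r*s, a*q^2 + b*q*s + c*s^2)"
  by (simp add: bqf_act_def)

lemma bqf_eval_act:
  fixes x y :: int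
  shows "bqf_eval (bqf_act f p q r s) x y = bqf_eval f (p*x + q*y) (r*x + s*y)"
  by (cases f) (simp add: bqf_act_def bqf_eval_def algebra_simps power2_eq_square)

lemma bqf_eval_inj:
  assumes "\<And>x y :: int. bqf_eval f x y = bqf_eval g x y"
  shows "f = g"
proof -
  obtain a b c a' b' c' where "f = (a,b,c)" "g = (a',b',c')" by (cases f, cases g)
  then show ?thesis
    using assms[of 1 0] assms[of 0 1] assms[of 1 1] by (simp add: bqf_eval_def)
qed

text \<open>A form is determined by its integer values, so equivalence can be handled as an equation
  between coefficient triples.\<close>

lemma bqf_SL2_equiv_iff:
  "bqf_SL2_equiv f g \<longleftrightarrow> (\<exists>p q r s. p*s - q*r = 1 \<and> g = bqf_act f p q r s)"
  unfolding bqf_SL2_equiv_def by (metis bqf_eval_act bqf_eval_inj)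

lemma bqf_act_act:
  "bqf_act (bqf_act f p q r s) p' q' r' s' =
   bqf_act f (p*p' + q*r') (p*q' + q*s') (r*p' + s*r') (r*q' + s*s')"
  by (rule bqf_eval_inj) (simp add: bqf_eval_act algebra_simps)

lemma det_mult:
  fixes p :: int
  shows "(p*p' + q*r') * (r*q' + s*s') - (p*q' + q*s') * (r*p' + s*r') = (p*s - q*r) * (p'*s' - q'*r')"
  by (simp add: algebra_simps)

lemma bqf_act_id [simp]: "bqf_act f 1 0 0 1 = f"
  by (cases f) (simp add: bqf_act_def)

lemma bqf_SL2_equiv_refl: "bqf_SL2_equiv f f"
  unfolding bqf_SL2_equiv_iff by (metis bqf_act_id diff_zero mult_1 mult_zero_left)

lemma bqf_act_inverse:
  assumes "p*s - q*r = 1"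
  shows "bqf_act (bqf_act f p q r s) s (-q) (-r) p = f"
proof -
  have "bqf_act (bqf_act f p q r s) s (-q) (-r) p = bqf_act f (p*s - q*r) 0 0 (p*s - q*r)"
    by (simp add: bqf_act_act algebra_simps)
  then show ?thesis using assms by simp
qed

lemma bqf_SL2_equiv_sym:
  assumes "bqf_SL2_equiv f g"
  shows "bqf_SL2_equiv g f"
proof -
  obtain p q r s where pqrs: "p*s - q*r = 1" "g = bqf_act f p q r s"
    using assms bqf_SL2_equiv_iff by blast
  have "s * p - (-q) * (-r) = 1" using pqrs(1) by (simp add: algebra_simps)
  then show ?thesis
    unfolding bqf_SL2_equiv_iff using bqf_act_inverse[OF pqrs(1), of f] pqrs(2) by metis
qed

lemma bqf_SL2_equiv_trans:
  assumes "bqf_SL2_equiv f g" "bqf_SL2_equiv g h"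
  shows "bqf_SL2_equiv f h"
proof -
  obtain p q r s where 1: "p*s - q*r = 1" "g = bqf_act f p q r s"
    using assms bqf_SL2_equiv_iff by blast
  obtain p' q' r' s' where 2: "p'*s' - q'*r' = 1" "h = bqf_act g p' q' r' s'"
    using assms bqf_SL2_equiv_iff by blast
  have "(p*p' + q*r') * (r*q' + s*s') - (p*q' + q*s') * (r*p' + s*r') = 1"
    unfolding det_mult using 1 2 by simp
  then show ?thesis using 1 2 bqf_act_act bqf_SL2_equiv_iff by metis
qed

text \<open>Completing the square gives \<open>4a f(x,y) = (2ax + by)^2 + n y^2\<close>. Positivity
  over the reals is thereby replaced by a condition on integers, the form in which it is used from
  here on.\<close>

lemma mem_pos_def_forms:
  assumes "n > 0"
  shows "(a,b,c) \<in> pos_def_forms (-n) \<longleftrightarrow> a > 0 \<and> 4*a*c - b^2 = n"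
proof
  assume "(a,b,c) \<in> pos_def_forms (-n)"
  then have *: "\<forall>x y::real. (x, y) \<noteq> (0, 0) \<longrightarrow> bqf_eval (a,b,c) x y > 0" "b^2 - 4*a*c = -n"
    by (auto simp: pos_def_forms_def bqf_pos_def_def bqf_discr_def)
  have "bqf_eval (a,b,c) (1::real) 0 > 0" using *(1) by simp
  then show "a > 0 \<and> 4*a*c - b^2 = n" using *(2) by (simp add: bqf_eval_def)
next
  assume *: "a > 0 \<and> 4*a*c - b^2 = n"
  have "bqf_eval (a,b,c) x y > 0" if "(x,y) \<noteq> (0,0)" for x y :: real
  proof -
    have "real_of_int (4*a*c - b^2) = of_int n" using * by presburger
    then have n: "4*real_of_int a*c - (real_of_int b)^2 = n" by simp
    have "4 * of_int a * bqf_eval (a,b,c) x y = (2*a*x + b*y)^2 + (4*real_of_int a*c - (real_of_int b)^2)*y^2"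
      by (simp add: bqf_eval_def power2_eq_square algebra_simps)
    also have "\<dots> = (2*a*x + b*y)^2 + n*y^2" using n by simp
    also have "\<dots> > 0"
    proof (cases "y = 0")
      case True
      then show ?thesis using that * by simp
    next
      case False
      then have "real_of_int n * y^2 > 0" using assms by simp
      then show ?thesis by (simp add: add_nonneg_pos)
    qed
    finally show ?thesis using * by (simp add: zero_less_mult_iff)
  qed
  then show "(a,b,c) \<in> pos_def_forms (-n)" using *
    by (auto simp: pos_def_forms_def bqf_pos_def_def bqf_discr_def)
qed

lemma bqf_act_mem:
  assumes "n > 0" "f \<in> pos_def_forms (-n)" "p*s - q*r = 1"
  shows "bqf_act f p q r s \<in> pos_def_forms (-n)"
proof -
  obtain a b c where f: "f = (a,b,c)" by (cases f)
  have abc: "a > 0" "4*a*c - b^2 = n" using assms f mem_pos_def_forms by blast+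
  let ?A = "a*p^2 + b*p*r + c*r^2"
  have d: "4 * ?A * (a*q^2 + b*q*s + c*s^2) - (2*a*p*q + b*(p*s + q*r) + 2*c*r*s)^2
       = (4*a*c - b^2) * (p*s - q*r)^2" by (simp add: power2_eq_square algebra_simps)
  have e: "4*a*?A = (2*a*p + b*r)^2 + (4*a*c - b^2)*r^2" by (simp add: power2_eq_square algebra_simps)
  have "4*a*?A > 0"
  proof (cases "r = 0")
    case True
    then have "p \<noteq> 0" using assms(3) by auto
    then show ?thesis using True abc by simp
  next
    case False
    then have "n*r^2 > 0" using assms(1) by simp
    then show ?thesis unfolding e abc(2) by (simp add: add_nonneg_pos)
  qed
  then have "?A > 0" using abc(1) by (simp add: zero_less_mult_iff)
  then show ?thesis using d abc assms(1,3) by (simp add: f bqf_act_simp mem_pos_def_forms)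
qed

abbreviation bqf_rel :: "int \<Rightarrow> (bqf \<times> bqf) set" where
  "bqf_rel D \<equiv> {(f, g). f \<in> pos_def_forms D \<and> g \<in> pos_def_forms D \<and> bqf_SL2_equiv f g}"

lemma equiv_bqf_rel: "equiv (pos_def_forms D) (bqf_rel D)"
  by (rule equivI)
     (auto simp: refl_on_def sym_def trans_def bqf_SL2_equiv_refl
           intro: bqf_SL2_equiv_sym bqf_SL2_equiv_trans)

definition bqf_class :: "int \<Rightarrow> bqf \<Rightarrow> bqf set" where
  "bqf_class n f = bqf_rel (-n) `` {f}"

lemma form_classes_eq: "form_classes (-n) = bqf_class n ` pos_def_forms (-n)"
  by (auto simp: form_classes_def bqf_class_def quotient_def)

lemma bqf_class_eq_iff:
  assumes "f \<in> pos_def_forms (-n)" "g \<in> pos_def_forms (-n)"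
  shows "bqf_class n f = bqf_class n g \<longleftrightarrow> bqf_SL2_equiv f g"
  using eq_equiv_class_iff[OF equiv_bqf_rel assms] assms by (simp add: bqf_class_def)

lemma mem_bqf_class:
  "g \<in> bqf_class n f \<longleftrightarrow> f \<in> pos_def_forms (-n) \<and> g \<in> pos_def_forms (-n) \<and> bqf_SL2_equiv f g"
  by (simp add: bqf_class_def)

section \<open>Reduced forms\<close>

text \<open>Gauss reduction. On the boundary \<open>\<bar>b\<bar> = a\<close> or
  \<open>a = c\<close> the forms \<open>(a,b,c)\<close> and \<open>(a,-b,c)\<close> are equivalent;
  the asymmetric conditions keep one of them.\<close>

definition reduced_forms :: "int \<Rightarrow> bqf set" where
  "reduced_forms n = {(a,b,c). (a,b,c) \<in> pos_def_forms (-n) \<and>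
     -a < b \<and> b \<le> a \<and> a \<le> c \<and> (a = c \<longrightarrow> 0 \<le> b)}"

lemma reduced_forms_iff:
  assumes "n > 0"
  shows "(a,b,c) \<in> reduced_forms n \<longleftrightarrow>
    a > 0 \<and> 4*a*c - b^2 = n \<and> -a < b \<and> b \<le> a \<and> a \<le> c \<and> (a = c \<longrightarrow> 0 \<le> b)"
  using assms by (auto simp: reduced_forms_def mem_pos_def_forms)

lemma pos_def_forms_odd:
  assumes "n > 0" "odd n" "(a,b,c) \<in> pos_def_forms (-n)"
  shows "odd b"
proof -
  have "odd (4*a*c - b^2)" using assms mem_pos_def_forms by simp
  then show ?thesis by simp
qed

text \<open>Take a form of the class with least leading coefficient. A translation moves
  \<open>b\<close> into the right interval without changing \<open>a\<close>, and exchanging the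
  variables shows \<open>a \<le> c\<close> by minimality.\<close>

lemma exists_reduced:
  assumes n: "n > 0" and "f \<in> pos_def_forms (-n)"
  shows "\<exists>g \<in> reduced_forms n. bqf_SL2_equiv f g"
proof -
  define S where "S = {g \<in> pos_def_forms (-n). bqf_SL2_equiv f g}"
  have fS: "f \<in> S" using assms bqf_SL2_equiv_refl S_def by simp
  obtain a b c where g: "(a,b,c) \<in> S" and min: "\<And>a' b' c'. (a',b',c') \<in> S \<Longrightarrow> a \<le> a'"
  proof -
    obtain g where g: "g \<in> S" "\<And>h. h \<in> S \<Longrightarrow> nat (fst g) \<le> nat (fst h)"
      using fS by (metis ex_has_least_nat[of "\<lambda>x. x \<in> S" f "\<lambda>x. nat (fst x)"])
    obtain a b c where abc: "g = (a,b,c)" by (cases g)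
    have "a \<le> a'" if "(a',b',c') \<in> S" for a' b' c'
      using g(2)[OF that] g(1) that n abc by (auto simp: S_def mem_pos_def_forms)
    then show thesis using that g(1) abc by metis
  qed
  have act: "bqf_act h p q r s \<in> S" if "h \<in> S" "p*s - q*r = 1" for h p q r s
    using that n unfolding S_def
    by (auto intro: bqf_act_mem) (metis bqf_SL2_equiv_iff bqf_SL2_equiv_trans)
  have a: "a > 0" using g n by (auto simp: S_def mem_pos_def_forms)
  \<comment> \<open>The division has remainder in \<open>[0, 2a)\<close>; the offset
    \<open>a - 1\<close> turns this into the half-open interval from \<open>-a\<close> (excluded) to
    \<open>a\<close> (included).\<close>
  define t where "t = - ((b + a - 1) div (2*a))"
  have tb: "-a < b + 2*a*t" "b + 2*a*t \<le> a"
  proof -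
    have "b + a - 1 = 2*a*((b + a - 1) div (2*a)) + (b + a - 1) mod (2*a)"
      by (simp add: mult_div_mod_eq)
    moreover have "0 \<le> (b + a - 1) mod (2*a)" "(b + a - 1) mod (2*a) < 2*a" using a by simp_all
    ultimately show "-a < b + 2*a*t" "b + 2*a*t \<le> a" unfolding t_def by (simp_all add: algebra_simps)
  qed
  define B where "B = b + 2*a*t"
  define C where "C = a*t^2 + b*t + c"
  have h: "(a,B,C) \<in> S"
    using act[OF g, of 1 1 t 0] by (simp add: bqf_act_simp B_def C_def algebra_simps)
  have sw: "(C,-B,a) \<in> S" using act[OF h, of 0 0 "-1" 1] by (simp add: bqf_act_simp)
  have aC: "a \<le> C" using min sw by blast
  show ?thesis
  proof (cases "a = C \<and> B < 0")
    case True
    then have "(C,-B,a) \<in> reduced_forms n" using sw tb by (auto simp: reduced_forms_def S_def B_def)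
    then show ?thesis using sw S_def by auto
  next
    case False
    then have "(a,B,C) \<in> reduced_forms n" using h tb aC by (auto simp: reduced_forms_def S_def B_def)
    then show ?thesis using h S_def by auto
  qed
qed

text \<open>The cross term is at most \<open>\<bar>b\<bar>\<close> times the larger of
  \<open>x^2\<close> and \<open>y^2\<close>, and that square has a coefficient of at least
  \<open>\<bar>b\<bar>\<close>. So a vector off the axes can attain the minimum \<open>a\<close>
  only if \<open>c = \<bar>b\<bar>\<close>.\<close>

lemma reduced_value_bound:
  assumes "\<bar>b\<bar> \<le> a" "a \<le> c" "x \<noteq> 0" "y \<noteq> 0"
  shows "a*x^2 + b*x*y + c*y^2 \<ge> a + c - \<bar>b::int\<bar>"
proof -
  have x1: "\<bar>x\<bar> \<ge> 1" and y1: "\<bar>y\<bar> \<ge> 1" using assms by auto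
  have x2: "x^2 \<ge> 1" and y2: "y^2 \<ge> 1" using assms by (simp_all add: int_one_le_iff_zero_less)
  have "b*x*y \<ge> - (\<bar>b\<bar>*\<bar>x\<bar>*\<bar>y\<bar>)" by (metis abs_ge_minus_self abs_mult minus_le_iff)
  moreover have "a*x^2 + c*y^2 - \<bar>b\<bar>*\<bar>x\<bar>*\<bar>y\<bar> \<ge> a + c - \<bar>b\<bar>"
  proof (cases "\<bar>x\<bar> \<ge> \<bar>y\<bar>")
    case True
    have "\<bar>b\<bar>*\<bar>x\<bar>*\<bar>y\<bar> \<le> \<bar>b\<bar>*\<bar>x\<bar>*\<bar>x\<bar>" using True by (simp add: mult_left_mono)
    also have "\<dots> = \<bar>b\<bar>*x^2" by (simp add: power2_eq_square mult.assoc)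
    finally have 1: "\<bar>b\<bar>*\<bar>x\<bar>*\<bar>y\<bar> \<le> \<bar>b\<bar>*x^2" .
    have "(a - \<bar>b\<bar>)*1 \<le> (a - \<bar>b\<bar>)*x^2" using assms(1) x2 by (intro mult_left_mono) auto
    moreover have "c*1 \<le> c*y^2" using assms y2 by (intro mult_left_mono) auto
    ultimately show ?thesis using 1 by (simp add: algebra_simps)
  next
    case False
    have "\<bar>b\<bar>*\<bar>x\<bar>*\<bar>y\<bar> \<le> \<bar>b\<bar>*\<bar>y\<bar>*\<bar>y\<bar>" using False by (simp add: mult_left_mono mult_right_mono)
    also have "\<dots> = \<bar>b\<bar>*y^2" by (simp add: power2_eq_square mult.assoc)
    finally have 1: "\<bar>b\<bar>*\<bar>x\<bar>*\<bar>y\<bar> \<le> \<bar>b\<bar>*y^2" .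
    have "(c - \<bar>b\<bar>)*1 \<le> (c - \<bar>b\<bar>)*y^2" using assms y2 by (intro mult_left_mono) auto
    moreover have "a*1 \<le> a*x^2" using assms x2 by (intro mult_left_mono) auto
    ultimately show ?thesis using 1 by (simp add: algebra_simps)
  qed
  ultimately show ?thesis by linarith
qed

text \<open>The leading coefficient of a reduced form is thus an invariant of its class, the
  starting point for uniqueness.\<close>

lemma reduced_leading_min:
  assumes "\<bar>b\<bar> \<le> a" "a \<le> c" "(x,y) \<noteq> (0,0)"
  shows "a*x^2 + b*x*y + c*y^2 \<ge> (a::int)"
proof -
  have a0: "a \<ge> 0" using assms by linarith
  consider "x = 0" "y \<noteq> 0" | "y = 0" "x \<noteq> 0" | "x \<noteq> 0" "y \<noteq> 0" using assms by auto
  then show ?thesis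
  proof cases
    case 1
    then have "y^2 \<ge> 1" by (simp add: int_one_le_iff_zero_less)
    then have "c*1 \<le> c*y^2" using assms a0 by (intro mult_left_mono) auto
    then show ?thesis using 1 assms by simp
  next
    case 2
    then have "x^2 \<ge> 1" by (simp add: int_one_le_iff_zero_less)
    then have "a*1 \<le> a*x^2" using assms a0 by (intro mult_left_mono) auto
    then show ?thesis using 2 by simp
  next
    case 3
    then show ?thesis using reduced_value_bound[OF assms(1,2), of x y] assms by linarith
  qed
qed

text \<open>Both leading coefficients are the minimum of the class, so they agree and
  \<open>(p,r)\<close> is a minimal vector of \<open>f\<close>. Oddness of \<open>n\<close> makes
  \<open>b\<close> odd, which excludes \<open>(k,0,k)\<close>; of the forms with extra automorphisms
  only \<open>(k,k,k)\<close> is left. The second conclusion, applied to an automorphism, says that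
  it is plus or minus the identity otherwise.\<close>

lemma reduced_unique:
  assumes n: "n > 0" "odd n"
    and f: "f \<in> reduced_forms n" and g: "bqf_act f p q r s \<in> reduced_forms n"
    and det: "p*s - q*r = 1"
  shows "bqf_act f p q r s = f"
    and "(q = 0 \<and> r = 0 \<and> p = s \<and> \<bar>p\<bar> = 1) \<or> (\<exists>k. f = (k,k,k))"
proof -
  obtain a b c where fe: "f = (a,b,c)" by (cases f)
  obtain a' b' c' where ge: "bqf_act f p q r s = (a',b',c')" by (cases "bqf_act f p q r s")
  note F = f[unfolded fe reduced_forms_def, simplified]
  note G = g[unfolded ge reduced_forms_def, simplified]
  have Fd: "a > 0" "4*a*c - b^2 = n" using F n mem_pos_def_forms by blast+
  have Gd: "a' > 0" "4*a'*c' - b'^2 = n" using G n mem_pos_def_forms by blast+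
  have "odd (4*a*c - b^2)" "odd (4*a'*c' - b'^2)" using Fd Gd n by simp_all
  then have b: "odd b" "odd b'" by simp_all
  have eqs: "a' = a*p^2 + b*p*r + c*r^2" "b' = 2*a*p*q + b*(p*s + q*r) + 2*c*r*s"
    using ge by (simp_all add: fe bqf_act_simp)
  have pr: "(p,r) \<noteq> (0,0)" using det by auto
  have inv: "f = bqf_act (a',b',c') s (-q) (-r) p"
    using bqf_act_inverse[OF det, of f] ge by simp
  then have a_eq: "a = a'*s^2 + b'*s*(-r) + c'*(-r)^2" by (simp add: fe bqf_act_simp)
  have bds: "\<bar>b\<bar> \<le> a" "a \<le> c" "\<bar>b'\<bar> \<le> a'" "a' \<le> c'" using F G by auto
  have "a \<le> a'" using reduced_leading_min[OF bds(1,2) pr] eqs by simp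
  moreover have "a' \<le> a"
  proof -
    have "(s, -r) \<noteq> (0,0)" using det by auto
    from reduced_leading_min[OF bds(3,4) this] show ?thesis using a_eq by simp
  qed
  ultimately have aa: "a' = a" by simp
  have fin: "(a',b',c') = (a,b,c)" if "b' = b"
  proof -
    have "4*a*c' = 4*a*c" using Fd(2) Gd(2) unfolding that aa by linarith
    then show ?thesis using Fd(1) that aa by simp
  qed
  have main: "bqf_act f p q r s = f \<and> ((q = 0 \<and> r = 0 \<and> p = s \<and> \<bar>p\<bar> = 1) \<or> (\<exists>k. f = (k,k,k)))"
  proof (cases "r = 0")
    case True
    then have ps: "p*s = 1" using det by simp
    then have ps': "p = s" "\<bar>p\<bar> = 1" by (auto simp: zmult_eq_1_iff)
    have bb: "b' = b + 2*(a*(p*q))" using eqs(2) True ps by simp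
    \<comment> \<open>The matrix is a translation up to sign; it changes \<open>b\<close> by a
      multiple of \<open>2a\<close>, and both values lie in an interval of that length.\<close>
    have "b' - b < 2*a" "b' - b > -2*a" using F G aa by auto
    then have "a*(p*q) < a*1" "a*(-1) < a*(p*q)" using bb by auto
    then have "p*q < 1" "-1 < p*q" using Fd(1) mult_less_cancel_left_pos by blast+
    then have "p*q = 0" by linarith
    then have q0: "q = 0" using ps by auto
    then show ?thesis using True ps' bb fin ge fe by simp
  next
    case r: False
    show ?thesis
    proof (cases "p = 0")
      case False
      \<comment> \<open>Here \<open>(p,r)\<close> is a minimal vector off the axes, so the bound
        leaves only \<open>c = a = \<bar>b\<bar>\<close>, and reducedness fixes the sign of
        \<open>b\<close>.\<close>
      have "a + c - \<bar>b\<bar> \<le> a" using reduced_value_bound[OF bds(1,2) False r] eqs aa by simp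
      then have "c = a" "\<bar>b\<bar> = a" using bds by auto
      then have fk: "c = a" "b = a" using F by auto
      have "4*a*c' = b'^2 + 3*a^2" using Fd Gd aa fk by (simp add: power2_eq_square)
      moreover have "4*a*c' \<ge> 4*a*a" using bds aa Fd(1) by simp
      ultimately have "a^2 \<le> b'^2" by (simp add: power2_eq_square)
      then have "a \<le> \<bar>b'\<bar>" using Fd(1) abs_le_square_iff[of a b'] by simp
      then have "b' = a" using G aa by auto
      then show ?thesis using fin fk ge fe by simp
    next
      \<comment> \<open>An exchange of variables followed by a translation. The bounds on
        \<open>b\<close> and \<open>b'\<close> leave \<open>r s = 0\<close>, which would give
        \<open>b' = -b < 0\<close> although \<open>a' = c'\<close>, and \<open>r s = 1\<close>,
        which gives \<open>b = b' = a\<close>.\<close>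
      case True
      then have qr: "q*r = -1" using det by simp
      then have r2: "r^2 = 1" by (auto simp: zmult_eq_neg1_iff)
      then have ca: "c = a" using eqs(1) True aa by simp
      then have b0: "0 \<le> b" using F by auto
      have bb: "b' = -b + 2*(a*(r*s))" using eqs(2) True qr ca by (simp add: algebra_simps)
      have bpos: "b > 0" using b0 b(1) by (cases "b = 0") auto
      have "2*(a*(r*s)) > -2*a + 0" using bb F G aa b0 by linarith
      then have "a*(-1) < a*(r*s)" by simp
      then have "-1 < r*s" using Fd(1) mult_less_cancel_left_pos by blast
      moreover have "2*(a*(r*s)) \<le> 2*a" using bb F G aa by linarith
      then have "a*(r*s) \<le> a*1" by simp
      then have "r*s \<le> 1" using Fd(1) by simp
      ultimately consider "r*s = 0" | "r*s = 1" by linarith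
      then show ?thesis
      proof cases
        case 1
        then have bn: "b' = -b" using bb by simp
        then have "4*a*c' = 4*a*a" using Fd(2) Gd(2) unfolding bn ca aa power2_minus by linarith
        then have "c' = a" using Fd(1) by simp
        then have "b' \<ge> 0" using G aa by auto
        then show ?thesis using bn bpos by simp
      next
        case 2
        then have "b + b' = 2*a" using bb by simp
        then have "b = a" "b' = a" using F G aa by linarith+
        then show ?thesis using fin ca ge fe by simp
      qed
    qed
  qed
  show "bqf_act f p q r s = f" by (rule conjunct1[OF main])
  show "(q = 0 \<and> r = 0 \<and> p = s \<and> \<bar>p\<bar> = 1) \<or> (\<exists>k. f = (k,k,k))" by (rule conjunct2[OF main])
qed

text \<open>Since \<open>b^2 \<le> a^2 \<le> a c\<close>, the discriminant gives
  \<open>3 a c \<le> n\<close>.\<close>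

lemma finite_reduced_forms:
  assumes "n > 0" shows "finite (reduced_forms n)"
proof -
  have "reduced_forms n \<subseteq> {0..n} \<times> {-n..n} \<times> {0..n}"
  proof
    fix f assume f: "f \<in> reduced_forms n"
    obtain a b c where fe: "f = (a,b,c)" by (cases f)
    note F = f[unfolded fe reduced_forms_def, simplified]
    have Fd: "a > 0" "4*a*c - b^2 = n" using F assms mem_pos_def_forms by blast+
    have "\<bar>b\<bar> \<le> \<bar>a\<bar>" using F by auto
    then have "b^2 \<le> a^2" by (simp add: abs_le_square_iff)
    also have "a^2 \<le> a*c" using F Fd by (simp add: power2_eq_square)
    finally have ac: "3*(a*c) \<le> n" using Fd(2) by linarith
    have "c*1 \<le> c*a" "a*1 \<le> a*c" using F Fd(1) by (intro mult_left_mono; simp)+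
    then have "a \<le> n" "c \<le> n" using ac F Fd(1) mult.commute[of a c] by linarith+
    then show "f \<in> {0..n} \<times> {-n..n} \<times> {0..n}" using F Fd(1) fe by auto
  qed
  then show ?thesis by (rule finite_subset) simp
qed

lemma reduced_mem: "f \<in> reduced_forms n \<Longrightarrow> f \<in> pos_def_forms (-n)"
  by (auto simp: reduced_forms_def)

lemma reduced_equiv_imp_eq:
  assumes "n > 0" "odd n" "f \<in> reduced_forms n" "g \<in> reduced_forms n" "bqf_SL2_equiv f g"
  shows "f = g"
  using assms(5) reduced_unique(1)[OF assms(1-3)] assms(4) unfolding bqf_SL2_equiv_iff by metis

lemma bij_reduced_classes:
  assumes "n > 0" "odd n"
  shows "bij_betw (bqf_class n) (reduced_forms n) (form_classes (-n))"
proof (rule bij_betw_imageI)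
  show "inj_on (bqf_class n) (reduced_forms n)"
    by (rule inj_onI) (metis assms bqf_class_eq_iff reduced_equiv_imp_eq reduced_mem)
  show "bqf_class n ` reduced_forms n = form_classes (-n)"
  proof (unfold form_classes_eq, intro equalityI subsetI)
    fix C assume "C \<in> bqf_class n ` reduced_forms n"
    then show "C \<in> bqf_class n ` pos_def_forms (-n)" using reduced_mem by blast
  next
    fix C assume "C \<in> bqf_class n ` pos_def_forms (-n)"
    then obtain f where f: "f \<in> pos_def_forms (-n)" "C = bqf_class n f" by blast
    obtain g where g: "g \<in> reduced_forms n" "bqf_SL2_equiv f g"
      using exists_reduced[OF assms(1) f(1)] by blast
    have "C = bqf_class n g" using bqf_class_eq_iff[OF f(1) reduced_mem[OF g(1)]] g(2) f(2) by simp
    then show "C \<in> bqf_class n ` reduced_forms n" using g(1) by blast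
  qed
qed

lemma finite_form_classes:
  assumes "n > 0" "odd n" shows "finite (form_classes (-n))"
  using bij_reduced_classes[OF assms] finite_reduced_forms[OF assms(1)] bij_betw_finite by blast

text \<open>A form \<open>(k,0,k)\<close> has even discriminant, so weight 1/2 does not occur. A
  form \<open>(k,k,k)\<close> has discriminant \<open>-3k^2\<close> with \<open>k > 0\<close>; hence
  at most one class has weight 1/3, and it costs 2/3 before multiplication by 3.\<close>

lemma hurwitz_eq:
  assumes n: "n > 0" "[n = 3] (mod 4)"
  shows "3 * hurwitz_class_number n =
     of_int (3 * int (card (form_classes (-n))) - (if \<exists>k. n = 3*k^2 then 2 else 0))"
proof -
  have od: "odd n" using mod4_3_odd n(2) .
  have no0: "(k,0,k) \<notin> C" if "C \<in> form_classes (-n)" for C k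
  proof
    assume "(k,0,k) \<in> C"
    then have "(k,0,k) \<in> pos_def_forms (-n)" using that
      by (auto simp: form_classes_eq mem_bqf_class)
    then show False using n od by (auto simp: mem_pos_def_forms)
  qed
  have wt: "class_weight C = (if \<exists>k. (k,k,k) \<in> C then 1/3 else 1)" if "C \<in> form_classes (-n)" for C
    using no0[OF that] by (simp add: class_weight_def)
  let ?S = "{C \<in> form_classes (-n). \<exists>k. (k,k,k) \<in> C}"
  have fin: "finite (form_classes (-n))" using finite_form_classes n od by blast
  have kk: "k > 0 \<and> n = 3*k^2" if "(k,k,k) \<in> pos_def_forms (-n)" for k
    using that n by (auto simp: mem_pos_def_forms power2_eq_square)
  have cardS: "card ?S = (if \<exists>k. n = 3*k^2 then 1 else 0)"
  proof (cases "\<exists>k. n = 3*k^2")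
    case True
    then obtain k0 where k0: "n = 3*k0^2" by blast
    define k where "k = \<bar>k0\<bar>"
    have k: "n = 3*k^2" "k > 0" using k0 n(1) unfolding k_def by auto
    have kf: "(k,k,k) \<in> pos_def_forms (-n)" using k n by (simp add: mem_pos_def_forms power2_eq_square)
    have "?S = {bqf_class n (k,k,k)}"
    proof
      show "{bqf_class n (k,k,k)} \<subseteq> ?S"
        using kf bqf_SL2_equiv_refl by (auto simp: form_classes_eq mem_bqf_class)
      show "?S \<subseteq> {bqf_class n (k,k,k)}"
      proof
        fix C assume C: "C \<in> ?S"
        then obtain f j where f: "f \<in> pos_def_forms (-n)" "C = bqf_class n f" "(j,j,j) \<in> C"
          by (auto simp: form_classes_eq)
        then have j: "(j,j,j) \<in> pos_def_forms (-n)" "bqf_SL2_equiv f (j,j,j)" by (auto simp: mem_bqf_class)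
        have "j^2 = k^2" "j > 0" using kk[OF j(1)] k by auto
        then have "j = k" using k(2) by (simp add: power2_eq_iff)
        then show "C \<in> {bqf_class n (k,k,k)}" using j f kf bqf_class_eq_iff by simp
      qed
    qed
    then have "card ?S = 1" by simp
    then show ?thesis using True by simp
  next
    case False
    have "?S = {}"
      using False kk by (auto simp: form_classes_eq mem_bqf_class)
    then show ?thesis using False by (metis card.empty)
  qed
  have "hurwitz_class_number n = (\<Sum>C\<in>form_classes (-n). class_weight C)"
    using n by (auto simp: hurwitz_class_number_def cong_def)
  also have "\<dots> = (\<Sum>C\<in>form_classes (-n). 1 - (if \<exists>k. (k,k,k) \<in> C then 2/3 else 0))"
    by (rule sum.cong) (auto simp: wt)
  also have "\<dots> = of_nat (card (form_classes (-n))) - (\<Sum>C\<in>form_classes (-n). if \<exists>k. (k,k,k) \<in> C then 2/3 else 0)"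
    by (simp add: sum_subtractf)
  also have "(\<Sum>C\<in>form_classes (-n). if \<exists>k. (k,k,k) \<in> C then 2/3 else 0) = (\<Sum>C\<in>?S. 2/3 :: rat)"
    using fin by (simp add: sum.If_cases Int_def)
  also have "\<dots> = (if \<exists>k. n = 3*k^2 then 2/3 else 0)" using cardS by simp
  finally have "hurwitz_class_number n = of_nat (card (form_classes (-n))) - (if \<exists>k. n = 3*k^2 then 2/3 else 0)" .
  then show ?thesis by (cases "\<exists>k. n = 3*k^2") (simp_all only: if_True if_False, simp_all)
qed

section \<open>The number of divisors\<close>

definition num_divisors :: "nat \<Rightarrow> nat" where
  "num_divisors m = card {d. d dvd m}"

lemma multiplicity_prime_power_times:
  assumes "prime (p::nat)" "\<not> p dvd k"
  shows "multiplicity p (p^e * k) = e"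
proof -
  have "k \<noteq> 0" using assms(2) by (metis dvd_0_right)
  moreover have "p^e \<noteq> 0" using assms(1) by auto
  ultimately show ?thesis
    using assms by (simp add: prime_elem_multiplicity_mult_distrib prime_imp_prime_elem not_dvd_imp_multiplicity_0)
qed

text \<open>A divisor is a power of \<open>p\<close> times a divisor of \<open>k\<close>, and the
  multiplicity of \<open>p\<close> recovers the power.\<close>

lemma num_divisors_prime_power_mult:
  assumes p: "prime (p::nat)" and k: "\<not> p dvd k" "k > 0"
  shows "num_divisors (p^e * k) = (e + 1) * num_divisors k"
proof -
  have inj: "inj_on (\<lambda>(i, d). p^i * d) ({..e} \<times> {d. d dvd k})"
  proof (rule inj_onI, clarify)
    fix i d j d'
    assume d: "d dvd k" "d' dvd k" and eq: "p^i * d = p^j * d'"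
    have "\<not> p dvd d" "\<not> p dvd d'" using d k by (meson dvd_trans)+
    then have m: "multiplicity p (p^i * d) = i" "multiplicity p (p^j * d') = j"
      using p multiplicity_prime_power_times by blast+
    then have "i = j" using eq by simp
    then show "i = j \<and> d = d'" using eq p prime_gt_0_nat by auto
  qed
  have "{d. d dvd p^e * k} = (\<lambda>(i, d). p^i * d) ` ({..e} \<times> {d. d dvd k})"
  proof (intro equalityI subsetI)
    fix d assume "d \<in> {d. d dvd p^e * k}"
    then have "d dvd p^e * k" by simp
    then obtain x y where xy: "d = x * y" "x dvd p^e" "y dvd k" using division_decomp by blast
    obtain i where i: "i \<le> e" "x = p^i" using xy(2) divides_primepow_nat[OF p] by blast
    then have "(i, y) \<in> {..e} \<times> {d. d dvd k}" "d = (\<lambda>(i, d). p^i * d) (i, y)" using xy by simp_all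
    then show "d \<in> (\<lambda>(i, d). p^i * d) ` ({..e} \<times> {d. d dvd k})" by (rule rev_image_eqI)
  qed (auto simp: mult_dvd_mono le_imp_power_dvd)
  then have "num_divisors (p^e * k) = card ({..e} \<times> {d. d dvd k})"
    using card_image[OF inj] by (simp add: num_divisors_def)
  then show ?thesis by (simp add: num_divisors_def card_cartesian_product)
qed

lemma card_large_divisors:
  assumes "m > 0"
  shows "card {d. d dvd m \<and> d * d > m} = card {d::nat. d dvd m \<and> d * d < m}"
proof -
  have key: "m < (m div d) * (m div d)" if "d dvd m" "d * d < m" for d
  proof -
    from \<open>d dvd m\<close> obtain e where e: "m = d * e" by (rule dvdE)
    have d: "d > 0" using assms e by (intro Nat.gr0I) simp
    then have "d < e" using that(2) unfolding e by simp
    then have "d * e < e * e" by simp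
    moreover have "m div d = e" using e d by simp
    ultimately show ?thesis using e by simp
  qed
  have key': "(m div d) * (m div d) < m" if "d dvd m" "m < d * d" for d
  proof -
    from \<open>d dvd m\<close> obtain e where e: "m = d * e" by (rule dvdE)
    have d: "d > 0" "e > 0" using assms e by (auto intro!: Nat.gr0I)
    then have "e < d" using that(2) unfolding e by simp
    then have "e * e < d * e" using d(2) by simp
    moreover have "m div d = e" using e d by simp
    ultimately show ?thesis using e by simp
  qed
  have inv: "m div (m div d) = d" if "d dvd m" for d
  proof -
    from \<open>d dvd m\<close> obtain e where e: "m = d * e" by (rule dvdE)
    then have "d > 0" "e > 0" using assms by auto
    then show ?thesis using e by simp
  qed
  have dv: "m div d dvd m" if "d dvd m" for d using that by (metis dvd_div_mult_self dvd_triv_left)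
  have "bij_betw (\<lambda>d. m div d) {d. d dvd m \<and> d * d > m} {d. d dvd m \<and> d * d < m}"
    by (rule bij_betw_byWitness[where f' = "\<lambda>d. m div d"]) (use key key' inv dv in blast)+
  then show ?thesis by (rule bij_betw_same_card)
qed

lemma num_divisors_split:
  assumes "m > 0"
  shows "num_divisors m = 2 * card {d::nat. d dvd m \<and> d * d < m} + (if \<exists>k. m = k^2 then 1 else 0)"
proof -
  let ?L = "{d::nat. d dvd m \<and> d * d < m}" and ?G = "{d. d dvd m \<and> d * d > m}"
  let ?E = "{d. d dvd m \<and> d * d = m}"
  have fin: "finite {d. d dvd m}" using assms by simp
  have "?L \<subseteq> {d. d dvd m}" "?G \<subseteq> {d. d dvd m}" "?E \<subseteq> {d. d dvd m}" by blast+
  then have f: "finite ?L" "finite ?G" "finite ?E" using fin finite_subset by blast+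
  have "{d. d dvd m} = (?L \<union> ?G) \<union> ?E" using less_linear by blast
  then have "num_divisors m = card ((?L \<union> ?G) \<union> ?E)" unfolding num_divisors_def by (rule arg_cong)
  moreover have "card ((?L \<union> ?G) \<union> ?E) = card (?L \<union> ?G) + card ?E"
    by (rule card_Un_disjoint) (use f in auto)
  moreover have "card (?L \<union> ?G) = card ?L + card ?G"
    by (rule card_Un_disjoint) (use f in auto)
  moreover have "card ?E = (if \<exists>k. m = k^2 then 1 else 0)"
  proof (cases "\<exists>k. m = k^2")
    case True
    then obtain k where "m = k^2" by blast
    moreover have "d = k" if "d * d = k^2" for d
      using that power2_eq_iff_nonneg[of d k] by (simp add: power2_eq_square)
    ultimately have "?E = {k}" by (intro equalityI subsetI) (simp_all add: power2_eq_square)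
    then show ?thesis using True by simp
  next
    case False
    then have "?E = {}" by (auto simp: power2_eq_square)
    then show ?thesis using False by (metis card.empty)
  qed
  ultimately show ?thesis using card_large_divisors[OF assms] by linarith
qed

lemma odd_num_divisors_iff: "m > 0 \<Longrightarrow> odd (num_divisors m) \<longleftrightarrow> (\<exists>k. m = k^2)"
  by (simp add: num_divisors_split)

lemma prime_power_decomp:
  assumes "prime (p::nat)" "m > 0"
  obtains e k where "m = p^e * k" "\<not> p dvd k" "k > 0"
  using assms multiplicity_decompose'[of m p] not_prime_unit[of p]
  by (metis gr0I mult_0_right not_gr_zero)

text \<open>If a prime has even exponent, removing its full power leaves a smaller number that is
  again not a square.\<close>

lemma nonsquare_odd_exponent:
  assumes "(m::nat) > 0" "\<nexists>k. m = k^2"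
  shows "\<exists>p e k. prime p \<and> odd e \<and> \<not> p dvd k \<and> k > 0 \<and> m = p^e * k"
  using assms
proof (induction m rule: less_induct)
  case (less m)
  have "m \<noteq> 1" using less.prems(2) by (metis power_one)
  then obtain p where p: "prime p" "p dvd m" using prime_factor_nat by blast
  obtain e k where ek: "m = p^e * k" "\<not> p dvd k" "k > 0" using prime_power_decomp p(1) less.prems(1) by blast
  show ?case
  proof (cases "odd e")
    case True then show ?thesis using p ek by blast
  next
    case False
    then obtain j where j: "e = 2*j" by blast
    have nsq: "\<nexists>i. k = i^2"
    proof
      assume "\<exists>i. k = i^2"
      then obtain i where "k = i^2" by blast
      then have "m = (p^j*i)^2" using ek j by (simp add: power_mult_distrib power_mult[symmetric] mult.commute)
      then show False using less.prems(2) by blast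
    qed
    have "e > 0" using p ek by (intro Nat.gr0I) auto
    then have "p^e > 1" using prime_gt_1_nat[OF p(1)] one_less_power by blast
    then have "k < m" using ek by simp
    then obtain q f i where q: "prime q" "odd f" "\<not> q dvd i" "i > 0" "k = q^f * i"
      using less.IH nsq ek(3) by blast
    have "q dvd k" using q by (metis dvd_mult2 dvd_power odd_pos)
    then have "p \<noteq> q" using ek(2) by auto
    then have "\<not> q dvd p^e * i" using p q by (metis prime_dvd_mult_iff prime_dvd_power primes_dvd_imp_eq)
    moreover have "m = q^f * (p^e * i)" using ek q by simp
    moreover have "p^e * i > 0" using p q prime_gt_0_nat by simp
    ultimately show ?thesis using q by blast
  qed
qed

text \<open>These are the factorizations \<open>m = u v\<close> with \<open>u < v\<close>, which is
  half the divisors when \<open>m\<close> is not a square. The number reappears as the number of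
  ambiguous reduced forms and as the order of the 2-torsion of the class group.\<close>

definition num_ambiguous :: "nat \<Rightarrow> nat" where
  "num_ambiguous m = card {d. d dvd m \<and> d * d < m}"

lemma num_divisors_nonsquare:
  "m > 0 \<Longrightarrow> \<nexists>k. m = k^2 \<Longrightarrow> num_divisors m = 2 * num_ambiguous m"
  using num_divisors_split[of m] by (simp add: num_ambiguous_def)

lemma odd_exponent_nonsquare:
  assumes "prime (p::nat)" "odd e" "\<not> p dvd k"
  shows "p^e * k \<noteq> i^2"
proof
  assume eq: "p^e * k = i^2"
  have "k \<noteq> 0" using assms(3) by (metis dvd_0_right)
  have "multiplicity p (p^e * k) = e"
    using assms multiplicity_prime_power_times by blast
  moreover have "i \<noteq> 0" using eq \<open>k \<noteq> 0\<close> assms by (metis mult_eq_0_iff not_prime_0 power_not_zero zero_power2)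
  then have "multiplicity p (i^2) = 2 * multiplicity p i"
    using assms by (simp add: prime_elem_multiplicity_power_distrib prime_imp_prime_elem)
  ultimately have "e = 2 * multiplicity p i" using eq by simp
  then show False using assms(2) by simp
qed

text \<open>For \<open>m = p^e k\<close> with \<open>e = 2j + 1\<close>, half the number of divisors
  is \<open>j + 1\<close> times that of \<open>k\<close>. It is odd exactly when \<open>j\<close> is
  even and \<open>k\<close> is a square, whence the exponent \<open>4a + 1\<close>.\<close>

lemma odd_num_ambiguous_iff:
  assumes "m > 0" "\<nexists>k. m = k^2"
  shows "odd (num_ambiguous m) \<longleftrightarrow> (\<exists>p a k. prime p \<and> \<not> p dvd k \<and> m = p^(4*a+1) * k^2)"
proof
  assume od: "odd (num_ambiguous m)"
  obtain p e k where pek: "prime p" "odd e" "\<not> p dvd k" "k > 0" "m = p^e * k"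
    using nonsquare_odd_exponent assms by blast
  obtain j where j: "e = 2*j + 1" using pek(2) by (auto elim: oddE)
  have "2 * num_ambiguous m = 2 * ((j + 1) * num_divisors k)"
    using num_divisors_nonsquare[OF assms] num_divisors_prime_power_mult[OF pek(1,3,4), of e] pek(5) j by simp
  then have "num_ambiguous m = (j + 1) * num_divisors k" by linarith
  then have od2: "odd ((j + 1) * num_divisors k)" using od by metis
  then obtain i where i: "k = i^2" using odd_num_divisors_iff pek(4) by auto
  obtain a where "j = 2*a" using od2 by (auto elim: evenE)
  then have "m = p^(4*a+1) * i^2" using pek(5) j i by simp
  moreover have "\<not> p dvd i" using pek(3) i by (metis dvd_trans dvd_power pos2)
  ultimately show "\<exists>p a k. prime p \<and> \<not> p dvd k \<and> m = p^(4*a+1) * k^2" using pek(1) by blast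
next
  assume "\<exists>p a k. prime p \<and> \<not> p dvd k \<and> m = p^(4*a+1) * k^2"
  then obtain p a k where pak: "prime p" "\<not> p dvd k" "m = p^(4*a+1) * k^2" by blast
  have k: "\<not> p dvd k^2" "k^2 > 0" using pak assms(1) prime_dvd_power by auto
  have "2 * num_ambiguous m = (4*a + 2) * num_divisors (k^2)"
    using num_divisors_nonsquare[OF assms] num_divisors_prime_power_mult[OF pak(1) k, of "4*a+1"] pak(3) by simp
  then have "num_ambiguous m = (2*a + 1) * num_divisors (k^2)" by simp
  moreover have "odd (num_divisors (k^2))" using odd_num_divisors_iff k(2) by blast
  ultimately show "odd (num_ambiguous m)" by simp
qed

section \<open>Ambiguous reduced forms\<close>

text \<open>The reduced forms equivalent to \<open>(a,-b,c)\<close>. The third classical type,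
  \<open>b = 0\<close>, is impossible for odd \<open>n\<close>.\<close>

definition ambiguous_forms :: "int \<Rightarrow> bqf set" where
  "ambiguous_forms n = {(a,b,c). (a,b,c) \<in> reduced_forms n \<and> (b = a \<or> a = c)}"

text \<open>A form \<open>(a,a,c)\<close> factors \<open>n\<close> as \<open>a (4c - a)\<close>, a
  form \<open>(a,b,a)\<close> as \<open>(2a - b)(2a + b)\<close>. For \<open>n = u v\<close> with
  \<open>u < v\<close>, each type yields a form, and exactly one of the two is reduced: the first if
  \<open>3u \<le> v\<close>, the second otherwise. \<open>phi\<close> and \<open>psi\<close> are
  these mutually inverse maps.\<close>

lemma card_ambiguous_forms:
  assumes n: "n > 0" "[n = 3] (mod 4)"
  shows "card (ambiguous_forms n) = num_ambiguous (nat n)"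
proof -
  define U where "U = {u::int. u > 0 \<and> u dvd n \<and> u * u < n}"
  have od: "odd n" using mod4_3_odd n(2) .
  define phi :: "bqf \<Rightarrow> int" where "phi = (\<lambda>(a,b,c). if b = a then a else 2*a - b)"
  define psi :: "int \<Rightarrow> bqf" where
    "psi = (\<lambda>u. let v = n div u in if 3*u \<le> v then (u,u,(u+v) div 4) else ((u+v) div 4, (v-u) div 2, (u+v) div 4))"
  \<comment> \<open>One factor is 1 and the other 3 modulo 4; this makes the coefficient
    \<open>(u + v) / 4\<close> in \<open>psi\<close> an integer.\<close>
  have four: "\<exists>k. u + v = 4*k" if "u * v = n" for u v :: int
  proof -
    have "(u mod 4) * (v mod 4) mod 4 = 3" using that n(2) by (simp add: cong_def mod_mult_eq)
    moreover have "u mod 4 \<in> {0,1,2,3}" "v mod 4 \<in> {0,1,2,3}" by (simp_all, presburger+)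
    ultimately have "(u mod 4 = 1 \<and> v mod 4 = 3) \<or> (u mod 4 = 3 \<and> v mod 4 = 1)" by auto
    then have "(u + v) mod 4 = 0" by presburger
    then show ?thesis by (metis dvd_def mod_0_imp_dvd)
  qed
  have phi: "phi f \<in> U \<and> psi (phi f) = f" if "f \<in> ambiguous_forms n" for f
  proof -
    obtain a b c where fe: "f = (a,b,c)" by (cases f)
    have F: "a > 0" "4*a*c - b^2 = n" "-a < b" "b \<le> a" "a \<le> c" "a = c \<longrightarrow> 0 \<le> b" "b = a \<or> a = c"
      using that n fe by (auto simp: ambiguous_forms_def reduced_forms_iff)
    have bo: "odd b" using that fe n od pos_def_forms_odd reduced_mem by (fastforce simp: ambiguous_forms_def)
    show ?thesis
    proof (cases "b = a")
      case True
      have nn: "n = a * (4*c - a)" using F(2) True by (simp add: power2_eq_square algebra_simps)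
      then have dv: "n div a = 4*c - a" using F(1) by simp
      have "a < 4*c - a" using F by linarith
      then have "a * a < n" using nn F(1) by simp
      then show ?thesis using True F dv nn fe by (auto simp: phi_def psi_def U_def Let_def)
    next
      case False
      then have ca: "c = a" "0 \<le> b" "b < a" using F by auto
      have b0: "b > 0" using bo ca(2) by (cases "b = 0") auto
      have nn: "n = (2*a - b) * (2*a + b)" using F(2) ca by (simp add: power2_eq_square algebra_simps)
      have u0: "2*a - b > 0" using F by linarith
      then have dv: "n div (2*a - b) = 2*a + b" using nn by simp
      have "2*a - b < 2*a + b" using b0 by linarith
      then have "(2*a - b) * (2*a - b) < n" unfolding nn using u0 by (rule mult_strict_left_mono)
      moreover have "\<not> 3*(2*a - b) \<le> 2*a + b" using ca(3) by simp
      ultimately show ?thesis using False ca dv nn u0 fe by (auto simp: phi_def psi_def U_def Let_def)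
    qed
  qed
  have psi: "psi u \<in> ambiguous_forms n \<and> phi (psi u) = u" if "u \<in> U" for u
  proof -
    have u: "u > 0" "u * u < n" using that by (auto simp: U_def)
    have "u dvd n" using that by (simp add: U_def)
    then obtain v where v: "n = u * v" by (rule dvdE)
    have dv: "n div u = v" using v u by simp
    have uv: "u < v" using v u by simp
    obtain k where k: "u + v = 4*k" using four v by blast
    have ve: "v = 4*k - u" using k by simp
    show ?thesis
    proof (cases "3*u \<le> v")
      case True
      have "psi u = (u,u,k)" using True dv k by (simp add: psi_def)
      moreover have "(u,u,k) \<in> reduced_forms n"
        unfolding reduced_forms_iff[OF n(1)] using u True v ve
        by (auto simp: power2_eq_square algebra_simps)
      ultimately show ?thesis by (simp add: ambiguous_forms_def phi_def)
    next
      case False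
      have e: "(v - u) div 2 = 2*k - u" using ve by simp
      have "psi u = (k,2*k - u,k)" using False dv k e by (simp add: psi_def)
      moreover have "(k,2*k-u,k) \<in> reduced_forms n"
        unfolding reduced_forms_iff[OF n(1)] using u uv False v ve
        by (auto simp: power2_eq_square algebra_simps)
      moreover have "2*k - u \<noteq> k" using False ve by linarith
      ultimately show ?thesis by (simp add: ambiguous_forms_def phi_def)
    qed
  qed
  have "bij_betw phi (ambiguous_forms n) U"
    by (rule bij_betw_byWitness[where f' = psi]) (use phi psi in auto)
  then have "card (ambiguous_forms n) = card U" by (rule bij_betw_same_card)
  also have "U = int ` {d. d dvd nat n \<and> d * d < nat n}"
  proof (intro equalityI subsetI)
    fix u assume u: "u \<in> U"
    then have "int (nat u) dvd int (nat n)" "int (nat u) * int (nat u) < int (nat n)" using n(1) by (auto simp: U_def)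
    then have "nat u \<in> {d. d dvd nat n \<and> d * d < nat n}"
      by (metis (mono_tags) int_dvd_int_iff mem_Collect_eq of_nat_less_iff of_nat_mult)
    moreover have "u = int (nat u)" using u by (simp add: U_def)
    ultimately show "u \<in> int ` {d. d dvd nat n \<and> d * d < nat n}" by blast
  next
    fix u assume "u \<in> int ` {d. d dvd nat n \<and> d * d < nat n}"
    then obtain d where d: "u = int d" "d dvd nat n" "d * d < nat n" by blast
    have "int d dvd int (nat n)" using d(2) by (simp only: int_dvd_int_iff)
    moreover have "int d * int d < int (nat n)" using d(3) by (simp only: of_nat_less_iff of_nat_mult[symmetric])
    moreover have "d > 0" using d(2) n(1) by (intro Nat.gr0I) simp
    moreover have "int (nat n) = n" using n(1) by simp
    ultimately have "int d dvd n" "int d * int d < n" "int d > 0" by simp_all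
    then show "u \<in> U" using d(1) n(1) by (simp add: U_def)
  qed
  also have "card \<dots> = num_ambiguous (nat n)" by (simp add: card_image num_ambiguous_def)
  finally show ?thesis .
qed

lemma card_form_classes_parity:
  assumes n: "n > 0" "[n = 3] (mod 4)"
  shows "even (card (form_classes (-n))) \<longleftrightarrow> even (num_ambiguous (nat n))"
proof -
  have od: "odd n" using mod4_3_odd n(2) .
  let ?R = "reduced_forms n" and ?A = "ambiguous_forms n"
  define P where "P = {(a,b,c). (a,b,c) \<in> ?R \<and> b \<noteq> a \<and> a \<noteq> c \<and> b > 0}"
  define M where "M = {(a,b,c). (a,b,c) \<in> ?R \<and> b \<noteq> a \<and> a \<noteq> c \<and> b < 0}"
  have b0: "b \<noteq> 0" if "(a,b,c) \<in> ?R" for a b c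
    using pos_def_forms_odd[OF n(1) od reduced_mem[OF that]] by auto
  have "?R = ?A \<union> (P \<union> M)"
    using b0 by (auto simp: ambiguous_forms_def P_def M_def) (metis linorder_neqE_linordered_idom)+
  moreover have fin: "finite ?R" using finite_reduced_forms n(1) .
  moreover have "finite ?A" "finite P" "finite M"
    by (rule finite_subset[OF _ fin]; auto simp: ambiguous_forms_def P_def M_def)+
  moreover have "?A \<inter> (P \<union> M) = {}" "P \<inter> M = {}" by (auto simp: ambiguous_forms_def P_def M_def)
  ultimately have "card ?R = card ?A + (card P + card M)" by (simp add: card_Un_disjoint)
  moreover have "bij_betw (\<lambda>(a,b,c). (a,-b,c)) P M"
    by (rule bij_betw_byWitness[where f' = "\<lambda>(a,b,c). (a,-b,c)"])
       (use n(1) in \<open>auto simp: P_def M_def reduced_forms_iff\<close>)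
  then have "card P = card M" by (rule bij_betw_same_card)
  moreover have "card (form_classes (-n)) = card ?R"
    using bij_betw_same_card[OF bij_reduced_classes[OF n(1) od]] by simp
  ultimately show ?thesis using card_ambiguous_forms[OF n] by simp
qed

section \<open>Passing from discriminant -N to -l^2 N\<close>

text \<open>Primitivity at one prime only: the recursion runs over powers of a fixed
  \<open>l\<close>, and common factors prime to \<open>l\<close> are carried along
  unchanged.\<close>

definition primitive_at :: "int \<Rightarrow> bqf \<Rightarrow> bool" where
  "primitive_at l f = (case f of (a,b,c) \<Rightarrow> \<not> (l dvd a \<and> l dvd b \<and> l dvd c))"

definition reduced_primitive_at :: "int \<Rightarrow> int \<Rightarrow> bqf set" where
  "reduced_primitive_at l n = {f \<in> reduced_forms n. primitive_at l f}"

lemma primitive_at_act: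
  assumes "p*s - q*r = 1"
  shows "primitive_at l (bqf_act f p q r s) \<longleftrightarrow> primitive_at l f"
proof -
  have imp: "primitive_at l g" if "primitive_at l (bqf_act g p' q' r' s')" for g p' q' r' s'
    using that by (cases g) (auto simp: primitive_at_def bqf_act_simp)
  show ?thesis using imp[of f p q r s] imp[of "bqf_act f p q r s" s "-q" "-r" p]
    unfolding bqf_act_inverse[OF assms] by blast
qed

lemma primitive_at_equiv: "bqf_SL2_equiv f g \<Longrightarrow> primitive_at l f \<longleftrightarrow> primitive_at l g"
  unfolding bqf_SL2_equiv_iff using primitive_at_act by blast

lemma reduced_scale_iff:
  assumes "n > 0" "l > 0"
  shows "(l*a, l*b, l*c) \<in> reduced_forms (l^2*n) \<longleftrightarrow> (a,b,c) \<in> reduced_forms n"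
proof -
  have e: "4*(l*a)*(l*c) - (l*b)^2 = l^2*(4*a*c - b^2)" by (simp add: power2_eq_square algebra_simps)
  have m: "-(l*a) < l*b \<longleftrightarrow> -a < b" using assms(2) mult_less_cancel_left_pos[of l "-a" b] by simp
  have "l^2*n > 0" using assms by simp
  then show ?thesis using assms
    unfolding reduced_forms_iff[OF \<open>l^2*n > 0\<close>] reduced_forms_iff[OF assms(1)] e m
    by (simp add: zero_less_mult_iff zero_le_mult_iff)
qed

text \<open>The reduced forms that are not primitive at \<open>l\<close> are exactly the
  \<open>l\<close>-fold multiples of reduced forms of discriminant \<open>-n\<close>.\<close>

lemma card_reduced_forms_split:
  assumes "n > 0" "l > 0"
  shows "card (reduced_forms (l^2*n)) = card (reduced_primitive_at l (l^2*n)) + card (reduced_forms n)"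
proof -
  let ?s = "\<lambda>(a,b,c). (l*a,l*b,l*c::int)"
  let ?I = "?s ` reduced_forms n" and ?P = "reduced_primitive_at l (l^2*n)"
  have "l^2*n > 0" using assms by simp
  then have fin: "finite (reduced_forms (l^2*n))" by (rule finite_reduced_forms)
  have "f \<in> ?I" if f: "f \<in> reduced_forms (l^2*n)" "\<not> primitive_at l f" for f
  proof -
    obtain a b c where fe: "f = (a,b,c)" by (cases f)
    then have "l dvd a" "l dvd b" "l dvd c" using f(2) by (auto simp: primitive_at_def)
    then obtain a' b' c' where "a = l*a'" "b = l*b'" "c = l*c'" unfolding dvd_def by blast
    then have "f = ?s (a',b',c')" "(a',b',c') \<in> reduced_forms n"
      using fe f(1) reduced_scale_iff[OF assms] by auto
    then show ?thesis by (rule rev_image_eqI[rotated])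
  qed
  moreover have "f \<in> reduced_forms (l^2*n) \<and> \<not> primitive_at l f" if f: "f \<in> ?I" for f
    using f reduced_scale_iff[OF assms] by (auto simp: primitive_at_def)
  ultimately have "reduced_forms (l^2*n) = ?P \<union> ?I" "?P \<inter> ?I = {}"
    unfolding reduced_primitive_at_def by blast+
  moreover have "finite ?P" "finite ?I"
    using fin finite_reduced_forms[OF assms(1)] unfolding reduced_primitive_at_def by simp_all
  ultimately have "card (reduced_forms (l^2*n)) = card ?P + card ?I" using card_Un_disjoint by metis
  moreover have "inj_on ?s (reduced_forms n)" using assms(2) by (auto simp: inj_on_def)
  then have "card ?I = card (reduced_forms n)" by (rule card_image)
  ultimately show ?thesis by simp
qed

lemma reduced_primitive_at_eq:
  assumes "n > 0" "\<not> l^2 dvd n"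
  shows "reduced_primitive_at l n = reduced_forms n"
proof -
  have "primitive_at l (a,b,c)" if "(a,b,c) \<in> reduced_forms n" for a b c
  proof (rule ccontr)
    assume "\<not> primitive_at l (a,b,c)"
    then obtain a' b' c' where "a = l*a'" "b = l*b'" "c = l*c'" unfolding primitive_at_def dvd_def by auto
    then have "n = l^2 * (4*a'*c' - b'^2)"
      using that reduced_forms_iff[OF assms(1)] by (auto simp: power2_eq_square algebra_simps)
    then show False using assms(2) by simp
  qed
  then show ?thesis unfolding reduced_primitive_at_def by auto
qed

text \<open>This is \<open>f(x, l y)\<close>, the restriction of \<open>f\<close> to one sublattice
  of index \<open>l\<close>. The other sublattices are obtained by first applying a matrix of
  determinant 1.\<close>

definition raise_form :: "int \<Rightarrow> bqf \<Rightarrow> bqf" where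
  "raise_form l f = (case f of (a,b,c) \<Rightarrow> (a, l*b, l^2*c))"

lemma raise_form_mem:
  assumes "n > 0" "l > 0" "f \<in> pos_def_forms (-n)"
  shows "raise_form l f \<in> pos_def_forms (-(l^2*n))"
proof -
  obtain a b c where fe: "f = (a,b,c)" by (cases f)
  have "a > 0" "4*a*c - b^2 = n" using assms fe mem_pos_def_forms by blast+
  moreover have "4*a*(l^2*c) - (l*b)^2 = l^2*(4*a*c - b^2)" by (simp add: power2_eq_square algebra_simps)
  moreover have "l^2*n > 0" using assms by simp
  ultimately show ?thesis by (simp add: fe raise_form_def mem_pos_def_forms)
qed

text \<open>Conjugation by the diagonal matrix with entries 1 and \<open>l\<close> makes the group
  of matrices with lower left entry divisible by \<open>l\<close> act on raised forms.\<close>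

lemma raise_form_act:
  "raise_form l (bqf_act f p q (l*r) s) = bqf_act (raise_form l f) p (l*q) r s"
  by (cases f) (simp add: raise_form_def bqf_act_simp power2_eq_square algebra_simps)

text \<open>The last coefficient of a raised form is divisible by \<open>l\<close>, and so are its
  middle and last coefficients before the substitution. Hence \<open>l\<close> divides
  \<open>a Q^2\<close>, so it divides \<open>Q\<close>, and the matrix comes from one with lower
  left entry divisible by \<open>l\<close>.\<close>

lemma raise_form_equiv_imp:
  assumes l: "prime l" and na: "\<not> l dvd fst f"
    and eq: "bqf_SL2_equiv (raise_form l f) (raise_form l g)"
  shows "\<exists>p q r s. p*s - q*(l*r) = 1 \<and> g = bqf_act f p q (l*r) s"
proof -
  obtain a b c a' b' c' where fe: "f = (a,b,c)" and ge: "g = (a',b',c')" by (cases f, cases g)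
  obtain p Q r s where d: "p*s - Q*r = 1" and e: "raise_form l g = bqf_act (raise_form l f) p Q r s"
    using eq bqf_SL2_equiv_iff by blast
  have "l^2*c' = a*Q^2 + l*b*Q*s + l^2*c*s^2" using e by (simp add: fe ge raise_form_def bqf_act_simp)
  then have "a*Q^2 = l*(l*c' - b*Q*s - l*c*s^2)" by (simp add: power2_eq_square algebra_simps)
  then have "l dvd a*Q^2" by simp
  then have "l dvd Q" using l na fe by (simp add: prime_dvd_mult_iff prime_dvd_power_iff)
  then obtain q where q: "Q = l*q" unfolding dvd_def by blast
  have "raise_form l g = raise_form l (bqf_act f p q (l*r) s)" using e q raise_form_act by simp
  moreover have "l \<noteq> 0" using l by auto
  ultimately have "g = bqf_act f p q (l*r) s"
    unfolding raise_form_def by (auto split: prod.splits)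
  moreover have "p*s - q*(l*r) = 1" using d q by (simp add: algebra_simps)
  ultimately show ?thesis by blast
qed

lemma inverse_mod_prime:
  assumes "prime (l::int)" "\<not> l dvd a"
  shows "\<exists>t. l dvd b + a*t"
proof -
  have "coprime a l" using assms by (metis coprime_commute prime_imp_coprime)
  then obtain x where "[a*x = 1] (mod l)" using cong_solve_coprime_int by blast
  then have "l dvd a*x - 1" by (simp add: cong_iff_dvd_diff)
  then have "l dvd b*(-(a*x - 1))" by (metis dvd_minus_iff dvd_mult)
  moreover have "b*(-(a*x - 1)) = b + a*(-b*x)" by (simp add: algebra_simps)
  ultimately show ?thesis by metis
qed

text \<open>If \<open>l\<close> divided \<open>a\<close> and \<open>c\<close>, the discriminant
  would make it divide \<open>b\<close>; so after an exchange of variables \<open>l\<close> does not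
  divide \<open>a\<close>. A translation then makes \<open>b\<close> divisible by \<open>l\<close>,
  possible as \<open>l\<close> is odd, and the discriminant forces \<open>l^2\<close> to divide
  \<open>c\<close>.\<close>

lemma exists_raised_form:
  assumes n: "n > 0" and l: "prime l" "odd l"
    and h: "h \<in> pos_def_forms (-(l^2*n))" "primitive_at l h"
  shows "\<exists>g \<in> pos_def_forms (-n). \<not> l dvd fst g \<and> bqf_SL2_equiv h (raise_form l g)"
proof -
  have l0: "l > 0" using l(1) prime_gt_0_int by blast
  have n': "l^2*n > 0" using n l0 by simp
  have "\<exists>h' \<in> pos_def_forms (-(l^2*n)). bqf_SL2_equiv h h' \<and> \<not> l dvd fst h'"
  proof -
    obtain a b c where he: "h = (a,b,c)" by (cases h)
    have d: "4*a*c - b^2 = l^2*n" using h he n' mem_pos_def_forms by blast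
    consider "\<not> l dvd a" | "\<not> l dvd c" | "l dvd a" "l dvd c" by blast
    then show ?thesis
    proof cases
      case 1
      then show ?thesis using h(1) he bqf_SL2_equiv_refl by (metis fst_conv)
    next
      case 2
      have "bqf_act h 0 (-1) 1 0 = (c,-b,a)" by (simp add: he bqf_act_simp)
      moreover have "bqf_act h 0 (-1) 1 0 \<in> pos_def_forms (-(l^2*n))" using bqf_act_mem[OF n' h(1)] by simp
      moreover have "bqf_SL2_equiv h (bqf_act h 0 (-1) 1 0)"
        unfolding bqf_SL2_equiv_iff by (intro exI[of _ 0] exI[of _ "-1"] exI[of _ 1]) simp
      ultimately show ?thesis using 2 by (metis fst_conv)
    next
      case 3
      have "b^2 = 4*a*c - l^2*n" using d by simp
      moreover have "l dvd 4*a*c - l^2*n" using 3 by (simp add: power2_eq_square)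
      ultimately have "l dvd b" using l(1) by (metis prime_dvd_power)
      then show ?thesis using h(2) he 3 by (simp add: primitive_at_def)
    qed
  qed
  then obtain a b c where abc: "(a,b,c) \<in> pos_def_forms (-(l^2*n))" "bqf_SL2_equiv h (a,b,c)" "\<not> l dvd a"
    by (metis fst_conv prod_cases3)
  have "\<not> l dvd 2" using l primes_dvd_imp_eq[of l 2] by auto
  then have "\<not> l dvd 2*a" using abc(3) l(1) by (simp add: prime_dvd_mult_iff)
  then obtain t where t: "l dvd b + (2*a)*t" using inverse_mod_prime[OF l(1)] by blast
  then obtain b' where b': "b + 2*a*t = l*b'" unfolding dvd_def by blast
  define c1 where "c1 = a*t^2 + b*t + c"
  have act: "bqf_act (a,b,c) 1 t 0 1 = (a, l*b', c1)" using b' by (simp add: bqf_act_simp c1_def algebra_simps)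
  have mem: "(a, l*b', c1) \<in> pos_def_forms (-(l^2*n))" using bqf_act_mem[OF n' abc(1), of 1 1 t 0] act by simp
  have eqv: "bqf_SL2_equiv h (a, l*b', c1)"
  proof (rule bqf_SL2_equiv_trans[OF abc(2)])
    show "bqf_SL2_equiv (a,b,c) (a, l*b', c1)" unfolding bqf_SL2_equiv_iff
      by (rule exI[of _ 1], rule exI[of _ t], rule exI[of _ 0], rule exI[of _ 1]) (simp add: act)
  qed
  have d: "a > 0" "4*a*c1 - (l*b')^2 = l^2*n" using mem n' mem_pos_def_forms by blast+
  then have "(4*a)*c1 = l^2*(n + b'^2)" by (simp add: power2_eq_square algebra_simps)
  then have dv: "l^2 dvd (4*a)*c1" by simp
  have "\<not> l dvd 4*a"
  proof -
    have "4*a = 2*(2*a)" by simp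
    then show ?thesis using \<open>\<not> l dvd 2\<close> \<open>\<not> l dvd 2*a\<close> l(1) by (metis prime_dvd_mult_iff)
  qed
  then have "coprime l (4*a)" using l(1) prime_imp_coprime by blast
  then have "coprime (l^2) (4*a)" by (rule coprime_power_left_iff[THEN iffD2, OF disjI1])
  then have "l^2 dvd c1" using dv coprime_dvd_mult_right_iff by blast
  then obtain c' where c': "c1 = l^2*c'" unfolding dvd_def by blast
  have "l^2*(4*a*c' - b'^2) = l^2*n" using d(2) c' by (simp add: power2_eq_square algebra_simps)
  then have "4*a*c' - b'^2 = n" using l0 by simp
  then have "(a,b',c') \<in> pos_def_forms (-n)" using d(1) n mem_pos_def_forms by blast
  moreover have "raise_form l (a,b',c') = (a, l*b', c1)" by (simp add: raise_form_def c')
  ultimately show ?thesis using eqv abc(3) by (metis fst_conv)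
qed

text \<open>The points of the projective line over the field with \<open>l\<close> elements are \<open>(k : 1)\<close> for
  \<open>0 \<le> k < l\<close> and \<open>(1 : 0)\<close>, the latter being encoded as \<open>k = l\<close>.\<close>

definition act_point :: "int \<Rightarrow> bqf \<Rightarrow> int \<Rightarrow> bqf" where
  "act_point l f k = (if k = l then f else bqf_act f k (-1) 1 0)"

text \<open>The first coefficient of \<open>act_point\<close> is the value of \<open>f\<close> at
  the point. If \<open>l\<close> divides it, the raised form is divisible by \<open>l\<close>; the
  good points are thus the sublattices on which \<open>f\<close> stays primitive at
  \<open>l\<close>.\<close>

definition good_points :: "int \<Rightarrow> bqf \<Rightarrow> int set" where
  "good_points l f = {k \<in> {0..l}. \<not> l dvd fst (act_point l f k)}"

text \<open>A form \<open>(k,k,k)\<close> has automorphisms of order 3; for \<open>l = 3\<close> they permute its good points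
  transitively, so that only one of them is kept.\<close>

definition orbit_points :: "int \<Rightarrow> bqf \<Rightarrow> int set" where
  "orbit_points l f = (if \<exists>k. f = (k,k,k) then {l} else good_points l f)"

definition reduce_form :: "int \<Rightarrow> bqf \<Rightarrow> bqf" where
  "reduce_form n f = (SOME g. g \<in> reduced_forms n \<and> bqf_SL2_equiv f g)"

lemma reduce_form:
  assumes "n > 0" "f \<in> pos_def_forms (-n)"
  shows "reduce_form n f \<in> reduced_forms n" "bqf_SL2_equiv f (reduce_form n f)"
  unfolding reduce_form_def using someI_ex[OF exists_reduced[OF assms, unfolded Bex_def]] by blast+

lemma act_point_equiv: "bqf_SL2_equiv f (act_point l f k)"
proof (cases "k = l")
  case False
  then have "act_point l f k = bqf_act f k (-1) 1 0" by (simp add: act_point_def)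
  moreover have "k*0 - (-1)*1 = (1::int)" by simp
  ultimately show ?thesis unfolding bqf_SL2_equiv_iff by blast
qed (simp add: act_point_def bqf_SL2_equiv_refl)

lemma equiv_mem:
  "n > 0 \<Longrightarrow> f \<in> pos_def_forms (-n) \<Longrightarrow> bqf_SL2_equiv f g \<Longrightarrow> g \<in> pos_def_forms (-n)"
  unfolding bqf_SL2_equiv_iff using bqf_act_mem by blast

text \<open>Coset decomposition: the class of the first column \<open>(p : r)\<close> on the
  projective line picks the point, and what remains is a matrix with lower left entry divisible by
  \<open>l\<close>.\<close>

lemma act_point_reaches:
  assumes l: "prime l" and d: "p*s - q*r = 1" and g: "g = bqf_act f p q r s" "\<not> l dvd fst g"
  shows "\<exists>k \<in> good_points l f. \<exists>p' q' r' s'. p'*s' - q'*(l*r') = 1 \<and> g = bqf_act (act_point l f k) p' q' (l*r') s'"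
proof -
  have l0: "l > 0" using l prime_gt_0_int by blast
  have good: "\<not> l dvd fst h" if "g = bqf_act h p' q' (l*r') s'" for h p' q' r' s'
  proof
    assume "l dvd fst h"
    then have "l dvd fst g" using that by (cases h) (simp add: bqf_act_simp power2_eq_square)
    then show False using g(2) by blast
  qed
  show ?thesis
  proof (cases "l dvd r")
    case True
    then obtain r' where r': "r = l*r'" unfolding dvd_def by blast
    then have g': "g = bqf_act (act_point l f l) p q (l*r') s" using g by (simp add: act_point_def)
    moreover have "l \<in> good_points l f" using good[OF g'] l0 by (simp add: good_points_def)
    moreover have "p*s - q*(l*r') = 1" using d r' by simp
    ultimately show ?thesis by blast
  next
    case False
    obtain t where t: "l dvd p + r*t" using inverse_mod_prime[OF l False] by blast
    \<comment> \<open>\<open>k\<close> is \<open>p / r\<close> modulo \<open>l\<close>, so that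
      \<open>(p : r) = (k : 1)\<close>.\<close>
    define k where "k = (-t) mod l"
    have k: "0 \<le> k" "k < l" using l0 by (simp_all add: k_def)
    have "l dvd (-t) - k" unfolding k_def by (metis dvd_minus_mod)
    then have "l dvd (p + r*t) + r*((-t) - k)" using t by (simp add: dvd_add)
    then have pk: "l dvd p - k*r" by (simp add: algebra_simps)
    then have "l dvd -(p - k*r)" by (simp only: dvd_minus_iff)
    then obtain r' where r': "-(p - k*r) = l*r'" unfolding dvd_def by blast
    have "act_point l f k = bqf_act f k (-1) 1 0" using k by (simp add: act_point_def)
    moreover have "bqf_act (bqf_act f k (-1) 1 0) r s (-(p - k*r)) (k*s - q) = bqf_act f p q r s"
      by (simp add: bqf_act_act algebra_simps)
    ultimately have g': "g = bqf_act (act_point l f k) r s (l*r') (k*s - q)" using g(1) r' by simp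
    moreover have "k \<in> good_points l f" using good[OF g'] k by (simp add: good_points_def)
    moreover have "r*(k*s - q) - s*(-(p - k*r)) = p*s - q*r" by (simp add: algebra_simps)
    then have "r*(k*s - q) - s*(l*r') = 1" using d r' by simp
    ultimately show ?thesis by blast
  qed
qed

text \<open>Composing the three matrices gives an automorphism of \<open>f\<close>. If this is plus
  or minus the identity, the two points lie in one coset. The cases separate the point at infinity,
  \<open>l\<close>, from the affine ones.\<close>

lemma act_point_unique:
  assumes l: "prime l" and k: "k \<in> {0..l}" "j \<in> {0..l}"
    and d: "p*s - q*(l*r) = 1"
    and noaut: "\<And>p q r s. bqf_act f p q r s = f \<Longrightarrow> p*s - q*r = 1 \<Longrightarrow> q = 0 \<and> r = 0 \<and> p = s \<and> \<bar>p\<bar> = 1"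
    and e: "act_point l f j = bqf_act (act_point l f k) p q (l*r) s"
  shows "j = k"
proof -
  have l0: "l > 1" using l prime_gt_1_int by blast
  have sub: "j = k" if "l dvd j - k" "j < l" "k < l"
  proof -
    have "\<bar>j - k\<bar> < l" using k that by auto
    then have "j - k = 0" using that(1) by (meson dvd_imp_le_int not_less abs_ge_self order.trans zdvd_not_zless zero_less_abs_iff dvd_abs_iff)
    then show ?thesis by simp
  qed
  consider "j = l" "k = l" | "j = l" "k \<noteq> l" | "j \<noteq> l" "k = l" | "j \<noteq> l" "k \<noteq> l" by blast
  then show ?thesis
  proof cases
    case 2
    then have "f = bqf_act f (k*p - l*r) (k*q - s) p q"
      using e by (simp add: act_point_def bqf_act_act)
    moreover have "(k*p - l*r)*q - (k*q - s)*p = 1" using d by (simp add: algebra_simps)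
    ultimately have "p = 0" using noaut by metis
    then have "l dvd 1" using d by (metis dvd_0_right dvd_diff dvd_mult dvd_triv_left mult_zero_left)
    then show ?thesis using l0 by simp
  next
    case 3
    then have "bqf_act f j (-1) 1 0 = bqf_act f p q (l*r) s" using e by (simp add: act_point_def)
    then have "bqf_act (bqf_act f p q (l*r) s) 0 1 (-1) j = f"
      using bqf_act_inverse[of j 0 "-1" 1 f] by simp
    then have "bqf_act f (-q) (p + q*j) (-s) (l*r + s*j) = f" by (simp add: bqf_act_act algebra_simps)
    moreover have "(-q)*(l*r + s*j) - (p + q*j)*(-s) = 1" using d by (simp add: algebra_simps)
    ultimately have "s = 0" using noaut by fastforce
    then have "l dvd 1" using d by (metis dvd_minus_iff dvd_mult dvd_triv_left mult_zero_right diff_0)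
    then show ?thesis using l0 by simp
  next
    case 4
    then have "bqf_act f j (-1) 1 0 = bqf_act (bqf_act f k (-1) 1 0) p q (l*r) s" using e by (simp add: act_point_def)
    then have "bqf_act (bqf_act (bqf_act f k (-1) 1 0) p q (l*r) s) 0 1 (-1) j = f"
      using bqf_act_inverse[of j 0 "-1" 1 f] by simp
    then have "bqf_act f (-(k*q - s)) ((k*p - l*r) + (k*q - s)*j) (-q) (p + q*j) = f"
      by (simp add: bqf_act_act algebra_simps)
    moreover have "(-(k*q - s))*(p + q*j) - ((k*p - l*r) + (k*q - s)*j)*(-q) = 1"
      using d by (simp add: algebra_simps)
    ultimately have A: "(k*p - l*r) + (k*q - s)*j = 0" "-q = 0" using noaut by blast+
    then have q: "q = 0" by simp
    then have "k*p - s*j = l*r" using A(1) by (simp add: algebra_simps)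
    moreover have ps: "p*s = 1" using d q by simp
    then have "p = s" "\<bar>s\<bar> = 1" by (auto simp: zmult_eq_1_iff)
    ultimately have "s*(k - j) = l*r" "s*s = 1" using ps by (simp_all add: algebra_simps)
    then have "k - j = l*(r*s)" by (metis mult.assoc mult.commute mult_1)
    then have "l dvd j - k" by (metis dvd_minus_iff dvd_triv_left minus_diff_eq)
    then show ?thesis using sub k 4 by auto
  qed simp
qed

text \<open>Forms of the larger discriminant correspond to pairs of a reduced form and a point. If
  two pairs have equivalent raised forms, then \<open>raise_form_equiv_imp\<close> makes the
  original forms equivalent, hence equal, and triviality of the automorphisms makes the points
  equal. For a form \<open>(k,k,k)\<close>, hypothesis \<open>l3\<close> leaves only
  \<open>l = 3\<close>, where one point stands for its whole orbit.\<close>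

lemma card_reduced_primitive_at_raise:
  assumes n: "n > 0" "odd n" and l: "prime l" "odd l"
    and l3: "\<And>k. (k,k,k) \<in> reduced_primitive_at l n \<Longrightarrow> l = 3"
  shows "card (reduced_primitive_at l (l^2*n)) = (\<Sum>f\<in>reduced_primitive_at l n. card (orbit_points l f))"
proof -
  let ?T = "reduced_primitive_at l n" and ?N = "l^2*n"
  define \<Phi> where "\<Phi> = (\<lambda>(f,k). reduce_form ?N (raise_form l (act_point l f k)))"
  have l0: "l > 0" using l(1) prime_gt_0_int by blast
  have n': "?N > 0" "odd ?N" using n l0 l by simp_all
  have T: "f \<in> reduced_forms n" "f \<in> pos_def_forms (-n)" "primitive_at l f" if "f \<in> ?T" for f
    using that reduced_mem by (auto simp: reduced_primitive_at_def)
  have good: "\<not> l dvd fst (act_point l f k)" "k \<in> {0..l}" if f: "f \<in> ?T" and k: "k \<in> orbit_points l f" for f k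
  proof -
    show "k \<in> {0..l}" using k l0 by (auto simp: orbit_points_def good_points_def split: if_splits)
    show "\<not> l dvd fst (act_point l f k)"
    proof (cases "\<exists>j. f = (j,j,j)")
      case True
      then obtain j where "f = (j,j,j)" by blast
      moreover have "k = l" using k True by (simp add: orbit_points_def)
      ultimately show ?thesis using T(3)[OF f] by (simp add: act_point_def primitive_at_def)
    next
      case False
      then show ?thesis using k by (simp add: orbit_points_def good_points_def)
    qed
  qed
  have rmem: "raise_form l (act_point l f k) \<in> pos_def_forms (-?N)" if "f \<in> ?T" for f k
    using raise_form_mem[OF n(1) l0] equiv_mem[OF n(1) T(2)[OF that] act_point_equiv] by blast
  have rprim: "primitive_at l (raise_form l g)" if "\<not> l dvd fst g" for g
    using that by (cases g) (simp add: raise_form_def primitive_at_def)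
  have inj: "inj_on \<Phi> (Sigma ?T (orbit_points l))"
  proof (rule inj_onI)
    fix x y assume x: "x \<in> Sigma ?T (orbit_points l)" and y: "y \<in> Sigma ?T (orbit_points l)" and eq: "\<Phi> x = \<Phi> y"
    obtain f k where xe: "x = (f,k)" by (cases x)
    obtain g j where ye: "y = (g,j)" by (cases y)
    have f: "f \<in> ?T" "k \<in> orbit_points l f" and g: "g \<in> ?T" "j \<in> orbit_points l g" using x y xe ye by auto
    have "bqf_SL2_equiv (raise_form l (act_point l f k)) (raise_form l (act_point l g j))"
      using reduce_form(2)[OF n'(1) rmem[OF f(1), of k]] reduce_form(2)[OF n'(1) rmem[OF g(1), of j]] eq
      unfolding \<Phi>_def xe ye by (metis bqf_SL2_equiv_sym bqf_SL2_equiv_trans case_prod_conv)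
    then obtain p q r s where d: "p*s - q*(l*r) = 1" and e: "act_point l g j = bqf_act (act_point l f k) p q (l*r) s"
      using raise_form_equiv_imp[OF l(1) good(1)[OF f]] by blast
    have "bqf_SL2_equiv (act_point l f k) (act_point l g j)" using d e bqf_SL2_equiv_iff by blast
    then have "bqf_SL2_equiv f g" by (meson act_point_equiv bqf_SL2_equiv_sym bqf_SL2_equiv_trans)
    then have fg: "f = g" using reduced_equiv_imp_eq[OF n T(1)[OF f(1)] T(1)[OF g(1)]] by blast
    have "j = k"
    proof (cases "\<exists>i. f = (i,i,i)")
      case True
      then show ?thesis using f(2) g(2) fg by (simp add: orbit_points_def)
    next
      case False
      then have "q' = 0 \<and> r' = 0 \<and> p' = s' \<and> \<bar>p'\<bar> = 1"
        if "bqf_act f p' q' r' s' = f" "p'*s' - q'*r' = 1" for p' q' r' s'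
        using reduced_unique(2)[OF n T(1)[OF f(1)], of p' q' r' s'] that T(1)[OF f(1)] by auto
      then show ?thesis using act_point_unique[OF l(1) good(2)[OF f] good(2)[OF g, folded fg] d] e fg by blast
    qed
    then show "x = y" using fg xe ye by simp
  qed
  have "\<Phi> ` Sigma ?T (orbit_points l) = reduced_primitive_at l ?N"
  proof (intro equalityI subsetI)
    fix h assume "h \<in> \<Phi> ` Sigma ?T (orbit_points l)"
    then obtain f k where f: "f \<in> ?T" "k \<in> orbit_points l f" "h = \<Phi> (f,k)" by auto
    show "h \<in> reduced_primitive_at l ?N"
      using reduce_form[OF n'(1) rmem[OF f(1), of k]] rprim[OF good(1)[OF f(1,2)]] f(3)
        primitive_at_equiv unfolding \<Phi>_def reduced_primitive_at_def by auto
  next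
    fix h assume h: "h \<in> reduced_primitive_at l ?N"
    then have h': "h \<in> reduced_forms ?N" "primitive_at l h" by (auto simp: reduced_primitive_at_def)
    obtain g where g: "g \<in> pos_def_forms (-n)" "\<not> l dvd fst g" "bqf_SL2_equiv h (raise_form l g)"
      using exists_raised_form[OF n(1) l reduced_mem[OF h'(1)] h'(2)] by blast
    define f where "f = reduce_form n g"
    have f: "f \<in> reduced_forms n" "bqf_SL2_equiv g f" using reduce_form[OF n(1) g(1)] f_def by auto
    have "primitive_at l g" using g(2) by (cases g) (simp add: primitive_at_def)
    then have fT: "f \<in> ?T" using f primitive_at_equiv by (auto simp: reduced_primitive_at_def)
    obtain p q r s where d: "p*s - q*r = 1" and ge: "g = bqf_act f p q r s"
      using bqf_SL2_equiv_sym[OF f(2)] bqf_SL2_equiv_iff by blast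
    have reach: "\<exists>k\<in>orbit_points l f. \<exists>p' q' r' s'. p'*s' - q'*(l*r') = 1 \<and> g = bqf_act (act_point l f k) p' q' (l*r') s'"
    proof (cases "\<exists>k. f = (k,k,k)")
      case False
      then have "orbit_points l f = good_points l f" by (simp add: orbit_points_def)
      then show ?thesis using act_point_reaches[OF l(1) d ge g(2)] by simp
    next
      case True
      then obtain k where k: "f = (k,k,k)" by blast
      then have l3': "l = 3" using l3 fT by blast
      \<comment> \<open>Left multiplication by the automorphism with rows \<open>(1,1)\<close> and
        \<open>(-1,0)\<close>, which has order 3 on the projective line. It moves the lower left
        entry from \<open>r\<close> to \<open>-p\<close> and then to
        \<open>-(p + r)\<close>.\<close>
      have rot: "bqf_act f x y z w = bqf_act f (x + z) (y + w) (-x) (-y)" for x y z w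
        by (simp add: k bqf_act_simp power2_eq_square algebra_simps)
      have fin: ?thesis if "g = bqf_act f x y z w" "x*w - y*z = 1" "l dvd z" for x y z w
      proof -
        from \<open>l dvd z\<close> obtain r' where "z = l*r'" by (rule dvdE)
        moreover have "act_point l f l = f" "l \<in> orbit_points l f" using True by (simp_all add: act_point_def orbit_points_def)
        ultimately show ?thesis using that by metis
      qed
      have "fst g = k*(p^2 + p*r + r^2)" using ge by (simp add: k bqf_act_simp algebra_simps)
      then have nd: "\<not> 3 dvd p^2 + p*r + r^2" using g(2) l3' by auto
      \<comment> \<open>Modulo 3 the form vanishes only at \<open>(1 : 1)\<close>; at the three
        other points one of \<open>r\<close>, \<open>p\<close>, \<open>p + r\<close> is 0, and a
        power of \<open>rot\<close> moves that entry to the lower left.\<close>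
      have "3 dvd r \<or> 3 dvd p \<or> 3 dvd p + r"
      proof (rule ccontr)
        assume "\<not> ?thesis"
        then have "3 dvd p - r" by presburger
        then obtain t where t: "p = r + 3*t" by (metis dvd_def diff_add_cancel add.commute)
        have "p^2 + p*r + r^2 = 3*(r^2 + 3*r*t + 3*t^2)" unfolding t by (simp add: power2_eq_square algebra_simps)
        then show False using nd by simp
      qed
      then consider "3 dvd r" | "3 dvd p" | "3 dvd p + r" by blast
      then show ?thesis
      proof cases
        case 1 then show ?thesis using fin[OF ge d] l3' by simp
      next
        case 2
        have "g = bqf_act f (p + r) (q + s) (-p) (-q)" using ge rot by simp
        moreover have "(p + r)*(-q) - (q + s)*(-p) = 1" using d by (simp add: algebra_simps)
        ultimately show ?thesis using fin 2 l3' by simp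
      next
        case 3
        have "g = bqf_act f (p + r + -p) (q + s + -q) (-(p + r)) (-(q + s))" using ge rot by metis
        moreover have "(p + r + -p)*(-(q + s)) - (q + s + -q)*(-(p + r)) = 1" using d by (simp add: algebra_simps)
        ultimately show ?thesis using fin 3 l3' by (metis dvd_minus_iff)
      qed
    qed
    then obtain k p' q' r' s' where k: "k \<in> orbit_points l f" "p'*s' - q'*(l*r') = 1"
      "g = bqf_act (act_point l f k) p' q' (l*r') s'" by blast
    have "raise_form l g = bqf_act (raise_form l (act_point l f k)) p' (l*q') r' s'"
      using k(3) raise_form_act by simp
    moreover have "p'*s' - (l*q')*r' = 1" using k(2) by (simp add: algebra_simps)
    ultimately have "bqf_SL2_equiv (raise_form l (act_point l f k)) (raise_form l g)"
      using bqf_SL2_equiv_iff by blast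
    then have "bqf_SL2_equiv h (raise_form l (act_point l f k))"
      using g(3) bqf_SL2_equiv_sym bqf_SL2_equiv_trans by blast
    then have "bqf_SL2_equiv h (\<Phi> (f,k))"
      using reduce_form(2)[OF n'(1) rmem[OF fT, of k]] bqf_SL2_equiv_trans unfolding \<Phi>_def by auto
    moreover have "\<Phi> (f,k) \<in> reduced_forms ?N" using reduce_form(1)[OF n'(1) rmem[OF fT, of k]] by (simp add: \<Phi>_def)
    ultimately have "h = \<Phi> (f,k)" using reduced_equiv_imp_eq[OF n' h'(1)] by blast
    moreover have "(f,k) \<in> Sigma ?T (orbit_points l)" using fT k(1) by simp
    ultimately show "h \<in> \<Phi> ` Sigma ?T (orbit_points l)" by (rule image_eqI)
  qed
  then have "card (reduced_primitive_at l ?N) = card (Sigma ?T (orbit_points l))"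
    using card_image[OF inj] by simp
  also have "\<dots> = (\<Sum>f\<in>?T. card (orbit_points l f))"
  proof (rule card_SigmaI)
    show "finite ?T" using finite_reduced_forms[OF n(1)] by (simp add: reduced_primitive_at_def)
    show "\<forall>f\<in>?T. finite (orbit_points l f)"
      unfolding orbit_points_def good_points_def by (simp del: atLeastAtMost_iff)
  qed
  finally show ?thesis .
qed

section \<open>The number of good points\<close>

definition num_roots :: "int \<Rightarrow> int \<Rightarrow> nat" where
  "num_roots l n = card {x \<in> {0..<l}. l dvd x^2 + n}"

text \<open>The roots are paired by \<open>x \<mapsto> l - x\<close>; 0 is no root and
  \<open>l / 2\<close> no integer.\<close>

lemma even_num_roots:
  assumes "odd l" "l > 0" "\<not> l dvd n"
  shows "even (num_roots l n)"
proof -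
  let ?S = "{x \<in> {0..<l}. l dvd x^2 + n}"
  define A where "A = {x \<in> ?S. 2*x < l}"
  define B where "B = {x \<in> ?S. 2*x > l}"
  have sq: "l dvd (l - x)^2 + n \<longleftrightarrow> l dvd x^2 + n" for x
  proof -
    have "(l - x)^2 + n = (x^2 + n) + l*(l - 2*x)" by (simp add: power2_eq_square algebra_simps)
    then show ?thesis by (metis dvd_add_times_triv_right_iff mult.commute)
  qed
  have z: "x > 0" if "x \<in> ?S" for x
  proof -
    have "x \<noteq> 0" "x \<ge> 0" using that assms(3) by auto
    then show ?thesis by simp
  qed
  have "2*x \<noteq> l" for x using assms(1) by auto
  then have "2*x < l \<or> 2*x > l" for x using linorder_neqE by blast
  then have "?S = A \<union> B" unfolding A_def B_def by blast
  moreover have "A \<inter> B = {}" unfolding A_def B_def by auto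
  moreover have "finite A" "finite B"
    unfolding A_def B_def by (simp_all del: atLeastLessThan_iff)
  ultimately have "num_roots l n = card A + card B" unfolding num_roots_def using card_Un_disjoint by metis
  moreover have "bij_betw (\<lambda>x. l - x) A B"
  proof (rule bij_betw_byWitness[where f' = "\<lambda>x. l - x"])
    show "(\<lambda>x. l - x) ` A \<subseteq> B"
    proof
      fix y assume "y \<in> (\<lambda>x. l - x) ` A"
      then obtain x where x: "x \<in> A" "y = l - x" by blast
      then have "x > 0" using z unfolding A_def by blast
      then show "y \<in> B" using x sq unfolding A_def B_def by simp
    qed
    show "(\<lambda>x. l - x) ` B \<subseteq> A" using sq assms(2) unfolding A_def B_def by auto
  qed simp_all
  then have "card A = card B" by (rule bij_betw_same_card)
  ultimately show ?thesis by simp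
qed

lemma num_roots_dvd:
  assumes "prime l" "l dvd n"
  shows "num_roots l n = 1"
proof -
  have l0: "l > 0" using assms(1) prime_gt_0_int by blast
  have "l dvd x^2 + n \<longleftrightarrow> l dvd x" for x
    using assms by (simp add: dvd_add_left_iff prime_dvd_power_iff)
  then have "{x \<in> {0..<l}. l dvd x^2 + n} = {x \<in> {0..<l}. l dvd x}" by simp
  also have "\<dots> = {0}" 
  proof (intro equalityI subsetI)
    fix x assume "x \<in> {x \<in> {0..<l}. l dvd x}"
    then have "0 \<le> x" "x < l" "l dvd x" by auto
    then have "\<not> 0 < x" using zdvd_not_zless by blast
    then show "x \<in> {0}" using \<open>0 \<le> x\<close> by simp
  qed (use l0 in simp)
  finally show ?thesis by (simp add: num_roots_def)
qed

lemma dvd_less_eq: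
  assumes "(l::int) dvd x - y" "x \<in> {0..<l}" "y \<in> {0..<l}"
  shows "x = y"
proof -
  have "x mod l = y mod l" using assms(1) by (simp add: mod_eq_dvd_iff)
  then show ?thesis using assms(2,3) by simp
qed

lemma dvd_minus_mod_int: "(l::int) dvd x mod l - x"
  by (metis dvd_minus_iff dvd_minus_mod minus_diff_eq)

text \<open>If \<open>l\<close> does not divide \<open>a\<close>, completing the square,
  \<open>k \<mapsto> 2ak + b\<close>, matches the zeros of the form with the square roots of
  \<open>-n\<close>. If \<open>l\<close> divides \<open>a\<close>, the point at infinity is a zero;
  there is one more exactly when \<open>l\<close> does not divide \<open>b\<close>, and this is also
  when \<open>-n\<close>, then congruent to \<open>b^2\<close>, has two roots instead of
  one.\<close>

lemma card_bad_points:
  assumes l: "prime l" "odd l" and f: "4*a*c - b^2 = n" "primitive_at l (a,b,c)"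
  shows "card {k \<in> {0..l}. l dvd fst (act_point l (a,b,c) k)} = num_roots l n"
proof -
  have l0: "l > 0" using l(1) prime_gt_0_int by blast
  have l2: "\<not> l dvd 2" using l primes_dvd_imp_eq[of l 2] by auto
  let ?B = "{k \<in> {0..<l}. l dvd a*k^2 + b*k + c}"
  have fs: "fst (act_point l (a,b,c) k) = (if k = l then a else a*k^2 + b*k + c)" for k
    by (simp add: act_point_def bqf_act_simp)
  have eqB: "{k \<in> {0..l}. l dvd fst (act_point l (a,b,c) k)} = (if l dvd a then insert l ?B else ?B)"
    using l0 by (auto simp: fs)
  have card: "card {k \<in> {0..l}. l dvd fst (act_point l (a,b,c) k)} = (if l dvd a then card ?B + 1 else card ?B)"
  proof -
    have "finite ?B" "l \<notin> ?B" by (auto simp del: atLeastLessThan_iff) simp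
    then show ?thesis using eqB by simp
  qed
  show ?thesis
  proof (cases "l dvd a")
    case False
    then have na: "\<not> l dvd 2*a" using l(1) l2 by (simp add: prime_dvd_mult_iff)
    have na4: "\<not> l dvd 4*a"
    proof -
      have "4*a = 2*(2*a)" by simp
      then show ?thesis using l2 na l(1) by (metis prime_dvd_mult_iff)
    qed
    have id: "(2*a*k + b)^2 + n = (4*a)*(a*k^2 + b*k + c)" for k
      unfolding f(1)[symmetric] by (simp add: power2_eq_square algebra_simps)
    have eqv: "l dvd (2*a*k + b)^2 + n \<longleftrightarrow> l dvd a*k^2 + b*k + c" for k
      unfolding id using na4 l(1) by (simp add: prime_dvd_mult_iff del: mult.assoc)
    have sqm: "l dvd x^2 + n \<longleftrightarrow> l dvd y^2 + n" if "l dvd x - y" for x y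
    proof -
      have "(x^2 + n) - (y^2 + n) = (x - y)*(x + y)" by (simp add: power2_eq_square algebra_simps)
      then have "l dvd (x^2 + n) - (y^2 + n)" using that by simp
      then show ?thesis by (metis dvd_diff_commute dvd_add_right_iff diff_add_cancel)
    qed
    define h where "h = (\<lambda>k. (2*a*k + b) mod l)"
    have "bij_betw h ?B {x \<in> {0..<l}. l dvd x^2 + n}"
    proof (rule bij_betw_imageI)
      show "inj_on h ?B"
      proof (rule inj_onI)
        fix x y assume xy: "x \<in> ?B" "y \<in> ?B" "h x = h y"
        then have "l dvd (2*a*x + b) - (2*a*y + b)" by (simp add: h_def mod_eq_dvd_iff)
        then have "l dvd (2*a)*(x - y)" by (simp add: algebra_simps)
        then have "l dvd x - y" using na l(1) by (simp only: prime_dvd_mult_iff) simp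
        then show "x = y" using dvd_less_eq xy by simp
      qed
      show "h ` ?B = {x \<in> {0..<l}. l dvd x^2 + n}"
      proof (intro equalityI subsetI)
        fix x assume "x \<in> h ` ?B"
        then obtain k where k: "k \<in> ?B" "x = h k" by blast
        have "l dvd x - (2*a*k + b)" unfolding k(2) h_def by (rule dvd_minus_mod_int)
        then have "l dvd x^2 + n" using sqm eqv k(1) by blast
        then show "x \<in> {x \<in> {0..<l}. l dvd x^2 + n}" using k(2) l0 by (simp add: h_def)
      next
        fix x assume x: "x \<in> {x \<in> {0..<l}. l dvd x^2 + n}"
        obtain t where t: "l dvd (b - x) + (2*a)*t" using inverse_mod_prime[OF l(1) na] by blast
        define k where "k = t mod l"
        have "l dvd k - t" unfolding k_def by (rule dvd_minus_mod_int)
        then have "l dvd ((b - x) + (2*a)*t) + (2*a)*(k - t)" using t by simp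
        then have kx: "l dvd (2*a*k + b) - x" by (simp add: algebra_simps)
        then have "l dvd (2*a*k + b)^2 + n" using sqm x by blast
        then have "k \<in> ?B" using eqv l0 by (simp add: k_def)
        moreover have "(2*a*k + b) mod l = x mod l" using kx by (simp add: mod_eq_dvd_iff)
        then have "x = h k" using x by (simp add: h_def)
        ultimately show "x \<in> h ` ?B" by blast
      qed
    qed
    then show ?thesis using card False bij_betw_same_card unfolding num_roots_def by fastforce
  next
    case True
    then have e: "l dvd a*k^2 + b*k + c \<longleftrightarrow> l dvd b*k + c" for k
      by (metis add.assoc dvd_add_right_iff dvd_mult2)
    have e2: "l dvd x^2 + n \<longleftrightarrow> l dvd x - b \<or> l dvd x + b" for x
    proof -
      have "x^2 + n = 4*a*c + (x - b)*(x + b)" unfolding f(1)[symmetric] by (simp add: power2_eq_square algebra_simps)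
      moreover have "l dvd 4*a*c" using True by simp
      ultimately have "l dvd x^2 + n \<longleftrightarrow> l dvd (x - b)*(x + b)" by (metis dvd_add_right_iff)
      then show ?thesis using l(1) by (simp only: prime_dvd_mult_iff)
    qed
    show ?thesis
    proof (cases "l dvd b")
      case b: True
      then have "\<not> l dvd c" using f(2) True by (simp add: primitive_at_def)
      then have "?B = {}" using e b by (auto simp: dvd_add_right_iff)
      then have "card ?B = 0" by (metis card.empty)
      moreover have "n = 4*a*c - b*b" using f(1) by (simp add: power2_eq_square)
      then have "l dvd n" using True b by simp
      then have "num_roots l n = 1" by (rule num_roots_dvd[OF l(1)])
      ultimately show ?thesis using card True by presburger
    next
      case b: False
      obtain t where t: "l dvd c + b*t" using inverse_mod_prime[OF l(1) b] by blast
      have "?B = {t mod l}"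
      proof (intro equalityI subsetI)
        fix k assume k: "k \<in> ?B"
        then have "l dvd (b*k + c) - (c + b*t)" using e t by (intro dvd_diff) auto
        then have "l dvd b*(k - t)" by (simp add: algebra_simps)
        then have "l dvd k - t" using b l(1) by (simp only: prime_dvd_mult_iff) simp
        then have "k mod l = t mod l" by (simp add: mod_eq_dvd_iff)
        then show "k \<in> {t mod l}" using k by simp
      next
        fix k assume k: "k \<in> {t mod l}"
        have "l dvd t mod l - t" by (rule dvd_minus_mod_int)
        then have "l dvd (c + b*t) + b*(t mod l - t)" using t by simp
        then have "l dvd b*k + c" using k by (simp add: algebra_simps)
        then show "k \<in> ?B" using e k l0 by simp
      qed
      moreover have "{x \<in> {0..<l}. l dvd x^2 + n} = {b mod l, (-b) mod l}"
      proof (intro equalityI subsetI)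
        fix x assume x: "x \<in> {x \<in> {0..<l}. l dvd x^2 + n}"
        then have "l dvd x - b \<or> l dvd x - (-b)" using e2 by simp
        then have "x mod l = b mod l \<or> x mod l = (-b) mod l" by (simp only: mod_eq_dvd_iff)
        then show "x \<in> {b mod l, (-b) mod l}" using x by simp
      next
        fix x assume x: "x \<in> {b mod l, (-b) mod l}"
        then have "l dvd x - b \<or> l dvd x - (-b)" using dvd_minus_mod_int by blast
        then have "l dvd x^2 + n" using e2 by simp
        then show "x \<in> {x \<in> {0..<l}. l dvd x^2 + n}" using x l0 by auto
      qed
      moreover have "b mod l \<noteq> (-b) mod l"
      proof
        assume "b mod l = (-b) mod l"
        then have "l dvd b - (-b)" by (simp only: mod_eq_dvd_iff)
        then have "l dvd 2*b" by simp
        then show False using l2 b l(1) prime_dvd_mult_iff by blast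
      qed
      ultimately show ?thesis using card True by (simp add: num_roots_def)
    qed
  qed
qed

lemma card_good_points:
  assumes n: "n > 0" and l: "prime l" "odd l" and f: "f \<in> pos_def_forms (-n)" "primitive_at l f"
  shows "int (card (good_points l f)) + int (num_roots l n) = l + 1"
proof -
  obtain a b c where fe: "f = (a,b,c)" by (cases f)
  let ?B = "{k \<in> {0..l}. l dvd fst (act_point l f k)}"
  have l0: "l > 0" using l(1) prime_gt_0_int by blast
  have "4*a*c - b^2 = n" using f(1) fe n mem_pos_def_forms by blast
  then have "card ?B = num_roots l n" using card_bad_points[OF l] f(2) fe by blast
  moreover have "{0..l} = good_points l f \<union> ?B" unfolding good_points_def by blast
  then have "card {0..l} = card (good_points l f \<union> ?B)" by (rule arg_cong)
  moreover have "card (good_points l f \<union> ?B) = card (good_points l f) + card ?B"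
    by (rule card_Un_disjoint)
       (auto simp: good_points_def simp del: atLeastAtMost_iff intro: finite_subset[of _ "{0..l}"])
  moreover have "card {0..l} = nat (l + 1)" by simp
  ultimately show ?thesis using l0 by linarith
qed

lemma card_orbit_points:
  assumes n: "n > 0" and l: "prime l" "odd l" and f: "f \<in> reduced_primitive_at l n" "\<nexists>k. f = (k,k,k)"
  shows "card (orbit_points l f) = nat (l + 1) - num_roots l n"
proof -
  have "int (card (good_points l f)) + int (num_roots l n) = l + 1"
    using card_good_points[OF n l, of f] f(1) reduced_mem by (simp add: reduced_primitive_at_def)
  then show ?thesis using f(2) by (simp add: orbit_points_def)
qed

lemma card_reduced_primitive_raise_generic:
  assumes n: "n > 0" "odd n" and l: "prime l" "odd l"
    and nk: "\<And>k. (k,k,k) \<notin> reduced_primitive_at l n"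
  shows "card (reduced_primitive_at l (l^2*n)) =
    card (reduced_primitive_at l n) * (nat (l + 1) - num_roots l n)"
proof -
  have "card (reduced_primitive_at l (l^2*n)) = (\<Sum>f\<in>reduced_primitive_at l n. card (orbit_points l f))"
    by (rule card_reduced_primitive_at_raise[OF n l]) (use nk in blast)
  also have "\<dots> = (\<Sum>f\<in>reduced_primitive_at l n. nat (l + 1) - num_roots l n)"
    by (rule sum.cong[OF refl], rule card_orbit_points[OF n(1) l]) (use nk in blast)+
  finally show ?thesis by simp
qed

text \<open>As 3 divides \<open>n\<close>, every form has three good points. Those of the unique
  form \<open>(j,j,j)\<close> are identified by its automorphisms, so the total falls short of three
  times the number of forms by 2.\<close>

lemma card_reduced_primitive_raise_3:
  assumes n: "n = 3*k^2" "odd n" "\<not> 3 dvd k"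
  shows "card (reduced_primitive_at 3 (9*n)) + 2 = 3 * card (reduced_primitive_at 3 n)"
proof -
  define j where "j = \<bar>k\<bar>"
  have j: "n = 3*j^2" "\<not> 3 dvd j" "j > 0" using n unfolding j_def by auto
  have n0: "n > 0" using j by simp
  have p3: "prime (3::int)" by simp
  let ?T = "reduced_primitive_at 3 n"
  have kT: "(j,j,j) \<in> ?T"
    using j n0 by (simp add: reduced_primitive_at_def reduced_forms_iff primitive_at_def power2_eq_square)
  have uniq: "i = j" if "(i,i,i) \<in> ?T" for i
  proof -
    have "i > 0" "3*i^2 = n" using that n0 by (auto simp: reduced_primitive_at_def reduced_forms_iff power2_eq_square)
    then have "i^2 = j^2" using j(1) by simp
    then show ?thesis using \<open>i > 0\<close> j(3) by (simp add: power2_eq_iff)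
  qed
  have fin: "finite ?T" using finite_reduced_forms[OF n0] by (simp add: reduced_primitive_at_def)
  have "card (reduced_primitive_at 3 (3^2*n)) = (\<Sum>f\<in>?T. card (orbit_points 3 f))"
    by (rule card_reduced_primitive_at_raise[OF n0 n(2) p3]) simp_all
  also have "\<dots> = card (orbit_points 3 (j,j,j)) + (\<Sum>f\<in>?T - {(j,j,j)}. card (orbit_points 3 f))"
    using fin kT by (rule sum.remove)
  also have "(\<Sum>f\<in>?T - {(j,j,j)}. card (orbit_points 3 f)) = (\<Sum>f\<in>?T - {(j,j,j)}. 3)"
  proof (rule sum.cong[OF refl])
    fix f assume f: "f \<in> ?T - {(j,j,j)}"
    then have "\<nexists>i. f = (i,i,i)" using uniq by blast
    moreover have "num_roots 3 n = 1" by (rule num_roots_dvd) (simp_all add: j(1))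
    ultimately show "card (orbit_points 3 f) = 3" using card_orbit_points[OF n0 p3, of f] f by simp
  qed
  also have "\<dots> = 3 * (card ?T - 1)" using fin kT by simp
  also have "card (orbit_points 3 (j,j,j)) = 1" by (simp add: orbit_points_def)
  finally have "card (reduced_primitive_at 3 (3^2*n)) = 1 + 3 * (card ?T - 1)" .
  moreover have "card ?T \<ge> 1" using fin kT card_gt_0_iff[of ?T] by (metis One_nat_def Suc_leI empty_iff)
  ultimately show ?thesis by simp
qed

section \<open>Additive subgroups of the complex numbers\<close>

definition additive_set :: "complex set \<Rightarrow> bool" where
  "additive_set A \<longleftrightarrow> 0 \<in> A \<and> (\<forall>x\<in>A. \<forall>y\<in>A. x - y \<in> A)"

lemma additive_setD:
  assumes "additive_set A"
  shows "0 \<in> A" "x \<in> A \<Longrightarrow> y \<in> A \<Longrightarrow> x - y \<in> A" "x \<in> A \<Longrightarrow> - x \<in> A"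
    "x \<in> A \<Longrightarrow> y \<in> A \<Longrightarrow> x + y \<in> A"
proof -
  show z: "0 \<in> A" and d: "\<And>x y. x \<in> A \<Longrightarrow> y \<in> A \<Longrightarrow> x - y \<in> A"
    using assms by (auto simp: additive_set_def)
  show m: "\<And>x. x \<in> A \<Longrightarrow> - x \<in> A" using d[OF z] by simp
  show "x \<in> A \<Longrightarrow> y \<in> A \<Longrightarrow> x + y \<in> A" using d[of x "-y"] m[of y] by simp
qed

lemma additive_set_of_int_mult:
  assumes "additive_set A" "x \<in> A"
  shows "of_int k * x \<in> A"
proof -
  have nat: "of_nat m * x \<in> A" for m
    by (induction m) (use assms additive_setD in \<open>auto simp: ring_distribs\<close>)
  show ?thesis
  proof (cases "k \<ge> 0")
    case True
    then show ?thesis using nat[of "nat k"] by (simp add: of_nat_nat)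
  next
    case False
    then have "of_int k * x = - (of_nat (nat (-k)) * x)" by (simp add: of_nat_nat)
    then show ?thesis using additive_setD(3)[OF assms(1) nat] by simp
  qed
qed

inductive_set add_span :: "complex set \<Rightarrow> complex set" for S where
  zero: "0 \<in> add_span S"
| base: "x \<in> S \<Longrightarrow> x \<in> add_span S"
| diff: "x \<in> add_span S \<Longrightarrow> y \<in> add_span S \<Longrightarrow> x - y \<in> add_span S"

lemma additive_add_span: "additive_set (add_span S)"
  by (auto simp: additive_set_def intro: add_span.intros)

lemma add_span_least:
  assumes "S \<subseteq> A" "additive_set A" shows "add_span S \<subseteq> A"
proof
  fix x assume "x \<in> add_span S"
  then show "x \<in> A" by induction (use assms additive_setD in auto)
qed

text \<open>The module product, which on ideals is composition of forms. Working with subsets of the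
  complex numbers makes its associativity and commutativity independent of coefficients.\<close>

definition set_prod :: "complex set \<Rightarrow> complex set \<Rightarrow> complex set" where
  "set_prod X Y = add_span {x * y |x y. x \<in> X \<and> y \<in> Y}"

lemma additive_set_prod: "additive_set (set_prod X Y)"
  by (simp add: set_prod_def additive_add_span)

lemma set_prodI: "x \<in> X \<Longrightarrow> y \<in> Y \<Longrightarrow> x * y \<in> set_prod X Y"
  unfolding set_prod_def by (rule add_span.base) blast

lemma set_prod_least:
  assumes "additive_set A" "\<And>x y. x \<in> X \<Longrightarrow> y \<in> Y \<Longrightarrow> x * y \<in> A"
  shows "set_prod X Y \<subseteq> A"
  unfolding set_prod_def using assms by (intro add_span_least) auto

lemma set_prod_commute: "set_prod X Y = set_prod Y X"
  unfolding set_prod_def by (rule arg_cong[where f = add_span]) (auto, metis mult.commute, metis mult.commute)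

lemma additive_vimage:
  assumes "additive_set A" shows "additive_set {u. u * z \<in> A}"
  using assms by (auto simp: additive_set_def left_diff_distrib)

text \<open>For fixed \<open>z\<close> the \<open>u\<close> with \<open>u z\<close> in the target
  form an additive set, so it suffices to check generators.\<close>

lemma set_prod_assoc_subset: "set_prod (set_prod X Y) Z \<subseteq> set_prod X (set_prod Y Z)"
proof (rule set_prod_least[OF additive_set_prod])
  fix u z assume u: "u \<in> set_prod X Y" and z: "z \<in> Z"
  have "set_prod X Y \<subseteq> {u. u * z \<in> set_prod X (set_prod Y Z)}"
  proof (rule set_prod_least[OF additive_vimage[OF additive_set_prod]])
    fix x y assume "x \<in> X" "y \<in> Y"
    then have "x * (y * z) \<in> set_prod X (set_prod Y Z)" using z by (intro set_prodI)
    then show "x * y \<in> {u. u * z \<in> set_prod X (set_prod Y Z)}" by (simp add: mult.assoc)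
  qed
  then show "u * z \<in> set_prod X (set_prod Y Z)" using u by blast
qed

lemma set_prod_assoc: "set_prod (set_prod X Y) Z = set_prod X (set_prod Y Z)"
  using set_prod_assoc_subset[of X Y Z] set_prod_assoc_subset[of Z Y X]
  by (simp add: set_prod_commute subset_antisym)

definition scale_set :: "complex \<Rightarrow> complex set \<Rightarrow> complex set" where
  "scale_set s X = (\<lambda>x. s * x) ` X"

lemma scale_setI: "x \<in> X \<Longrightarrow> s * x \<in> scale_set s X"
  unfolding scale_set_def by (rule imageI)

lemma mem_scale_set: "s \<noteq> 0 \<Longrightarrow> y \<in> scale_set s X \<longleftrightarrow> y / s \<in> X"
  by (force simp: scale_set_def)

lemma scale_set_scale: "scale_set s (scale_set t X) = scale_set (s * t) X"
  by (simp add: scale_set_def image_image mult.assoc)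

lemma scale_set_1 [simp]: "scale_set 1 X = X"
  by (simp add: scale_set_def)

lemma additive_scale_set:
  assumes "additive_set A" shows "additive_set (scale_set s A)"
proof -
  have "s * x - s * y \<in> scale_set s A" if "x \<in> A" "y \<in> A" for x y
    using scale_setI[of "x - y" A s] additive_setD(2)[OF assms that] by (simp add: right_diff_distrib)
  moreover have "0 \<in> scale_set s A" using scale_setI[OF additive_setD(1)[OF assms], of s] by simp
  ultimately show ?thesis by (auto simp: additive_set_def scale_set_def)
qed

lemma set_prod_scale_left: "set_prod (scale_set s X) Y = scale_set s (set_prod X Y)"
proof
  show "set_prod (scale_set s X) Y \<subseteq> scale_set s (set_prod X Y)"
  proof (rule set_prod_least[OF additive_scale_set[OF additive_set_prod]])
    fix u y assume "u \<in> scale_set s X" "y \<in> Y"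
    then show "u * y \<in> scale_set s (set_prod X Y)"
      by (auto simp: scale_set_def mult.assoc intro!: set_prodI)
  qed
  have "set_prod X Y \<subseteq> {u. u * s \<in> set_prod (scale_set s X) Y}"
  proof (rule set_prod_least[OF additive_vimage[OF additive_set_prod]])
    fix x y assume "x \<in> X" "y \<in> Y"
    then have "s * x * y \<in> set_prod (scale_set s X) Y" by (intro set_prodI scale_setI)
    then show "x * y \<in> {u. u * s \<in> set_prod (scale_set s X) Y}" by (simp add: mult_ac)
  qed
  then show "scale_set s (set_prod X Y) \<subseteq> set_prod (scale_set s X) Y"
    by (auto simp: scale_set_def mult.commute)
qed

lemma set_prod_scale: "set_prod (scale_set s X) (scale_set t Y) = scale_set (s * t) (set_prod X Y)"
  by (metis scale_set_scale set_prod_commute set_prod_scale_left)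

lemma cnj_set_prod: "cnj ` set_prod X Y = set_prod (cnj ` X) (cnj ` Y)"
proof -
  have sub: "cnj ` set_prod X Y \<subseteq> set_prod (cnj ` X) (cnj ` Y)" for X Y
  proof -
    have ad: "additive_set {u. cnj u \<in> set_prod (cnj ` X) (cnj ` Y)}"
      using additive_set_prod[of "cnj ` X" "cnj ` Y"] by (auto simp: additive_set_def)
    have "set_prod X Y \<subseteq> {u. cnj u \<in> set_prod (cnj ` X) (cnj ` Y)}"
      by (rule set_prod_least[OF ad]) (auto intro: set_prodI)
    then show ?thesis by blast
  qed
  have inv: "cnj ` cnj ` Z = Z" for Z by (simp add: image_image)
  have "cnj ` cnj ` set_prod (cnj ` X) (cnj ` Y) \<subseteq> cnj ` set_prod (cnj ` cnj ` X) (cnj ` cnj ` Y)"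
    by (intro image_mono sub)
  then show ?thesis using sub[of X Y] unfolding inv by (rule subset_antisym[rotated])
qed

lemma int_subgroup_principal:
  assumes "0 \<in> S" "\<And>x y. x \<in> S \<Longrightarrow> y \<in> S \<Longrightarrow> x - y \<in> S" "z \<in> S" "(z::int) \<noteq> 0"
  obtains k where "k > 0" "S = {k * j |j. True}"
proof -
  have neg: "- x \<in> S" if "x \<in> S" for x using assms(2)[OF assms(1) that] by simp
  have add: "x + y \<in> S" if "x \<in> S" "y \<in> S" for x y using assms(2)[OF that(1) neg[OF that(2)]] by simp
  have natm: "int m * x \<in> S" if "x \<in> S" for x m
    by (induction m) (use assms(1) add that in \<open>auto simp: ring_distribs\<close>)
  have mult: "j * x \<in> S" if "x \<in> S" for x j
  proof (cases "j \<ge> 0")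
    case True then show ?thesis using natm[OF that, of "nat j"] by simp
  next
    case False
    then show ?thesis using neg[OF natm[OF that, of "nat (-j)"]] by simp
  qed
  have ex: "int (nat \<bar>z\<bar>) \<in> S \<and> nat \<bar>z\<bar> > 0" using assms(3,4) neg by (auto simp: abs_if)
  define m where "m = (LEAST m. int m \<in> S \<and> m > 0)"
  have m: "int m \<in> S \<and> m > 0" unfolding m_def by (rule LeastI[of "\<lambda>m. int m \<in> S \<and> m > 0", OF ex])
  have least: "m \<le> i" if "int i \<in> S" "i > 0" for i unfolding m_def using that by (intro Least_le) simp
  have "S = {int m * j |j. True}"
  proof (intro equalityI subsetI)
    fix x assume x: "x \<in> S"
    have "x mod int m = x - (x div int m) * int m" by (simp add: minus_div_mult_eq_mod)
    then have r: "x mod int m \<in> S" using assms(2)[OF x mult] m by simp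
    have "x mod int m = 0"
    proof (rule ccontr)
      assume "x mod int m \<noteq> 0"
      moreover have "0 \<le> x mod int m" "x mod int m < int m" using m by simp_all
      ultimately have "x mod int m > 0" by linarith
      then have "m \<le> nat (x mod int m)" using least[of "nat (x mod int m)"] r by simp
      then show False using \<open>x mod int m < int m\<close> \<open>x mod int m > 0\<close> by linarith
    qed
    then show "x \<in> {int m * j |j. True}" by auto
  next
    fix x assume "x \<in> {int m * j |j. True}"
    then obtain j where "x = j * int m" by (auto simp: mult.commute)
    then show "x \<in> S" using mult m by simp
  qed
  then show thesis using that[of "int m"] m by simp
qed

section \<open>The class group of a squarefree discriminant\<close>

locale squarefree_discriminant =
  fixes n :: int
  assumes n_pos: "n > 0" and n_mod4: "[n = 3] (mod 4)" and n_squarefree: "squarefree n"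
begin

text \<open>The norm of \<open>w\<close>; \<open>w\<close> is a root of \<open>X^2 - X + M\<close>,
  and \<open>(1,1,M)\<close> is the principal form.\<close>

definition M :: int where "M = (n + 1) div 4"

definition w :: complex where "w = Complex (1/2) (sqrt (of_int n) / 2)"

lemma n_eq: "n = 4 * M - 1"
  using n_mod4 unfolding M_def cong_def by (simp, presburger)

lemma n_odd: "odd n" using mod4_3_odd n_mod4 .

lemma w_sq: "w * w = w - of_int M"
proof -
  have "real_of_int n = 4 * of_int M - 1" using n_eq by simp
  moreover have "sqrt (real_of_int n) * sqrt (real_of_int n) = of_int n" using n_pos by simp
  ultimately show ?thesis unfolding w_def by (simp add: complex_eq_iff field_simps)
qed

lemma w_sq': "w * (w * x) = w * x - of_int M * x"
  using w_sq by (metis left_diff_distrib mult.assoc)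

lemma cnj_w: "cnj w = 1 - w"
  unfolding w_def by (simp add: complex_eq_iff)

lemma w_independent: "of_int x + of_int y * w = 0 \<longleftrightarrow> x = 0 \<and> y = 0"
proof -
  have "Im (of_int x + of_int y * w) = of_int y * sqrt (of_int n) / 2" by (simp add: w_def)
  moreover have "sqrt (real_of_int n) > 0" using n_pos by simp
  ultimately have "of_int x + of_int y * w = 0 \<Longrightarrow> y = 0" using n_pos
    by (metis div_0 divide_eq_0_iff mult_eq_0_iff of_int_eq_0_iff order_less_irrefl zero_complex.sel(2) zero_neq_numeral)
  then show ?thesis by auto
qed

text \<open>The ring of integers of the field generated by the square root of
  \<open>-n\<close>.\<close>

definition Ring :: "complex set" where "Ring = {of_int x + of_int y * w |x y. True}"

text \<open>The second basis vector equals \<open>(b + sqrt(-n)) / 2\<close>: this is the classical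
  ideal of norm \<open>a\<close> attached to the form.\<close>

definition lat :: "bqf \<Rightarrow> complex set" where
  "lat f = (case f of (a,b,c) \<Rightarrow>
     {of_int x * of_int a + of_int y * (of_int ((b - 1) div 2) + w) |x y. True})"

definition is_module :: "complex set \<Rightarrow> bool" where
  "is_module A \<longleftrightarrow> additive_set A \<and> (\<forall>x\<in>A. w * x \<in> A)"

lemma is_moduleD: "is_module A \<Longrightarrow> additive_set A" "is_module A \<Longrightarrow> x \<in> A \<Longrightarrow> w * x \<in> A"
  by (auto simp: is_module_def)

lemma is_module_Ring_mult: "is_module A \<Longrightarrow> r \<in> Ring \<Longrightarrow> x \<in> A \<Longrightarrow> r * x \<in> A"
proof -
  assume A: "is_module A" and r: "r \<in> Ring" and x: "x \<in> A"
  obtain u v where "r = of_int u + of_int v * w" using r by (auto simp: Ring_def)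
  then have "r * x = of_int u * x + of_int v * (w * x)" by (simp add: algebra_simps)
  then show ?thesis
    using A x is_moduleD additive_set_of_int_mult additive_setD(4) by metis
qed

lemma is_module_Ring: "is_module Ring"
proof -
  have "0 \<in> Ring" unfolding Ring_def by (simp, rule exI[of _ 0], rule exI[of _ 0]) simp
  moreover have "x - y \<in> Ring" if "x \<in> Ring" "y \<in> Ring" for x y
  proof -
    obtain a b c d where "x = of_int a + of_int b * w" "y = of_int c + of_int d * w"
      using \<open>x \<in> Ring\<close> \<open>y \<in> Ring\<close> by (auto simp: Ring_def)
    then have "x - y = of_int (a - c) + of_int (b - d) * w" by (simp add: algebra_simps)
    then show ?thesis unfolding Ring_def by blast
  qed
  moreover have "w * x \<in> Ring" if "x \<in> Ring" for x
  proof -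
    obtain a b where "x = of_int a + of_int b * w" using \<open>x \<in> Ring\<close> by (auto simp: Ring_def)
    then have "w * x = of_int (- b * M) + of_int (a + b) * w" by (simp add: algebra_simps w_sq)
    then show ?thesis unfolding Ring_def by blast
  qed
  ultimately show ?thesis by (simp add: is_module_def additive_set_def)
qed

lemma of_int_Ring: "of_int k \<in> Ring"
  unfolding Ring_def by (simp, rule exI[of _ k], rule exI[of _ 0]) simp

lemma w_Ring: "w \<in> Ring"
  unfolding Ring_def by (simp, rule exI[of _ 0], rule exI[of _ 1]) simp

lemma cnj_Ring:
  assumes "x \<in> Ring" shows "cnj x \<in> Ring"
proof -
  obtain a b where "x = of_int a + of_int b * w" using assms by (auto simp: Ring_def)
  then have "cnj x = of_int (a + b) + of_int (- b) * w" by (simp add: cnj_w algebra_simps)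
  then show ?thesis unfolding Ring_def by blast
qed

lemma is_module_set_prod: "is_module X \<Longrightarrow> is_module (set_prod X Y)"
proof -
  assume X: "is_module X"
  have "set_prod X Y \<subseteq> {u. u * w \<in> set_prod X Y}"
  proof (rule set_prod_least[OF additive_vimage[OF additive_set_prod]])
    fix x y assume "x \<in> X" "y \<in> Y"
    then have "w * x * y \<in> set_prod X Y" using X is_moduleD by (intro set_prodI)
    then show "x * y \<in> {u. u * w \<in> set_prod X Y}" by (simp add: mult_ac)
  qed
  then show ?thesis using additive_set_prod by (auto simp: is_module_def mult.commute)
qed

lemma set_prod_Ring: "is_module A \<Longrightarrow> set_prod Ring A = A"
proof
  assume A: "is_module A"
  show "set_prod Ring A \<subseteq> A"
    using A is_moduleD(1) is_module_Ring_mult by (intro set_prod_least) auto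
  show "A \<subseteq> set_prod Ring A" using set_prodI[OF of_int_Ring[of 1]] by auto
qed

lemma is_module_scale: "is_module A \<Longrightarrow> is_module (scale_set s A)"
proof -
  assume A: "is_module A"
  have "w * (s * x) \<in> scale_set s A" if "x \<in> A" for x
    using scale_setI[OF is_moduleD(2)[OF A that], of s] by (simp add: mult_ac)
  then show ?thesis using additive_scale_set is_moduleD(1)[OF A] by (auto simp: is_module_def scale_set_def)
qed

text \<open>The last equation says that \<open>a c\<close> is the norm of \<open>B + w\<close>; it
  is the discriminant equation divided by 4.\<close>

lemma form_params:
  assumes "(a,b,c) \<in> pos_def_forms (-n)"
  defines "B \<equiv> (b - 1) div 2"
  shows "a > 0" "b = 2 * B + 1" "a * c = B^2 + B + M"
proof -
  have ab: "a > 0" "4*a*c - b^2 = n" using assms(1) n_pos mem_pos_def_forms by blast+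
  then show "a > 0" by simp
  have "odd (4*a*c - b^2)" using ab n_odd by simp
  then have "odd b" by simp
  then show b: "b = 2 * B + 1" unfolding B_def by (auto elim: oddE)
  have "4 * (a * c) = 4 * (B^2 + B + M)"
    using ab(2) n_eq unfolding b by (simp add: power2_eq_square algebra_simps)
  then show "a * c = B^2 + B + M" by simp
qed

lemma form_params_complex:
  assumes "(a,b,c) \<in> pos_def_forms (-n)"
  defines "B \<equiv> (b - 1) div 2"
  shows "of_int a * of_int c = (of_int B * of_int B + of_int B + of_int M :: complex)"
proof -
  have "complex_of_int (a * c) = of_int (B^2 + B + M)" using form_params(3)[OF assms(1)] B_def by simp
  then show ?thesis by (simp add: power2_eq_square)
qed

lemma lat_simp: "lat (a,b,c) = {of_int x * of_int a + of_int y * (of_int ((b - 1) div 2) + w) |x y. True}"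
  by (simp add: lat_def)

lemma additive_lat: "additive_set (lat f)"
proof -
  obtain a b c where fe: "f = (a,b,c)" by (cases f)
  have "0 \<in> lat f" unfolding fe lat_simp by (simp, rule exI[of _ 0], rule exI[of _ 0]) simp
  moreover have "x - y \<in> lat f" if x: "x \<in> lat f" and y: "y \<in> lat f" for x y
  proof -
    obtain i j k l where "x = of_int i * of_int a + of_int j * (of_int ((b - 1) div 2) + w)"
      "y = of_int k * of_int a + of_int l * (of_int ((b - 1) div 2) + w)"
      using x y unfolding fe lat_simp by blast
    then have "x - y = of_int (i - k) * of_int a + of_int (j - l) * (of_int ((b - 1) div 2) + w)"
      by (simp add: algebra_simps)
    then show ?thesis unfolding fe lat_simp by blast
  qed
  ultimately show ?thesis by (simp add: additive_set_def)
qed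

lemma lat_gens: "of_int a \<in> lat (a,b,c)" "of_int ((b - 1) div 2) + w \<in> lat (a,b,c)"
proof -
  have "of_int a = of_int 1 * of_int a + of_int 0 * (of_int ((b - 1) div 2) + w)" by simp
  then show "of_int a \<in> lat (a,b,c)" unfolding lat_simp by blast
  have "of_int ((b - 1) div 2) + w = of_int 0 * of_int a + of_int 1 * (of_int ((b - 1) div 2) + w)" by simp
  then show "of_int ((b - 1) div 2) + w \<in> lat (a,b,c)" unfolding lat_simp by blast
qed

lemma lat_least:
  assumes "additive_set A" "of_int a \<in> A" "of_int ((b - 1) div 2) + w \<in> A"
  shows "lat (a,b,c) \<subseteq> A"
  unfolding lat_simp
proof clarify
  fix x y
  show "of_int x * of_int a + of_int y * (of_int ((b - 1) div 2) + w) \<in> A"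
    using assms additive_set_of_int_mult additive_setD(4) by blast
qed

lemma lat_Ring: "lat f \<subseteq> Ring"
proof -
  obtain a b c where fe: "f = (a,b,c)" by (cases f)
  have "of_int ((b - 1) div 2) + w \<in> Ring"
    using additive_setD(4) is_moduleD(1)[OF is_module_Ring] of_int_Ring w_Ring by blast
  then show ?thesis
    unfolding fe using lat_least of_int_Ring is_moduleD(1)[OF is_module_Ring] by blast
qed

text \<open>Integrality of \<open>c\<close> makes the lattice an ideal, because
  \<open>w (B + w) = -c a + (B + 1)(B + w)\<close>.\<close>

lemma is_module_lat:
  assumes "f \<in> pos_def_forms (-n)" shows "is_module (lat f)"
proof -
  obtain a b c where fe: "f = (a,b,c)" by (cases f)
  define B where "B = (b - 1) div 2"
  have ac: "of_int a * of_int c = (of_int B * of_int B + of_int B + of_int M :: complex)"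
    using form_params_complex assms fe B_def by blast
  have ad: "additive_set {u. u * w \<in> lat f}" by (rule additive_vimage[OF additive_lat])
  have "of_int (-B) * of_int a + of_int a * (of_int B + w) \<in> lat f"
    unfolding fe lat_simp B_def by blast
  then have 1: "of_int a * w \<in> lat f" by (simp add: algebra_simps)
  have "(of_int B + w) * w = (of_int B * of_int B + of_int B + of_int B * w + w) - (of_int B * of_int B + of_int B + of_int M)"
    by (simp add: algebra_simps w_sq)
  also have "\<dots> = of_int (-c) * of_int a + of_int (B + 1) * (of_int B + w)"
    unfolding ac[symmetric] by (simp add: algebra_simps)
  finally have 2: "(of_int B + w) * w \<in> lat f" unfolding fe lat_simp B_def by blast
  have "lat f \<subseteq> {u. u * w \<in> lat f}"
    using 1 2 lat_least[OF ad] unfolding fe B_def by simp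
  then show ?thesis using additive_lat by (auto simp: is_module_def mult.commute)
qed

lemma lat_one: "lat (1,1,M) = Ring"
  unfolding lat_simp Ring_def by simp

lemma one_form_mem: "(1,1,M) \<in> pos_def_forms (-n)"
  using n_pos n_eq by (simp add: mem_pos_def_forms)

lemma cnj_lat:
  assumes "(a,b,c) \<in> pos_def_forms (-n)"
  shows "cnj ` lat (a,b,c) = lat (a,-b,c)"
proof -
  have sub: "cnj ` lat (a,b,c) \<subseteq> lat (a,-b,c)" if b: "b = 2*B + 1" for b B
  proof
    fix z assume "z \<in> cnj ` lat (a,b,c)"
    moreover have "(b - 1) div 2 = B" "(-b - 1) div 2 = -B - 1" using b by simp_all
    ultimately obtain x y where "z = cnj (of_int x * of_int a + of_int y * (of_int B + w))"
      unfolding lat_simp by auto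
    then have "z = of_int x * of_int a + of_int (-y) * (of_int (-B-1) + w)"
      by (simp add: cnj_w algebra_simps)
    then show "z \<in> lat (a,-b,c)" unfolding lat_simp \<open>(-b - 1) div 2 = -B - 1\<close> by blast
  qed
  have b: "b = 2*((b-1) div 2) + 1" using form_params(2)[OF assms] by simp
  have "cnj ` lat (a,-b,c) \<subseteq> lat (a,-(-b),c)" by (rule sub[of "-b" "-((b-1) div 2) - 1"]) (use b in simp)
  then have "cnj ` cnj ` lat (a,-b,c) \<subseteq> cnj ` lat (a,b,c)" by (intro image_mono) simp
  then show ?thesis using sub[OF b] by (simp add: image_image)
qed

text \<open>Here squarefreeness enters: it makes every form primitive, which is what renders its
  lattice invertible.\<close>

lemma form_coprime:
  assumes "(a,b,c) \<in> pos_def_forms (-n)" "d dvd a" "d dvd b" "d dvd c"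
  shows "d dvd 1"
proof -
  obtain a' b' c' where "a = d*a'" "b = d*b'" "c = d*c'" using assms(2-4) unfolding dvd_def by blast
  moreover have "4*a*c - b^2 = n" using assms(1) n_pos mem_pos_def_forms by blast
  ultimately have "n = d^2*(4*a'*c' - b'^2)" by (simp add: power2_eq_square algebra_simps)
  then show ?thesis using n_squarefree unfolding squarefree_def by (metis dvd_triv_left)
qed

text \<open>The product contains \<open>a^2\<close>, \<open>a b\<close> and \<open>a c\<close>, so coprimality of the coefficients gives \<open>a\<close>.\<close>

lemma lat_cnj_lat:
  assumes f: "(a,b,c) \<in> pos_def_forms (-n)"
  shows "set_prod (lat (a,b,c)) (cnj ` lat (a,b,c)) = scale_set (of_int a) Ring"
proof
  define B where "B = (b - 1) div 2"
  have a: "a > 0" and b: "b = 2*B + 1" using form_params[OF f] B_def by auto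
  have ac: "of_int a * of_int c = (of_int B * of_int B + of_int B + of_int M :: complex)"
    using form_params_complex[OF f] B_def by blast
  let ?L = "lat (a,b,c)" and ?S = "scale_set (of_int a) Ring"
  have S: "is_module ?S" by (rule is_module_scale[OF is_module_Ring])
  have e2: "of_int B + w \<in> ?L" "of_int a \<in> ?L" using lat_gens B_def by auto
  have Ring2: "of_int B + w \<in> Ring" using e2 lat_Ring by blast
  show "set_prod ?L (cnj ` ?L) \<subseteq> ?S"
  proof (rule set_prod_least)
    show "additive_set ?S" using S is_moduleD by blast
    have aux: "?L \<subseteq> {u. u * cnj v \<in> ?S}" if v: "v \<in> ?L" for v
      unfolding B_def[symmetric]
    proof (rule lat_least)
      show "additive_set {u. u * cnj v \<in> ?S}" using additive_vimage S is_moduleD by blast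
      have "cnj v \<in> Ring" using v lat_Ring cnj_Ring by blast
      then show "of_int a \<in> {u. u * cnj v \<in> ?S}" using scale_setI by simp
      have "?L \<subseteq> {v. (of_int B + w) * cnj v \<in> ?S}"
      proof (rule lat_least)
        show "additive_set {v. (of_int B + w) * cnj v \<in> ?S}"
          using S is_moduleD unfolding additive_set_def by (auto simp: right_diff_distrib)
        show "of_int a \<in> {v. (of_int B + w) * cnj v \<in> ?S}"
          using scale_setI[OF Ring2, of "of_int a"] by (simp add: mult.commute)
        have "(of_int B + w) * cnj (of_int B + w) = of_int a * of_int c"
          unfolding ac by (simp add: cnj_w algebra_simps w_sq)
        then show "of_int ((b - 1) div 2) + w \<in> {v. (of_int B + w) * cnj v \<in> ?S}"
          using scale_setI[OF of_int_Ring[of c], of "of_int a"] by (simp add: B_def)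
      qed
      then show "of_int ((b - 1) div 2) + w \<in> {u. u * cnj v \<in> ?S}" using v by (auto simp: B_def)
    qed
    fix x y assume "x \<in> ?L" "y \<in> cnj ` ?L"
    then show "x * y \<in> ?S" using aux by blast
  qed
  let ?P = "set_prod ?L (cnj ` ?L)"
  have P: "is_module ?P" by (rule is_module_set_prod[OF is_module_lat[OF f]])
  then have ad: "additive_set ?P" by (rule is_moduleD)
  define g where "g = gcd a (gcd b c)"
  have "g dvd a" "g dvd gcd b c" unfolding g_def by (rule gcd_dvd1, rule gcd_dvd2)
  then have "g dvd 1" using form_coprime[OF f] by (metis gcd_dvd1 gcd_dvd2 dvd_trans)
  then have g1: "g = 1" by (simp add: g_def)
  obtain u v where uv: "u * a + v * gcd b c = 1" using bezout_int[of a "gcd b c"] g1 g_def by auto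
  obtain s t where st: "s * b + t * c = gcd b c" using bezout_int[of b c] by auto
  have c1: "cnj (of_int a) \<in> cnj ` ?L" "cnj (of_int B + w) \<in> cnj ` ?L" using e2 by blast+
  have lin: "of_int i * x + (of_int j * y + of_int k * z) \<in> ?P" if "x \<in> ?P" "y \<in> ?P" "z \<in> ?P" for i j k x y z
    using additive_set_of_int_mult[OF ad that(1), of i] additive_set_of_int_mult[OF ad that(2), of j]
      additive_set_of_int_mult[OF ad that(3), of k] additive_setD(4)[OF ad] by simp
  have "of_int a * of_int a \<in> ?P" using set_prodI[OF e2(2) c1(1)] by simp
  moreover have "of_int a * of_int b \<in> ?P"
  proof -
    have "of_int a * of_int b = of_int a * cnj (of_int B + w) + (of_int B + w) * cnj (of_int a)"
      using b by (simp add: cnj_w algebra_simps)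
    then show ?thesis using set_prodI[OF e2(2) c1(2)] set_prodI[OF e2(1) c1(1)] additive_setD(4)[OF ad] by simp
  qed
  moreover have "of_int a * of_int c \<in> ?P"
  proof -
    have "of_int a * of_int c = (of_int B + w) * cnj (of_int B + w)"
      unfolding ac by (simp add: cnj_w algebra_simps w_sq)
    then show ?thesis using set_prodI[OF e2(1) c1(2)] by simp
  qed
  ultimately have "of_int u * (of_int a * of_int a) + (of_int (v*s) * (of_int a * of_int b)
      + of_int (v*t) * (of_int a * of_int c)) \<in> ?P"
    by (rule lin)
  moreover have "of_int u * (of_int a * of_int a) + (of_int (v*s) * (of_int a * of_int b)
      + of_int (v*t) * (of_int a * of_int c)) = (of_int (a * (u * a + v * (s * b + t * c))) :: complex)"
    by (simp add: algebra_simps)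
  ultimately have "of_int a \<in> ?P" using uv st by simp
  then have "r * of_int a \<in> ?P" if "r \<in> Ring" for r using is_module_Ring_mult[OF P that] by blast
  then have "of_int a * r \<in> ?P" if "r \<in> Ring" for r using that by (simp only: mult.commute)
  then show "?S \<subseteq> ?P" unfolding scale_set_def by blast
qed

text \<open>A triangular basis of the ideal: \<open>k\<close> generates the
  \<open>w\<close>-coordinates occurring in \<open>A\<close>, and \<open>m\<close> the integers in
  \<open>A\<close>. Closure under \<open>w\<close> shows that \<open>k\<close> divides the whole
  basis, and after division by \<open>k\<close> the basis has the shape of
  \<open>lat\<close>.\<close>

lemma module_is_lat:
  assumes A: "is_module A" "A \<subseteq> Ring" "z \<in> A" "z \<noteq> 0"
  obtains k f where "k > 0" "f \<in> pos_def_forms (-n)" "A = scale_set (of_int k) (lat f)"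
proof -
  note ad = is_moduleD(1)[OF A(1)]
  define Y where "Y = {y. \<exists>x. of_int x + of_int y * w \<in> A}"
  define X where "X = {x. (of_int x :: complex) \<in> A}"
  obtain z1 z2 where z: "z = of_int z1 + of_int z2 * w" using A(2,3) by (auto simp: Ring_def)
  \<comment> \<open>The \<open>w\<close>-coordinate of \<open>w (x + y w)\<close> is
    \<open>x + y\<close>; this gives membership in \<open>Y\<close>, hence divisibility by
    \<open>k\<close>.\<close>
  have wA: "of_int (-y*M) + of_int (x + y) * w \<in> A" if "of_int x + of_int y * w \<in> A" for x y
  proof -
    have "w * (of_int x + of_int y * w) = of_int (-y*M) + of_int (x + y) * w" by (simp add: algebra_simps w_sq)
    then show ?thesis using is_moduleD(2)[OF A(1) that] by simp
  qed
  have Y0: "0 \<in> Y" using additive_setD(1)[OF ad] unfolding Y_def by (auto intro: exI[of _ 0])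
  have Yd: "y - y' \<in> Y" if "y \<in> Y" "y' \<in> Y" for y y'
  proof -
    obtain x x' where "of_int x + of_int y * w \<in> A" "of_int x' + of_int y' * w \<in> A" using \<open>y \<in> Y\<close> \<open>y' \<in> Y\<close> Y_def by auto
    then have "(of_int x + of_int y * w) - (of_int x' + of_int y' * w) \<in> A" using additive_setD(2)[OF ad] by blast
    moreover have "(of_int x + of_int y * w) - (of_int x' + of_int y' * w) = of_int (x - x') + of_int (y - y') * w"
      by (simp add: algebra_simps)
    ultimately have "of_int (x - x') + of_int (y - y') * w \<in> A" by metis
    then show ?thesis unfolding Y_def by blast
  qed
  have "\<exists>y \<in> Y. y \<noteq> 0"
  proof (cases "z2 = 0")
    case False then show ?thesis using A(3) z Y_def by blast
  next
    case True
    have "z1 + z2 \<in> Y" using wA[of z1 z2] A(3) unfolding z Y_def by blast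
    moreover have "z1 + z2 \<noteq> 0" using A(4) True unfolding z by auto
    ultimately show ?thesis by blast
  qed
  then obtain k where k: "k > 0" "Y = {k * j |j. True}" using int_subgroup_principal[OF Y0 Yd] by metis
  have X0: "0 \<in> X" using additive_setD(1)[OF ad] X_def by simp
  have Xd: "x - x' \<in> X" if "x \<in> X" "x' \<in> X" for x x'
    using additive_setD(2)[OF ad] that unfolding X_def by simp
  \<comment> \<open>The norm of \<open>z\<close> is a nonzero integer in the ideal.\<close>
  have "\<exists>x \<in> X. x \<noteq> 0"
  proof -
    have "cnj z \<in> Ring" using A(2,3) cnj_Ring by blast
    then have "cnj z * z \<in> A" using is_module_Ring_mult[OF A(1) _ A(3)] by blast
    moreover have eq: "cnj z * z = of_int (z1^2 + z1*z2 + z2^2*M)"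
      unfolding z by (simp add: cnj_w algebra_simps w_sq w_sq' power2_eq_square)
    moreover have "cnj z * z \<noteq> 0" using A(4) by simp
    ultimately show ?thesis unfolding X_def by (metis mem_Collect_eq of_int_0)
  qed
  then obtain m where m: "m > 0" "X = {m * j |j. True}" using int_subgroup_principal[OF X0 Xd] by metis
  have "m \<in> X" using m(2) by (auto intro: exI[of _ 1])
  then have mA: "of_int m + of_int 0 * w \<in> A" by (simp add: X_def)
  then have "m + 0 \<in> Y" using wA[OF mA] unfolding Y_def by blast
  then have "m \<in> Y" by simp
  then obtain a where a: "m = k * a" using k(2) by auto
  have "k \<in> Y" using k(2) by (auto intro: exI[of _ 1])
  then obtain r where r: "of_int r + of_int k * w \<in> A" unfolding Y_def by blast
  have "r + k \<in> Y" using wA[OF r] unfolding Y_def by blast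
  then obtain i where "r + k = k * i" using k(2) by auto
  then have rB: "r = k * (i - 1)" by (simp add: algebra_simps)
  define B where "B = i - 1"
  have rB': "of_int k * (of_int B + w) \<in> A" using r rB by (simp add: B_def algebra_simps)
  have a0: "a > 0" using a m(1) k(1) by (simp add: zero_less_mult_iff)
  \<comment> \<open>The first factor is the conjugate of \<open>B + w\<close>. The product is an
    integer in \<open>A\<close>, hence a multiple of \<open>m = k a\<close>; the quotient is the
    coefficient \<open>c\<close>.\<close>
  have "(of_int B + 1 - w) * (of_int k * (of_int B + w)) \<in> A"
  proof (rule is_module_Ring_mult[OF A(1) _ rB'])
    have "of_int B + 1 - w = of_int (B + 1) + of_int (-1) * w" by simp
    then show "of_int B + 1 - w \<in> Ring" unfolding Ring_def by blast
  qed
  moreover have "(of_int B + 1 - w) * (of_int k * (of_int B + w)) = of_int (k * (B^2 + B + M))"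
    by (simp add: algebra_simps w_sq w_sq' power2_eq_square)
  ultimately have "k * (B^2 + B + M) \<in> X" unfolding X_def by simp
  then obtain c where "k * (B^2 + B + M) = m * c" using m(2) by auto
  then have c: "a * c = B^2 + B + M" using a k(1) by simp
  define f where "f = (a, 2*B + 1, c)"
  have "4*a*c - (2*B+1)^2 = 4*(a*c) - (4*(B^2 + B) + 1)" by (simp add: power2_eq_square algebra_simps)
  also have "\<dots> = 4 * M - 1" unfolding c by simp
  also have "\<dots> = n" by (rule n_eq[symmetric])
  finally have fm: "f \<in> pos_def_forms (-n)" unfolding f_def using n_pos a0 mem_pos_def_forms by blast
  have lf: "lat f = {of_int x * of_int a + of_int y * (of_int B + w) |x y. True}" unfolding f_def lat_simp by simp
  have "A = scale_set (of_int k) (lat f)"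
  proof
    show "scale_set (of_int k) (lat f) \<subseteq> A"
    proof
      fix v assume "v \<in> scale_set (of_int k) (lat f)"
      then obtain x y where "v = of_int k * (of_int x * of_int a + of_int y * (of_int B + w))"
        unfolding lf scale_set_def by blast
      then have "v = of_int x * of_int m + of_int y * (of_int k * (of_int B + w))"
        by (simp add: a algebra_simps)
      moreover have "of_int m \<in> A" using mA by simp
      ultimately show "v \<in> A" using rB' additive_set_of_int_mult[OF ad] additive_setD(4)[OF ad] by simp
    qed
    show "A \<subseteq> scale_set (of_int k) (lat f)"
    proof
      fix v assume v: "v \<in> A"
      obtain x y where xy: "v = of_int x + of_int y * w" using A(2) v by (auto simp: Ring_def)
      then have "y \<in> Y" using v Y_def by blast
      then obtain j where j: "y = k * j" using k(2) by auto
      have "v - of_int j * (of_int k * (of_int B + w)) \<in> A"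
        using v rB' additive_set_of_int_mult[OF ad] additive_setD(2)[OF ad] by blast
      moreover have "v - of_int j * (of_int k * (of_int B + w)) = of_int (x - j*k*B)"
        unfolding xy j by (simp add: algebra_simps)
      ultimately have "x - j*k*B \<in> X" by (simp add: X_def)
      then obtain e where e: "x - j*k*B = m * e" using m(2) by auto
      then have "x = k*a*e + j*k*B" using a by simp
      then have "v = of_int k * (of_int e * of_int a + of_int j * (of_int B + w))"
        unfolding xy j by (simp add: algebra_simps)
      then show "v \<in> scale_set (of_int k) (lat f)" unfolding lf scale_set_def by blast
    qed
  qed
  then show thesis using that k(1) fm by blast
qed

end

section \<open>Involutions and elements of order 4 in finite groups\<close>

lemma (in comm_group) card_square_roots_of_one_dvd:
  assumes "finite (carrier G)"
  shows "card {x \<in> carrier G. x \<otimes> x = \<one>} dvd order G"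
proof -
  let ?H = "{x \<in> carrier G. x \<otimes> x = \<one>}"
  have "subgroup ?H G"
  proof (rule subgroupI)
    show "?H \<noteq> {}" using one_closed r_one by blast
    show "inv a \<in> ?H" if "a \<in> ?H" for a using that by (simp add: inv_mult_group[symmetric])
    show "a \<otimes> b \<in> ?H" if "a \<in> ?H" "b \<in> ?H" for a b
    proof -
      have "(a \<otimes> b) \<otimes> (a \<otimes> b) = (a \<otimes> a) \<otimes> (b \<otimes> b)"
        using that by (simp add: m_ac)
      then show ?thesis using that by simp
    qed
  qed auto
  then show ?thesis using lagrange by (metis dvd_triv_right)
qed

text \<open>A subgroup of order 4 is too large to lie in the 2-torsion, and the square of an element
  outside the 2-torsion is the only nontrivial involution, \<open>t\<close>.\<close>

lemma (in comm_group) exists_square_root_of_involution: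
  assumes fin: "finite (carrier G)" and 4: "4 dvd order G"
    and two: "card {x \<in> carrier G. x \<otimes> x = \<one>} = 2"
    and t: "t \<in> carrier G" "t \<otimes> t = \<one>" "t \<noteq> \<one>"
  shows "\<exists>x \<in> carrier G. x \<otimes> x = t"
proof -
  let ?T = "{x \<in> carrier G. x \<otimes> x = \<one>}"
  have T: "?T = {\<one>, t}"
  proof (rule card_seteq[symmetric])
    show "finite ?T" using fin by simp
    show "{\<one>, t} \<subseteq> ?T" using t by simp
    show "card ?T \<le> card {\<one>, t}" using two t(3) by simp
  qed
  obtain m where m: "order G = 2^2 * m" using 4 by (auto elim: dvdE)
  obtain H where H: "subgroup H G" "card H = 2^2"
    using sylow_thm[OF two_is_prime_nat group_axioms m fin] by blast
  have "\<not> H \<subseteq> ?T"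
  proof
    assume "H \<subseteq> ?T"
    then have "card H \<le> card ?T" using fin by (intro card_mono) auto
    then show False using H two by simp
  qed
  then obtain x where x: "x \<in> H" "x \<notin> ?T" by blast
  then have xc: "x \<in> carrier G" using H subgroup.subset by blast
  interpret H: group "G\<lparr>carrier := H\<rparr>" using H(1) subgroup_imp_group by blast
  have "order (G\<lparr>carrier := H\<rparr>) = 4" using H(2) by (simp add: order_def)
  then have "x [^]\<^bsub>G\<lparr>carrier := H\<rparr>\<^esub> (4::nat) = \<one>" using H.pow_order_eq_1[of x] x(1) by simp
  then have "x [^] (4::nat) = \<one>" by (simp add: nat_pow_def)
  moreover have "x [^] (4::nat) = (x \<otimes> x) \<otimes> (x \<otimes> x)"
    using xc by (simp add: numeral_eq_Suc m_assoc)
  ultimately have "x \<otimes> x \<in> ?T" using xc by simp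
  then have "x \<otimes> x = t" using T x(2) xc by blast
  then show ?thesis using xc by blast
qed

lemma (in group) four_dvd_order:
  assumes "x \<in> carrier G" "x \<otimes> x \<noteq> \<one>" "(x \<otimes> x) \<otimes> (x \<otimes> x) = \<one>"
  shows "4 dvd order G"
proof -
  have "x [^] (4::nat) = (x \<otimes> x) \<otimes> (x \<otimes> x)" using assms(1) by (simp add: numeral_eq_Suc m_assoc)
  then have 4: "ord x dvd 4" using assms pow_eq_id by simp
  have "x [^] (2::nat) = x \<otimes> x" using assms(1) by (simp add: numeral_eq_Suc)
  then have n2: "\<not> ord x dvd 2" using assms pow_eq_id by metis
  have "ord x \<le> 4" using 4 by (rule dvd_imp_le) simp
  then have "ord x \<in> {0,1,2,3,4}" by auto
  then have "ord x = 4" using 4 n2 by auto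
  then show ?thesis using ord_dvd_group_order[OF assms(1)] by simp
qed

context squarefree_discriminant
begin

section \<open>Equivalence of forms and scaling of lattices\<close>

lemma norm_form:
  assumes f: "(a,b,c) \<in> pos_def_forms (-n)"
  defines "v \<equiv> (\<lambda>x y. of_int x * of_int a + of_int y * (of_int ((b - 1) div 2) + w) :: complex)"
  shows "v x y * cnj (v x y) = of_int (a * bqf_eval (a,b,c) x y)"
proof -
  define B where "B = (b - 1) div 2"
  have b: "b = 2*B + 1" using form_params[OF f] B_def by auto
  have ac: "of_int a * of_int c = (of_int B * of_int B + of_int B + of_int M :: complex)"
    using form_params_complex[OF f] B_def by blast
  have "v x y * cnj (v x y) = of_int x * of_int x * of_int a * of_int a
      + of_int x * of_int y * of_int a * (2 * of_int B + 1)
      + of_int y * of_int y * (of_int B * of_int B + of_int B + of_int M)"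
    unfolding v_def B_def[symmetric] by (simp add: cnj_w algebra_simps w_sq w_sq')
  also have "\<dots> = of_int (a * bqf_eval (a,b,c) x y)"
    unfolding ac[symmetric] b by (simp add: bqf_eval_def power2_eq_square algebra_simps)
  finally show ?thesis .
qed

text \<open>The substitution takes the basis \<open>a, e\<close> of the lattice of \<open>f\<close>
  to \<open>e1, e2\<close>. Since \<open>cnj e1 * e1 = a a'\<close> and
  \<open>cnj e1 * e2 = a (B' + w)\<close>, the factor \<open>cnj e1 / a\<close> carries this basis
  to that of \<open>lat g\<close>.\<close>

lemma lat_equiv_imp_scale:
  assumes f: "f \<in> pos_def_forms (-n)" and eqv: "bqf_SL2_equiv f g"
  shows "\<exists>s. s \<noteq> 0 \<and> lat g = scale_set s (lat f)"
proof -
  obtain p q r s where d: "p*s - q*r = 1" and ge: "g = bqf_act f p q r s"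
    using eqv bqf_SL2_equiv_iff by blast
  obtain a b c where fe: "f = (a,b,c)" by (cases f)
  obtain a' b' c' where ge': "g = (a',b',c')" by (cases g)
  have g: "(a',b',c') \<in> pos_def_forms (-n)" using bqf_act_mem[OF n_pos f d] ge ge' by simp
  note fp = form_params[OF f[unfolded fe]] and gp = form_params[OF g]
  define B where "B = (b - 1) div 2"
  define B' where "B' = (b' - 1) div 2"
  have b: "b = 2*B + 1" "b' = 2*B' + 1" using fp gp B_def B'_def by auto
  have ac: "a * c = B*B + B + M" using fp B_def by (simp add: power2_eq_square)
  have ac': "of_int a * of_int c = (of_int B * of_int B + of_int B + of_int M :: complex)"
    using form_params_complex[OF f[unfolded fe]] B_def by blast
  have a': "a' = a*p^2 + b*p*r + c*r^2" and b': "b' = 2*a*p*q + b*(p*s + q*r) + 2*c*r*s"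
    using ge unfolding fe ge' by (simp_all add: bqf_act_simp)
  obtain S where S: "S = p*s + q*r" by blast
  have S1: "S = 1 + 2*(q*r)" using d S by simp
  \<comment> \<open>By the determinant, \<open>S = p s + q r\<close> equals
    \<open>1 + 2 q r\<close>, so the formula for \<open>b'\<close> can be halved to one for
    \<open>B'\<close>.\<close>
  have "2*B' + 1 = 2*(a*p*q) + (2*(B*S) + S) + 2*(c*r*s)"
    using b' unfolding b S[symmetric] by (simp add: ring_distribs)
  then have "B' = a*p*q + B*S + c*r*s + q*r" using S1 by linarith
  then have B': "B' = a*p*q + B*(p*s + q*r) + c*r*s + q*r" unfolding S .
  define e where "e = (of_int B + w :: complex)"
  have ee: "e * cnj e = of_int a * of_int c"
    unfolding ac' e_def by (simp add: cnj_w algebra_simps w_sq)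
  have ee1: "e + cnj e = of_int b" unfolding e_def b by (simp add: cnj_w)
  define e1 where "e1 = of_int p * of_int a + of_int r * e"
  define e2 where "e2 = of_int q * of_int a + of_int s * e"
  define E where "E = (of_int B' + w :: complex)"
  have in_f: "of_int x * of_int a + of_int y * e \<in> lat f" for x y
    unfolding fe lat_simp e_def B_def by blast
  have N: "cnj e1 * e1 = of_int a * of_int a'"
  proof -
    have "cnj e1 * e1 = of_int p * of_int p * of_int a * of_int a
        + of_int p * of_int r * of_int a * (e + cnj e) + of_int r * of_int r * (e * cnj e)"
      unfolding e1_def by (simp add: algebra_simps)
    then show ?thesis unfolding ee ee1 a' by (simp add: power2_eq_square algebra_simps)
  qed
  have X: "cnj e1 * e2 = of_int a * E"
  proof -
    have ce: "cnj e = 2 * of_int B + 1 - e" using ee1 unfolding b by (simp add: algebra_simps)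
    have "cnj e1 * e2 = of_int a * (of_int p * of_int q * of_int a)
        + of_int a * (of_int (p*s - q*r) * e) + of_int a * of_int (q*r) * (2 * of_int B + 1)
        + of_int r * of_int s * (e * cnj e)"
      unfolding e1_def e2_def by (simp add: ce algebra_simps)
    also have "\<dots> = of_int a * (of_int (p*q*a) + e + of_int (q*r) * (2 * of_int B + 1) + of_int (r*s*c))"
      unfolding ee d by (simp add: algebra_simps)
    also have "of_int (p*q*a) + e + of_int (q*r) * (2 * of_int B + 1) + of_int (r*s*c)
        = of_int (p*q*a + B*(p*s - q*r) + q*r*(2*B + 1) + r*s*c) + w"
      unfolding e_def d by simp
    also have "p*q*a + B*(p*s - q*r) + q*r*(2*B + 1) + r*s*c = B'"
      unfolding B' by (simp add: algebra_simps)
    finally show ?thesis unfolding E_def .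
  qed
  have g_lat: "lat g = {of_int x * of_int a' + of_int y * E |x y. True}"
    unfolding ge' lat_simp E_def B'_def ..
  have a0: "(of_int a :: complex) \<noteq> 0" using fp(1) by simp
  have e1n: "cnj e1 \<noteq> 0"
  proof
    assume "cnj e1 = 0"
    then have "of_int a * of_int a' = (0::complex)" using N by simp
    then show False using fp(1) gp(1) by simp
  qed
  have "lat g = scale_set (cnj e1 / of_int a) (lat f)"
  proof
    show "lat g \<subseteq> scale_set (cnj e1 / of_int a) (lat f)"
    proof
      fix z assume "z \<in> lat g"
      then obtain x y where z: "z = of_int x * of_int a' + of_int y * E" unfolding g_lat by blast
      have "of_int a * z = of_int x * (of_int a * of_int a') + of_int y * (of_int a * E)"
        unfolding z by (simp add: algebra_simps)
      also have "\<dots> = cnj e1 * (of_int x * e1 + of_int y * e2)"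
        unfolding N[symmetric] X[symmetric] by (simp add: algebra_simps)
      also have "of_int x * e1 + of_int y * e2 = of_int (x*p + y*q) * of_int a + of_int (x*r + y*s) * e"
        unfolding e1_def e2_def by (simp add: algebra_simps)
      finally have "z = (cnj e1 / of_int a) * (of_int (x*p + y*q) * of_int a + of_int (x*r + y*s) * e)"
        using a0 by (simp add: field_simps)
      then show "z \<in> scale_set (cnj e1 / of_int a) (lat f)" using scale_setI[OF in_f] by metis
    qed
    show "scale_set (cnj e1 / of_int a) (lat f) \<subseteq> lat g"
    proof
      fix z assume "z \<in> scale_set (cnj e1 / of_int a) (lat f)"
      then obtain x y where z: "z = (cnj e1 / of_int a) * (of_int x * of_int a + of_int y * e)"
        unfolding fe scale_set_def lat_simp e_def B_def by blast
      have "of_int x * of_int a + of_int y * e = of_int (p*s - q*r) * (of_int x * of_int a + of_int y * e)"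
        using d by simp
      also have "\<dots> = of_int (x*s - y*q) * e1 + of_int (y*p - x*r) * e2"
        unfolding e1_def e2_def by (simp add: algebra_simps)
      finally have "z = (cnj e1 / of_int a) * (of_int (x*s - y*q) * e1 + of_int (y*p - x*r) * e2)"
        unfolding z by (rule arg_cong)
      then have "of_int a * z = cnj e1 * (of_int (x*s - y*q) * e1 + of_int (y*p - x*r) * e2)"
        using a0 by simp
      then have "of_int a * z = of_int (x*s - y*q) * (cnj e1 * e1) + of_int (y*p - x*r) * (cnj e1 * e2)"
        by (simp only: distrib_left mult.left_commute)
      then have "of_int a * z = of_int a * (of_int (x*s - y*q) * of_int a' + of_int (y*p - x*r) * E)"
        unfolding N X by (simp add: algebra_simps)
      then have "z = of_int (x*s - y*q) * of_int a' + of_int (y*p - x*r) * E"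
        using a0 mult_left_cancel by blast
      then show "z \<in> lat g" unfolding g_lat by blast
    qed
  qed
  moreover have "cnj e1 / of_int a \<noteq> 0" using e1n a0 by simp
  ultimately show ?thesis by blast
qed

lemma scale_set_inverse:
  assumes "s \<noteq> 0" "X = scale_set s Y" shows "Y = scale_set (1/s) X"
  unfolding assms(2) scale_set_scale using assms(1) by simp

lemma mem_scale_lat:
  assumes "x \<in> scale_set s (lat (a,b,c))"
  obtains p r where "x = s * (of_int p * of_int a + of_int r * (of_int ((b - 1) div 2) + w))"
proof -
  obtain u where u: "x = s * u" "u \<in> lat (a,b,c)" using assms unfolding scale_set_def by blast
  show thesis using u(2) that unfolding u(1) lat_simp by blast
qed

text \<open>The base change is an integral matrix whose inverse is integral too. Comparing oriented
  areas shows that its determinant is positive, hence 1, and comparing norms by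
  \<open>norm_form\<close> shows that it carries \<open>f\<close> to \<open>g\<close>.\<close>

lemma lat_scale_imp_equiv:
  assumes f: "f \<in> pos_def_forms (-n)" and g: "g \<in> pos_def_forms (-n)"
    and s: "s \<noteq> 0" and eq: "lat g = scale_set s (lat f)"
  shows "bqf_SL2_equiv f g"
proof -
  have change: "\<exists>p q r t D. D = p*t - q*r \<and>
      of_int a' = s * (of_int p * of_int a + of_int r * (of_int ((b - 1) div 2) + w)) \<and>
      of_int ((b' - 1) div 2) + w = s * (of_int q * of_int a + of_int t * (of_int ((b - 1) div 2) + w)) \<and>
      of_int a' = s * cnj s * of_int a * of_int D"
    if f: "(a,b,c) \<in> pos_def_forms (-n)" and g: "(a',b',c') \<in> pos_def_forms (-n)"
      and eq: "lat (a',b',c') = scale_set s (lat (a,b,c))" for a b c a' b' c' s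
  proof -
    define e where "e = (of_int ((b - 1) div 2) + w :: complex)"
    define E where "E = (of_int ((b' - 1) div 2) + w :: complex)"
    have m: "of_int a' \<in> scale_set s (lat (a,b,c))" "E \<in> scale_set s (lat (a,b,c))"
      using lat_gens[where a = a' and b = b' and c = c'] unfolding eq E_def by simp_all
    obtain p r where 1: "of_int a' = s * (of_int p * of_int a + of_int r * e)"
      using mem_scale_lat[OF m(1)] unfolding e_def .
    obtain q t where 2: "E = s * (of_int q * of_int a + of_int t * e)"
      using mem_scale_lat[OF m(2)] unfolding e_def .
    \<comment> \<open>The second basis vectors all have the same imaginary part, so the expression
      below is an oriented area and yields \<open>a' = \<bar>s\<bar>^2 a D\<close>.\<close>
    have dE: "E - cnj E = 2*w - 1" and de: "e - cnj e = 2*w - 1"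
      unfolding E_def e_def by (simp_all add: cnj_w)
    have "of_int a' * (2*w - 1) = cnj (of_int a') * E - of_int a' * cnj E"
      unfolding dE[symmetric] by (simp add: algebra_simps)
    also have "\<dots> = s * cnj s * of_int a * of_int (p*t - q*r) * (e - cnj e)"
      unfolding 1 unfolding 2 by (simp add: algebra_simps)
    finally have "of_int a' * (2*w - 1) = s * cnj s * of_int a * of_int (p*t - q*r) * (2*w - 1)"
      unfolding de .
    moreover have "2*w - 1 \<noteq> 0"
    proof
      assume "2*w - 1 = 0"
      then have "of_int (-1) + of_int 2 * w = 0" by simp
      then have "(-1::int) = 0 \<and> (2::int) = 0" by (rule iffD1[OF w_independent])
      then show False by simp
    qed
    ultimately have 3: "of_int a' = s * cnj s * of_int a * of_int (p*t - q*r)"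
      using mult_right_cancel by blast
    show ?thesis
      by (rule exI[of _ p], rule exI[of _ q], rule exI[of _ r], rule exI[of _ t], rule exI[of _ "p*t - q*r"])
         (intro conjI refl 1[unfolded e_def] 2[unfolded e_def E_def] 3)
  qed
  obtain a b c where fe: "f = (a,b,c)" by (cases f)
  obtain a' b' c' where ge: "g = (a',b',c')" by (cases g)
  have fp: "a > 0" and gp: "a' > 0" using form_params(1) f g fe ge by blast+
  define e where "e = (of_int ((b - 1) div 2) + w :: complex)"
  define E where "E = (of_int ((b' - 1) div 2) + w :: complex)"
  obtain p q r t D where D: "D = p*t - q*r" and E1: "of_int a' = s * (of_int p * of_int a + of_int r * e)"
    and E2: "E = s * (of_int q * of_int a + of_int t * e)"
    and N: "of_int a' = s * cnj s * of_int a * of_int D"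
    using change[OF f[unfolded fe] g[unfolded ge] eq[unfolded fe ge]] unfolding e_def E_def by blast
  obtain D' where N': "of_int a = (1/s) * cnj (1/s) * of_int a' * of_int D'"
    using change[OF g[unfolded ge] f[unfolded fe] scale_set_inverse[OF s eq, unfolded fe ge]] by blast
  have ss: "s * cnj s = of_real ((cmod s)^2)" by (rule complex_norm_square[symmetric])
  have "complex_of_real (of_int a') = of_real ((cmod s)^2 * of_int a * of_int D)" using N unfolding ss by simp
  then have NR: "of_int a' = (cmod s)^2 * of_int a * of_int D" by (simp only: of_real_eq_iff)
  have sp: "(cmod s)^2 > 0" using s by simp
  have "(cmod s)^2 * of_int a > 0" using sp fp by simp
  moreover have "(cmod s)^2 * of_int a * real_of_int D > 0" using NR gp by simp
  \<comment> \<open>Positivity of both leading coefficients excludes determinant -1, that is,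
    improper equivalence.\<close>
  ultimately have "real_of_int D > 0" by (simp only: zero_less_mult_pos)
  then have D0: "D > 0" by simp
  have "(of_int a :: complex) = of_int a * (of_int D * of_int D')"
    using N' N s by (simp add: field_simps)
  then have "complex_of_int (D * D') = of_int 1" using fp by simp
  then have "D * D' = 1" by (simp only: of_int_eq_iff)
  then have D1: "D = 1" using D0 by (simp add: zmult_eq_1_iff)
  have ev: "bqf_eval g x y = bqf_eval f (p*x + q*y) (r*x + t*y)" for x y :: int
  proof -
    let ?V = "of_int x * of_int a' + of_int y * E"
    let ?U = "of_int (p*x + q*y) * of_int a + of_int (r*x + t*y) * e"
    have "?V = s * ?U" unfolding E2 unfolding E1 by (simp add: algebra_simps)
    then have "?V * cnj ?V = (s * cnj s) * (?U * cnj ?U)" by (simp add: mult_ac)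
    then have "of_int (a' * bqf_eval g x y) = s * cnj s * of_int (a * bqf_eval f (p*x + q*y) (r*x + t*y))"
      using norm_form[OF g[unfolded ge], of x y] norm_form[OF f[unfolded fe], of "p*x + q*y" "r*x + t*y"]
      unfolding e_def E_def fe ge by simp
    also have "\<dots> = of_int a' * of_int (bqf_eval f (p*x + q*y) (r*x + t*y))"
      using N D1 by (simp add: mult_ac)
    finally have "of_int a' * complex_of_int (bqf_eval g x y) = of_int a' * of_int (bqf_eval f (p*x + q*y) (r*x + t*y))"
      by simp
    moreover have "(of_int a' :: complex) \<noteq> 0" using gp by simp
    ultimately have "complex_of_int (bqf_eval g x y) = of_int (bqf_eval f (p*x + q*y) (r*x + t*y))"
      using mult_left_cancel by blast
    then show ?thesis by (simp only: of_int_eq_iff)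
  qed
  then show ?thesis unfolding bqf_SL2_equiv_def using D D1 by blast
qed

section \<open>The group of lattices and the class group\<close>

definition Lattices :: "complex set monoid" where
  "Lattices = \<lparr>carrier = {scale_set s (lat f) |s f. s \<noteq> 0 \<and> f \<in> pos_def_forms (-n)},
     monoid.mult = set_prod, one = Ring\<rparr>"

text \<open>All nonzero complex scalars are allowed, as in \<open>Lattices\<close>, and not only
  elements of the field; the cosets are then the homothety classes of lattices.\<close>

definition Principal :: "complex set set" where
  "Principal = {scale_set s Ring |s. s \<noteq> 0}"

lemma Lattices_simps:
  "X \<in> carrier Lattices \<longleftrightarrow> (\<exists>s f. s \<noteq> 0 \<and> f \<in> pos_def_forms (-n) \<and> X = scale_set s (lat f))"
  "X \<otimes>\<^bsub>Lattices\<^esub> Y = set_prod X Y" "\<one>\<^bsub>Lattices\<^esub> = Ring"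
  by (auto simp: Lattices_def)

lemma scale_lat_in_Lattices: "s \<noteq> 0 \<Longrightarrow> f \<in> pos_def_forms (-n) \<Longrightarrow> scale_set s (lat f) \<in> carrier Lattices"
  unfolding Lattices_simps by blast

lemma lat_in_Lattices: "f \<in> pos_def_forms (-n) \<Longrightarrow> lat f \<in> carrier Lattices"
  using scale_lat_in_Lattices[of 1 f] by simp

lemma scale_Ring_in_Lattices: "s \<noteq> 0 \<Longrightarrow> scale_set s Ring \<in> carrier Lattices"
  using scale_lat_in_Lattices[OF _ one_form_mem] by (simp add: lat_one)

lemma module_in_Lattices:
  assumes "is_module A" "A \<subseteq> Ring" "z \<in> A" "z \<noteq> 0"
  shows "A \<in> carrier Lattices"
proof -
  obtain k f where "k > 0" "f \<in> pos_def_forms (-n)" "A = scale_set (of_int k) (lat f)"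
    using module_is_lat[OF assms] .
  then show ?thesis using scale_lat_in_Lattices[of "of_int k" f] by simp
qed

lemma Lattices_is_module: "X \<in> carrier Lattices \<Longrightarrow> is_module X"
  using is_module_scale is_module_lat unfolding Lattices_simps by blast

lemma Lattices_scale: "X \<in> carrier Lattices \<Longrightarrow> s \<noteq> 0 \<Longrightarrow> scale_set s X \<in> carrier Lattices"
  unfolding Lattices_simps by (metis mult_eq_0_iff scale_set_scale)

text \<open>The product of two ideals is a nonzero ideal, since it contains \<open>a a'\<close>;
  \<open>module_is_lat\<close> supplies the composed form.\<close>

lemma Lattices_mult_closed:
  assumes "X \<in> carrier Lattices" "Y \<in> carrier Lattices"
  shows "set_prod X Y \<in> carrier Lattices"
proof -
  obtain s f t g where X: "s \<noteq> 0" "f \<in> pos_def_forms (-n)" "X = scale_set s (lat f)"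
    and Y: "t \<noteq> 0" "g \<in> pos_def_forms (-n)" "Y = scale_set t (lat g)"
    using assms unfolding Lattices_simps by blast
  obtain a b c where fe: "f = (a,b,c)" by (cases f)
  obtain a' b' c' where ge: "g = (a',b',c')" by (cases g)
  have "a > 0" "a' > 0" using form_params(1) X Y fe ge by blast+
  then have "of_int a * of_int a' \<noteq> (0::complex)" by simp
  moreover have "of_int a * of_int a' \<in> set_prod (lat f) (lat g)"
    unfolding fe ge by (intro set_prodI lat_gens)
  moreover have "set_prod (lat f) (lat g) \<subseteq> Ring"
    using lat_Ring is_module_Ring_mult[OF is_module_Ring] is_moduleD(1)[OF is_module_Ring]
    by (intro set_prod_least) blast+
  ultimately have "set_prod (lat f) (lat g) \<in> carrier Lattices"
    using module_in_Lattices[OF is_module_set_prod[OF is_module_lat[OF X(2)]]] by blast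
  then show ?thesis using Lattices_scale X(1) Y(1) unfolding X(3) Y(3) set_prod_scale by simp
qed

lemma comm_group_Lattices: "comm_group Lattices"
proof (rule comm_groupI)
  show "\<one>\<^bsub>Lattices\<^esub> \<in> carrier Lattices"
    using scale_Ring_in_Lattices[of 1] by (simp add: Lattices_simps(3))
  fix X assume X: "X \<in> carrier Lattices"
  show "\<one>\<^bsub>Lattices\<^esub> \<otimes>\<^bsub>Lattices\<^esub> X = X"
    using set_prod_Ring[OF Lattices_is_module[OF X]] by (simp add: Lattices_simps)
  obtain s f where f: "s \<noteq> 0" "f \<in> pos_def_forms (-n)" "X = scale_set s (lat f)"
    using X unfolding Lattices_simps by blast
  obtain a b c where fe: "f = (a,b,c)" by (cases f)
  have a: "a > 0" using form_params(1) f fe by blast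
  have fm: "(a,-b,c) \<in> pos_def_forms (-n)" using f(2) n_pos unfolding fe by (simp add: mem_pos_def_forms)
  \<comment> \<open>The inverse is the conjugate lattice, suitably scaled, because lattice times
    conjugate is \<open>a\<close> times the ring.\<close>
  let ?Y = "scale_set (1 / (s * of_int a)) (lat (a,-b,c))"
  have "set_prod (lat (a,-b,c)) (lat f) = scale_set (of_int a) Ring"
    using lat_cnj_lat[OF f(2)[unfolded fe]] unfolding cnj_lat[OF f(2)[unfolded fe]] fe by (simp only: set_prod_commute)
  then have "set_prod ?Y X = Ring"
    unfolding f(3) set_prod_scale using f(1) a by (simp add: scale_set_scale)
  moreover have "?Y \<in> carrier Lattices" using f(1) a fm by (intro scale_lat_in_Lattices) simp_all
  ultimately show "\<exists>Y\<in>carrier Lattices. Y \<otimes>\<^bsub>Lattices\<^esub> X = \<one>\<^bsub>Lattices\<^esub>"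
    unfolding Lattices_simps(2,3) by blast
next
  fix X Y assume "X \<in> carrier Lattices" "Y \<in> carrier Lattices"
  then show "X \<otimes>\<^bsub>Lattices\<^esub> Y \<in> carrier Lattices" unfolding Lattices_simps(2) by (rule Lattices_mult_closed)
  show "X \<otimes>\<^bsub>Lattices\<^esub> Y = Y \<otimes>\<^bsub>Lattices\<^esub> X" unfolding Lattices_simps(2) by (rule set_prod_commute)
next
  fix X Y Z
  show "X \<otimes>\<^bsub>Lattices\<^esub> Y \<otimes>\<^bsub>Lattices\<^esub> Z = X \<otimes>\<^bsub>Lattices\<^esub> (Y \<otimes>\<^bsub>Lattices\<^esub> Z)"
    unfolding Lattices_simps(2) by (rule set_prod_assoc)
qed

sublocale L: comm_group Lattices by (rule comm_group_Lattices)

lemma subgroup_Principal: "subgroup Principal Lattices"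
proof (rule L.subgroupI)
  show "Principal \<subseteq> carrier Lattices" using scale_Ring_in_Lattices unfolding Principal_def by blast
  show "Principal \<noteq> {}" unfolding Principal_def by (auto intro: exI[of _ 1])
  have mult: "set_prod (scale_set s Ring) (scale_set t Ring) = scale_set (s * t) Ring" for s t
    using set_prod_Ring[OF is_module_Ring] by (simp add: set_prod_scale)
  show "X \<otimes>\<^bsub>Lattices\<^esub> Y \<in> Principal" if "X \<in> Principal" "Y \<in> Principal" for X Y
  proof -
    from \<open>X \<in> Principal\<close> \<open>Y \<in> Principal\<close>
    obtain s t where "s \<noteq> 0" "X = scale_set s Ring" "t \<noteq> 0" "Y = scale_set t Ring"
      unfolding Principal_def by blast
    then have "s * t \<noteq> 0" "X \<otimes>\<^bsub>Lattices\<^esub> Y = scale_set (s * t) Ring" using mult by (simp_all add: Lattices_simps(2))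
    then show ?thesis unfolding Principal_def by blast
  qed
  show "inv\<^bsub>Lattices\<^esub> X \<in> Principal" if X: "X \<in> Principal" for X
  proof -
    obtain s where s: "s \<noteq> 0" "X = scale_set s Ring" using X unfolding Principal_def by blast
    have "scale_set (1/s) Ring \<otimes>\<^bsub>Lattices\<^esub> X = \<one>\<^bsub>Lattices\<^esub>"
      using s mult by (simp add: Lattices_simps(2,3))
    then have "inv\<^bsub>Lattices\<^esub> X = scale_set (1/s) Ring"
      using s by (intro L.inv_equality) (simp_all add: scale_Ring_in_Lattices)
    moreover have "1/s \<noteq> 0" using s by simp
    ultimately show ?thesis unfolding Principal_def by blast
  qed
qed

definition Class_group :: "complex set set monoid" where
  "Class_group = Lattices Mod Principal"

definition lat_class :: "complex set \<Rightarrow> complex set set" where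
  "lat_class X = Principal #>\<^bsub>Lattices\<^esub> X"

sublocale C: comm_group Class_group
  unfolding Class_group_def by (rule L.abelian_FactGroup[OF subgroup_Principal])

lemma lat_class_eq:
  assumes "is_module X" shows "lat_class X = {scale_set s X |s. s \<noteq> 0}"
proof -
  have "set_prod (scale_set s Ring) X = scale_set s X" for s
    using set_prod_Ring[OF assms] by (simp add: set_prod_scale_left)
  then show ?thesis unfolding lat_class_def r_coset_def Principal_def Lattices_simps(2) by auto
qed

lemma lat_class_eq_iff:
  assumes "is_module X" "is_module Y"
  shows "lat_class X = lat_class Y \<longleftrightarrow> (\<exists>s. s \<noteq> 0 \<and> Y = scale_set s X)"
proof
  assume "lat_class X = lat_class Y"
  moreover have "Y \<in> lat_class Y" unfolding lat_class_eq[OF assms(2)] using scale_set_1[of Y] by (metis (mono_tags, lifting) mem_Collect_eq zero_neq_one)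
  ultimately show "\<exists>s. s \<noteq> 0 \<and> Y = scale_set s X" unfolding lat_class_eq[OF assms(1)] by auto
next
  assume "\<exists>s. s \<noteq> 0 \<and> Y = scale_set s X"
  then obtain s where s: "s \<noteq> 0" "Y = scale_set s X" by blast
  have "{scale_set t X |t. t \<noteq> 0} = {scale_set t Y |t. t \<noteq> 0}"
  proof (intro equalityI subsetI)
    fix Z assume "Z \<in> {scale_set t X |t. t \<noteq> 0}"
    then obtain t where "t \<noteq> 0" "Z = scale_set t X" by blast
    then have "Z = scale_set (t/s) Y" "t/s \<noteq> 0" using s by (simp_all add: scale_set_scale)
    then show "Z \<in> {scale_set t Y |t. t \<noteq> 0}" by blast
  next
    fix Z assume "Z \<in> {scale_set t Y |t. t \<noteq> 0}"
    then obtain t where "t \<noteq> 0" "Z = scale_set t Y" by blast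
    then have "Z = scale_set (t*s) X" "t*s \<noteq> 0" using s by (simp_all add: scale_set_scale)
    then show "Z \<in> {scale_set t X |t. t \<noteq> 0}" by blast
  qed
  then show "lat_class X = lat_class Y" unfolding lat_class_eq[OF assms(1)] lat_class_eq[OF assms(2)] .
qed

lemma lat_class_scale:
  assumes "is_module X" "s \<noteq> 0"
  shows "lat_class (scale_set s X) = lat_class X"
proof -
  have "\<exists>t. t \<noteq> 0 \<and> scale_set s X = scale_set t X" using assms(2) by blast
  then show ?thesis using lat_class_eq_iff[OF assms(1) is_module_scale[OF assms(1), of s]] by simp
qed

lemma lat_class_mult:
  assumes "X \<in> carrier Lattices" "Y \<in> carrier Lattices"
  shows "lat_class X \<otimes>\<^bsub>Class_group\<^esub> lat_class Y = lat_class (set_prod X Y)"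
  using normal.rcos_sum[OF L.subgroup_imp_normal[OF subgroup_Principal] assms]
  unfolding lat_class_def Class_group_def FactGroup_def Lattices_simps(2) by simp

lemma lat_class_Ring: "lat_class Ring = \<one>\<^bsub>Class_group\<^esub>"
  unfolding lat_class_eq[OF is_module_Ring] by (simp add: Class_group_def FactGroup_def Principal_def)

lemma lat_class_closed: "X \<in> carrier Lattices \<Longrightarrow> lat_class X \<in> carrier Class_group"
  unfolding lat_class_def Class_group_def FactGroup_def RCOSETS_def by auto

lemma Class_group_cases:
  assumes "x \<in> carrier Class_group"
  obtains f where "f \<in> reduced_forms n" "x = lat_class (lat f)"
proof -
  obtain X where X: "X \<in> carrier Lattices" "x = lat_class X"
    using assms unfolding lat_class_def Class_group_def FactGroup_def RCOSETS_def by auto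
  then obtain s g where g: "s \<noteq> 0" "g \<in> pos_def_forms (-n)" "X = scale_set s (lat g)"
    unfolding Lattices_simps by blast
  obtain f where f: "f \<in> reduced_forms n" "bqf_SL2_equiv g f" using exists_reduced[OF n_pos g(2)] by blast
  obtain t where t: "t \<noteq> 0" "lat f = scale_set t (lat g)" using lat_equiv_imp_scale[OF g(2) f(2)] by blast
  have "lat_class (lat f) = lat_class (lat g)" "lat_class X = lat_class (lat g)"
    using lat_class_eq_iff is_module_lat g t reduced_mem[OF f(1)] Lattices_is_module[OF X(1)] by metis+
  then show thesis using that f(1) X(2) by simp
qed

lemma lat_class_lat_eq_iff:
  assumes "f \<in> pos_def_forms (-n)" "g \<in> pos_def_forms (-n)"
  shows "lat_class (lat f) = lat_class (lat g) \<longleftrightarrow> bqf_SL2_equiv f g"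
  using lat_class_eq_iff[OF is_module_lat[OF assms(1)] is_module_lat[OF assms(2)]]
    lat_equiv_imp_scale[OF assms(1)] lat_scale_imp_equiv[OF assms] by blast

lemma bij_reduced_Class_group:
  "bij_betw (\<lambda>f. lat_class (lat f)) (reduced_forms n) (carrier Class_group)"
proof (rule bij_betw_imageI)
  show "inj_on (\<lambda>f. lat_class (lat f)) (reduced_forms n)"
    by (rule inj_onI) (metis lat_class_lat_eq_iff n_odd n_pos reduced_equiv_imp_eq reduced_mem)
  show "(\<lambda>f. lat_class (lat f)) ` reduced_forms n = carrier Class_group"
    using lat_class_closed[OF lat_in_Lattices[OF reduced_mem]] Class_group_cases by blast
qed

lemma finite_Class_group: "finite (carrier Class_group)"
  using bij_reduced_Class_group finite_reduced_forms[OF n_pos] bij_betw_finite by blast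

lemma order_Class_group: "order Class_group = card (form_classes (-n))"
  using bij_betw_same_card[OF bij_reduced_Class_group]
    bij_betw_same_card[OF bij_reduced_classes[OF n_pos n_odd]] by (simp add: order_def)

text \<open>The class of \<open>(a,-b,c)\<close> is the inverse. Off the boundary both forms are
  reduced, and they differ because \<open>b\<close> is odd; on the boundary a translation or an
  exchange of variables identifies them.\<close>

lemma square_eq_one_iff:
  assumes f: "f \<in> reduced_forms n"
  shows "lat_class (lat f) \<otimes>\<^bsub>Class_group\<^esub> lat_class (lat f) = \<one>\<^bsub>Class_group\<^esub> \<longleftrightarrow> f \<in> ambiguous_forms n"
proof -
  obtain a b c where fe: "f = (a,b,c)" by (cases f)
  have fm: "(a,b,c) \<in> pos_def_forms (-n)" using reduced_mem f fe by blast
  have F: "a > 0" "4*a*c - b^2 = n" "-a < b" "b \<le> a" "a \<le> c" "a = c \<longrightarrow> 0 \<le> b"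
    using f n_pos fe by (auto simp: reduced_forms_iff)
  have bo: "odd b" using pos_def_forms_odd[OF n_pos n_odd fm] .
  have fm': "(a,-b,c) \<in> pos_def_forms (-n)" using fm n_pos by (simp add: mem_pos_def_forms)
  let ?x = "lat_class (lat (a,b,c))" and ?y = "lat_class (lat (a,-b,c))"
  have xc: "?x \<in> carrier Class_group" "?y \<in> carrier Class_group"
    using lat_class_closed lat_in_Lattices fm fm' by blast+
  have "?x \<otimes>\<^bsub>Class_group\<^esub> ?y = lat_class (scale_set (of_int a) Ring)"
    using lat_class_mult[OF lat_in_Lattices[OF fm] lat_in_Lattices[OF fm']] lat_cnj_lat[OF fm] cnj_lat[OF fm] by simp
  also have "\<dots> = lat_class Ring"
    by (rule lat_class_scale[OF is_module_Ring]) (use F(1) in simp)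
  finally have xy: "?x \<otimes>\<^bsub>Class_group\<^esub> ?y = \<one>\<^bsub>Class_group\<^esub>" by (simp add: lat_class_Ring)
  have "?x \<otimes>\<^bsub>Class_group\<^esub> ?x = \<one>\<^bsub>Class_group\<^esub> \<longleftrightarrow> ?x = ?y"
    using xy xc by (metis C.inv_equality C.m_comm)
  also have "\<dots> \<longleftrightarrow> bqf_SL2_equiv (a,b,c) (a,-b,c)" by (rule lat_class_lat_eq_iff[OF fm fm'])
  also have "\<dots> \<longleftrightarrow> b = a \<or> a = c"
  proof
    assume eqv: "bqf_SL2_equiv (a,b,c) (a,-b,c)"
    show "b = a \<or> a = c"
    proof (rule ccontr)
      assume "\<not> (b = a \<or> a = c)"
      then have "(a,-b,c) \<in> reduced_forms n" using F n_pos by (simp add: reduced_forms_iff)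
      then have "(a,b,c) = (a,-b,c)" using reduced_equiv_imp_eq[OF n_pos n_odd _ _ eqv] f fe by blast
      then show False using bo by simp
    qed
  next
    assume "b = a \<or> a = c"
    then show "bqf_SL2_equiv (a,b,c) (a,-b,c)"
    proof
      assume "b = a"
      then have "(a,-b,c) = bqf_act (a,b,c) 1 (-1) 0 1" by (simp add: bqf_act_simp)
      then show ?thesis unfolding bqf_SL2_equiv_iff by force
    next
      assume "a = c"
      then have "(a,-b,c) = bqf_act (a,b,c) 0 (-1) 1 0" by (simp add: bqf_act_simp)
      then show ?thesis unfolding bqf_SL2_equiv_iff by force
    qed
  qed
  finally show ?thesis using f fe by (simp add: ambiguous_forms_def)
qed

lemma card_square_roots_of_one:
  "card {x \<in> carrier Class_group. x \<otimes>\<^bsub>Class_group\<^esub> x = \<one>\<^bsub>Class_group\<^esub>} = num_ambiguous (nat n)"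
proof -
  let ?h = "\<lambda>f. lat_class (lat f)"
  have sub: "ambiguous_forms n \<subseteq> reduced_forms n" by (auto simp: ambiguous_forms_def)
  have "{x \<in> carrier Class_group. x \<otimes>\<^bsub>Class_group\<^esub> x = \<one>\<^bsub>Class_group\<^esub>} = ?h ` ambiguous_forms n"
  proof (intro equalityI subsetI)
    fix x assume x: "x \<in> {x \<in> carrier Class_group. x \<otimes>\<^bsub>Class_group\<^esub> x = \<one>\<^bsub>Class_group\<^esub>}"
    then obtain f where f: "f \<in> reduced_forms n" "x = ?h f" using Class_group_cases by blast
    then have "f \<in> ambiguous_forms n" using square_eq_one_iff x by blast
    then show "x \<in> ?h ` ambiguous_forms n" using f(2) by blast
  next
    fix x assume "x \<in> ?h ` ambiguous_forms n"
    then obtain f where f: "f \<in> ambiguous_forms n" "x = ?h f" by blast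
    then have "f \<in> reduced_forms n" using sub by blast
    then show "x \<in> {x \<in> carrier Class_group. x \<otimes>\<^bsub>Class_group\<^esub> x = \<one>\<^bsub>Class_group\<^esub>}"
      using f square_eq_one_iff lat_class_closed[OF lat_in_Lattices[OF reduced_mem]] by blast
  qed
  then have "card {x \<in> carrier Class_group. x \<otimes>\<^bsub>Class_group\<^esub> x = \<one>\<^bsub>Class_group\<^esub>} = card (ambiguous_forms n)"
    using card_image[OF inj_on_subset[OF bij_betw_imp_inj_on[OF bij_reduced_Class_group] sub]] by simp
  then show ?thesis using card_ambiguous_forms[OF n_pos n_mod4] by simp
qed

lemma num_ambiguous_dvd_class_number: "num_ambiguous (nat n) dvd card (form_classes (-n))"
  using C.card_square_roots_of_one_dvd[OF finite_Class_group]
  unfolding card_square_roots_of_one order_Class_group .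

end

section \<open>Legendre's theorem for p x^2 + q y^2 = z^2\<close>

text \<open>Pigeonhole for the \<open>p q\<close> classes of
  \<open>(x - \<alpha> u, x - \<beta> v)\<close> modulo \<open>q\<close> and \<open>p\<close>, on a
  box whose sides are the integer parts of the roots of \<open>p q\<close>, \<open>q\<close> and
  \<open>p\<close>. None of these numbers is a square, so the bounds are strict.\<close>

lemma legendre_box:
  fixes p q :: int and \<alpha> \<beta> :: int
  assumes p: "prime p" and q: "prime q" and pq: "p \<noteq> q"
    and \<alpha>: "[\<alpha>^2 = p] (mod q)" and \<beta>: "[\<beta>^2 = q] (mod p)"
  obtains x u v where "(x, u, v) \<noteq> (0, 0, 0)" "x^2 < p*q" "u^2 < q" "v^2 < p"
    "p * q dvd x^2 - p*u^2 - q*v^2"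
proof -
  have p0: "p > 1" and q0: "q > 1" using p q prime_gt_1_int by blast+
  have floor: "\<exists>r::int. 0 \<le> r \<and> r^2 < N \<and> N < (r + 1)^2" if N: "N > 0" "\<And>k. N \<noteq> k^2" for N :: int
  proof -
    let ?r = "\<lfloor>sqrt (of_int N)\<rfloor>"
    have s: "sqrt (of_int N) \<ge> 0" using N by simp
    then have r0: "?r \<ge> 0" by simp
    have "(of_int ?r)^2 \<le> (sqrt (of_int N))^2" using r0 by (intro power_mono) auto
    then have "real_of_int (?r^2) \<le> of_int N" using N by simp
    then have "?r^2 \<le> N" by linarith
    moreover have "(sqrt (of_int N))^2 < (of_int ?r + 1)^2"
      using s by (intro power_strict_mono) (linarith, simp_all)
    then have "of_int N < real_of_int ((?r + 1)^2)" using N by simp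
    then have "N < (?r + 1)^2" by linarith
    ultimately show ?thesis using r0 N(2)[of ?r] by (intro exI[of _ ?r]) auto
  qed
  have nsq: "r \<noteq> k^2" if "prime r" for r k :: int
  proof
    assume e: "r = k^2"
    then have "r dvd k" using that by (metis dvd_refl prime_dvd_power)
    then obtain j where j: "k = r * j" unfolding dvd_def by blast
    have "r * (r * j^2) = k^2" unfolding j by (simp add: power2_eq_square)
    then have "r * (r * j^2) = r * 1" unfolding e[symmetric] by simp
    then have "r * j^2 = 1" using that by (simp only: mult_cancel_left not_prime_0) auto
    then have "r dvd 1" by (metis dvd_triv_left)
    then show False using that not_prime_unit by blast
  qed
  have nsq2: "p*q \<noteq> k^2" for k
  proof
    assume e: "p*q = k^2"
    then have "p dvd k" using p by (metis dvd_triv_left prime_dvd_power)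
    then obtain j where "k = p * j" unfolding dvd_def by blast
    then have "p * q = p * (p * j^2)" using e by (simp add: power2_eq_square algebra_simps)
    then have "q = p * j^2" using p0 by simp
    then have "p dvd q" by simp
    then show False using p q pq primes_dvd_imp_eq by blast
  qed
  obtain X where X: "0 \<le> X" "X^2 < p*q" "p*q < (X+1)^2" using floor[of "p*q"] p0 q0 nsq2 by auto
  obtain U where U: "0 \<le> U" "U^2 < q" "q < (U+1)^2" using floor[of q] q0 nsq[OF q] by auto
  obtain V where V: "0 \<le> V" "V^2 < p" "p < (V+1)^2" using floor[of p] p0 nsq[OF p] by auto
  define Bx where "Bx = {0..X} \<times> {0..U} \<times> {0..V}"
  define F where "F = (\<lambda>(x,u,v). ((x - \<alpha>*u) mod q, (x - \<beta>*v) mod p))"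
  \<comment> \<open>Each side has more integer points than the length of the corresponding root, and
    the three roots multiply to \<open>p q\<close>; the comparison is made between squares.\<close>
  have "p*q < (X+1)*((U+1)*(V+1))"
  proof -
    have "(p*q)*(q*p) < (X+1)^2 * ((U+1)^2 * (V+1)^2)"
      using X U V p0 q0 by (intro mult_strict_mono) auto
    then have "(p*q)^2 < ((X+1)*((U+1)*(V+1)))^2" by (simp add: power2_eq_square algebra_simps)
    moreover have "0 \<le> (X+1)*((U+1)*(V+1))" using X U V by simp
    ultimately show ?thesis by (rule power_less_imp_less_base)
  qed
  moreover have "card Bx = nat ((X+1)*((U+1)*(V+1)))"
    using X U V by (simp add: Bx_def card_cartesian_product nat_mult_distrib)
  moreover have "card ({0..<q} \<times> {0..<p}) = nat (p*q)"
    using p0 q0 by (simp add: card_cartesian_product nat_mult_distrib)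
  moreover have "0 < p*q" using p0 q0 by simp
  ultimately have card: "card ({0..<q} \<times> {0..<p}) < card Bx"
    by (metis order.strict_trans zless_nat_conj)
  have "F ` Bx \<subseteq> {0..<q} \<times> {0..<p}" using p0 q0 by (auto simp: F_def)
  then have "card (F ` Bx) \<le> card ({0..<q} \<times> {0..<p})" by (intro card_mono) simp_all
  then have "\<not> inj_on F Bx" using card card_image[of F Bx] by (metis leD)
  then obtain s t where st: "s \<in> Bx" "t \<in> Bx" "s \<noteq> t" "F s = F t" unfolding inj_on_def by blast
  obtain x u v where s: "s = (x,u,v)" by (cases s)
  obtain x' u' v' where t: "t = (x',u',v')" by (cases t)
  have sq: "(i - j)^2 \<le> I^2" if "i \<in> {0..I}" "j \<in> {0..I}" for i j I :: int
  proof -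
    have "\<bar>i - j\<bar> \<le> \<bar>I\<bar>" using that by auto
    then show ?thesis by (simp add: abs_le_square_iff)
  qed
  let ?x = "x - x'" and ?u = "u - u'" and ?v = "v - v'"
  have bd: "?x^2 < p*q" "?u^2 < q" "?v^2 < p"
    using st s t sq[of x X x'] sq[of u U u'] sq[of v V v'] X(2) U(2) V(2) by (auto simp: Bx_def)
  have "q dvd (x - \<alpha>*u) - (x' - \<alpha>*u')" "p dvd (x - \<beta>*v) - (x' - \<beta>*v')"
    using st(4) by (simp_all add: F_def s t mod_eq_dvd_iff)
  then have d: "q dvd ?x - \<alpha>*?u" "p dvd ?x - \<beta>*?v" by (simp_all add: algebra_simps)
  have "q dvd (?x - \<alpha>*?u)*(?x + \<alpha>*?u) + (\<alpha>^2 - p)*?u^2 - q*?v^2"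
    using d(1) \<alpha> by (simp add: cong_iff_dvd_diff)
  moreover have "(?x - \<alpha>*?u)*(?x + \<alpha>*?u) + (\<alpha>^2 - p)*?u^2 - q*?v^2 = ?x^2 - p*?u^2 - q*?v^2"
    by (simp add: power2_eq_square algebra_simps)
  ultimately have 1: "q dvd ?x^2 - p*?u^2 - q*?v^2" by metis
  have "p dvd (?x - \<beta>*?v)*(?x + \<beta>*?v) + (\<beta>^2 - q)*?v^2 - p*?u^2"
    using d(2) \<beta> by (simp add: cong_iff_dvd_diff)
  moreover have "(?x - \<beta>*?v)*(?x + \<beta>*?v) + (\<beta>^2 - q)*?v^2 - p*?u^2 = ?x^2 - p*?u^2 - q*?v^2"
    by (simp add: power2_eq_square algebra_simps)
  ultimately have 2: "p dvd ?x^2 - p*?u^2 - q*?v^2" by metis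
  have "coprime p q" using p q pq primes_coprime by blast
  then have "p * q dvd ?x^2 - p*?u^2 - q*?v^2" using 1 2 divides_mult by blast
  moreover have "(?x, ?u, ?v) \<noteq> (0,0,0)" using st(3) s t by auto
  ultimately show thesis using that bd by blast
qed

text \<open>The bounds of the box leave only the values 0 and \<open>-pq\<close> for \<open>x^2 - p u^2 - q v^2\<close>; in the second
  case the composition identity for the two sides of \<open>x^2 + pq = p u^2 + q v^2\<close> gives a solution.\<close>

lemma legendre_equation:
  fixes p q :: int
  assumes p: "prime p" and q: "prime q" and pq: "p \<noteq> q"
    and res: "QuadRes q p" "QuadRes p q"
  obtains x y z where "p*x^2 + q*y^2 = z^2" "z \<noteq> 0"
proof -
  have p0: "p > 1" and q0: "q > 1" using p q prime_gt_1_int by blast+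
  obtain \<alpha> \<beta> where "[\<alpha>^2 = p] (mod q)" "[\<beta>^2 = q] (mod p)" using res unfolding QuadRes_def by blast
  then obtain x u v where xuv: "(x, u, v) \<noteq> (0, 0, 0)" "x^2 < p*q" "u^2 < q" "v^2 < p"
    "p * q dvd x^2 - p*u^2 - q*v^2" using legendre_box[OF p q pq] by metis
  obtain j where j: "x^2 - p*u^2 - q*v^2 = (p*q)*j" using xuv(5) by (rule dvdE)
  have u: "p*u^2 < p*q" "0 \<le> p*u^2" using xuv(3) p0 by simp_all
  have v: "q*v^2 < p*q" "0 \<le> q*v^2" using xuv(4) q0 by (simp_all add: mult.commute)
  have "(p*q)*j < (p*q)*1" "(p*q)*(-2) < (p*q)*j" using j u v xuv(2) zero_le_power2[of x] by linarith+
  moreover have "p*q > 0" using p0 q0 by simp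
  ultimately have "j < 1" "-2 < j" using mult_less_cancel_left_pos by blast+
  then consider "j = 0" | "j = -1" by linarith
  then show thesis
  proof cases
    case 1
    then have e: "p*u^2 + q*v^2 = x^2" using j by simp
    have "x \<noteq> 0"
    proof
      assume "x = 0"
      then have "p*u^2 + q*v^2 = 0" using e by simp
      then have "p*u^2 = 0" "q*v^2 = 0" using u(2) v(2) by linarith+
      then show False using xuv(1) \<open>x = 0\<close> p0 q0 by simp
    qed
    then show thesis using that e by blast
  next
    case 2
    then have e: "x^2 + p*q = p*u^2 + q*v^2" using j by simp
    have "p*(u*x + q*v)^2 + q*(v*x - p*u)^2 = (x^2 + p*q)*(p*u^2 + q*v^2)"
      by (simp add: power2_eq_square algebra_simps)
    also have "\<dots> = (x^2 + p*q)^2" using e by (simp add: power2_eq_square)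
    finally have "p*(u*x + q*v)^2 + q*(v*x - p*u)^2 = (x^2 + p*q)^2" .
    moreover have "x^2 + p*q \<noteq> 0" using p0 q0 by (smt (verit) mult_pos_pos zero_le_power2)
    ultimately show thesis using that by blast
  qed
qed

text \<open>After division by the common divisor, a prime dividing two of the unknowns would have
  its square divide a prime coefficient times the square of the third, hence would divide the third
  as well.\<close>

lemma legendre_coprime:
  fixes p q :: int
  assumes p: "prime p" and q: "prime q" and pq: "p \<noteq> q"
    and sol: "p*x^2 + q*y^2 = z^2" "z \<noteq> 0"
  obtains x y z where "p*x^2 + q*y^2 = z^2" "z \<noteq> 0" "coprime x z" "\<not> p dvd z" "\<not> q dvd x"
proof -
  define g where "g = gcd x (gcd y z)"
  have g0: "g \<noteq> 0" using sol(2) by (simp add: g_def)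
  have "g dvd x" "g dvd gcd y z" unfolding g_def by (rule gcd_dvd1, rule gcd_dvd2)
  then obtain x' y' z' where xyz: "x = g*x'" "y = g*y'" "z = g*z'"
    by (metis dvdE gcd_dvd1 gcd_dvd2 dvd_trans)
  have "g^2*(p*x'^2 + q*y'^2) = g^2*z'^2" using sol(1) xyz by (simp add: power2_eq_square algebra_simps)
  then have e: "p*x'^2 + q*y'^2 = z'^2" using g0 by simp
  have z0: "z' \<noteq> 0" using sol(2) xyz by auto
  have no: False if "prime l" "l dvd x'" "l dvd y'" "l dvd z'" for l
  proof -
    have "g * l dvd x" "g * l dvd y" "g * l dvd z" using that xyz by simp_all
    then have "g * l dvd g" unfolding g_def by (intro gcd_greatest)
    then have "l dvd 1" using g0 by (metis dvd_times_left_cancel_iff mult.right_neutral)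
    then show False using that(1) not_prime_unit by blast
  qed
  have once: "r dvd w" if r: "prime r" "prime s" "r \<noteq> s" "r^2 dvd s*w^2" for r s w :: int
  proof -
    have "r dvd s*w^2" using r(4) by (metis dvd_trans dvd_power pos2)
    moreover have "\<not> r dvd s" using r primes_dvd_imp_eq by blast
    ultimately show ?thesis using r(1) by (metis prime_dvd_mult_iff prime_dvd_power)
  qed
  \<comment> \<open>This holds even for \<open>l = s\<close>, since a prime coefficient contains
    \<open>l\<close> only once.\<close>
  have once': "l dvd w" if l: "prime l" "prime s" "l^2 dvd s*w^2" for l s w :: int
  proof (rule ccontr)
    assume nw: "\<not> l dvd w"
    then have "coprime (l^2) (w^2)" using l(1) by (simp add: prime_imp_coprime)
    then have "l^2 dvd s" using l(3) by (metis coprime_dvd_mult_left_iff)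
    then have "l dvd s" by (metis dvd_trans dvd_power pos2)
    then have "l = s" using l primes_dvd_imp_eq by blast
    then have "l * l dvd l * 1" using \<open>l^2 dvd s\<close> by (simp add: power2_eq_square)
    then have "l dvd 1" using l(1) by (metis dvd_times_left_cancel_iff not_prime_0)
    then show False using l(1) not_prime_unit by blast
  qed
  have sqd: "l^2 dvd w^2" if "l dvd w" for l w :: int using that by (rule dvd_power_same)
  have nz: "\<not> p dvd z'"
  proof
    assume pz: "p dvd z'"
    have "q*y'^2 = z'^2 - p*x'^2" using e by simp
    moreover have "p dvd z'^2 - p*x'^2" using pz by (simp add: power2_eq_square)
    ultimately have "p dvd y'" using p q pq by (metis prime_dvd_mult_iff prime_dvd_power primes_dvd_imp_eq)
    then have "p^2 dvd z'^2 - q*y'^2" using sqd[OF pz] sqd[of p y'] by simp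
    then have "p^2 dvd p*x'^2" using e by (metis add_diff_cancel_right')
    then have "p dvd x'" using once' p by blast
    then show False using no p \<open>p dvd y'\<close> pz by blast
  qed
  have nx: "\<not> q dvd x'"
  proof
    assume qx: "q dvd x'"
    then have "q dvd p*x'^2 + q*y'^2" by (simp add: power2_eq_square)
    then have qz: "q dvd z'" using e q by (metis prime_dvd_power)
    then have "q^2 dvd z'^2 - p*x'^2" using sqd[OF qz] sqd[OF qx] by simp
    then have "q^2 dvd q*y'^2" using e by (metis add_diff_cancel_left')
    then have "q dvd y'" using once' q by blast
    then show False using no q qx qz by blast
  qed
  have "coprime x' z'"
  proof (rule ccontr)
    assume "\<not> coprime x' z'"
    then have "\<not> is_unit (gcd x' z')" by (simp add: coprime_iff_gcd_eq_1)
    moreover have "gcd x' z' \<noteq> 0" using z0 by simp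
    ultimately obtain l where "prime l" "l dvd gcd x' z'" using prime_divisor_exists by blast
    then have l: "prime l" "l dvd x'" "l dvd z'" by simp_all
    have "l^2 dvd z'^2 - p*x'^2" using sqd[OF l(2)] sqd[OF l(3)] by simp
    then have "l^2 dvd q*y'^2" using e by (metis add_diff_cancel_left')
    then have "l dvd y'" using once' l(1) q by blast
    then show False using no l by blast
  qed
  then show thesis using that e z0 nz nx by blast
qed

text \<open>In a reduced solution \<open>x\<close> is invertible modulo \<open>q\<close>, and
  \<open>p\<close> is the square of \<open>z / x\<close>.\<close>

lemma QuadRes_of_solution:
  fixes p q :: int
  assumes p: "prime p" and q: "prime q" and pq: "p \<noteq> q"
    and sol: "p*x^2 + q*y^2 = z^2" "z \<noteq> 0"
  shows "QuadRes q p"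
proof -
  obtain x y z where s: "p*x^2 + q*y^2 = z^2" "\<not> q dvd x"
    using legendre_coprime[OF p q pq sol] by metis
  have "coprime x q" using s(2) q by (metis coprime_commute prime_imp_coprime)
  then obtain t where t: "[x*t = 1] (mod q)" using cong_solve_coprime_int by blast
  have "[z^2 = p*x^2] (mod q)" using s(1) by (metis cong_def mod_mult_self2)
  then have "[z^2*t^2 = p*x^2*t^2] (mod q)" by (rule cong_scalar_right)
  moreover have "[(x*t)^2 = 1^2] (mod q)" using t by (rule cong_pow)
  then have "[p*(x*t)^2 = p*1^2] (mod q)" by (rule cong_scalar_left)
  then have "[p*x^2*t^2 = p] (mod q)" by (simp add: power_mult_distrib mult.assoc)
  ultimately have "[(z*t)^2 = p] (mod q)" by (metis cong_trans power_mult_distrib)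
  then show ?thesis unfolding QuadRes_def by blast
qed

section \<open>Discriminants -pq\<close>

locale two_prime_discriminant = squarefree_discriminant +
  fixes p q :: int
  assumes p_prime: "prime p" and q_prime: "prime q" and p_neq_q: "p \<noteq> q" and n_pq: "n = p * q"
begin

text \<open>The ambiguous form belonging to the factorization \<open>n = p q\<close>; its lattice is
  the ramified ideal of norm \<open>p\<close>. It need not be reduced, as either prime may be the
  larger one.\<close>

definition t :: bqf where "t = (p, p, (p + q) div 4)"

lemma pq_odd: "odd p" "odd q" using n_odd unfolding n_pq by simp_all

lemma pq_ge_3: "p \<ge> 3" "q \<ge> 3"
proof -
  have "p > 1" "q > 1" using p_prime q_prime prime_gt_1_int by blast+
  moreover have "p \<noteq> 2" "q \<noteq> 2" using pq_odd by auto
  ultimately show "p \<ge> 3" "q \<ge> 3" by linarith+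
qed

lemma four_dvd_sum: "4 * ((p + q) div 4) = p + q"
proof -
  have "p * q mod 4 = 3" using n_mod4 unfolding n_pq cong_def by simp
  then have "(p mod 4) * (q mod 4) mod 4 = 3" by (simp add: mod_mult_eq)
  moreover have "p mod 4 \<in> {0,1,2,3}" "q mod 4 \<in> {0,1,2,3}" by (simp_all, presburger+)
  ultimately have "(p mod 4 = 1 \<and> q mod 4 = 3) \<or> (p mod 4 = 3 \<and> q mod 4 = 1)" by auto
  then show ?thesis by presburger
qed

lemma t_mem: "(p, p, (p + q) div 4) \<in> pos_def_forms (-n)"
proof -
  have "4 * p * ((p + q) div 4) = p * (p + q)" using four_dvd_sum by (metis mult.assoc mult.left_commute)
  then have "4 * p * ((p + q) div 4) - p^2 = n" unfolding n_pq by (simp add: power2_eq_square algebra_simps)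
  then show ?thesis using n_pos pq_ge_3 by (simp add: mem_pos_def_forms)
qed

text \<open>This diagonal shape connects squares represented by \<open>t\<close> with solutions of
  \<open>p X^2 + q Y^2 = Z^2\<close>.\<close>

lemma t_eval: "4 * bqf_eval t x y = p * (2*x + y)^2 + q * y^2" for x y :: int
proof -
  have "4 * bqf_eval t x y = 4*p*x^2 + 4*p*x*y + (4 * ((p + q) div 4)) * y^2"
    by (simp add: t_def bqf_eval_def algebra_simps)
  then show ?thesis unfolding four_dvd_sum by (simp add: power2_eq_square algebra_simps)
qed

definition e :: complex where "e = of_int ((p - 1) div 2) + w"

lemma lat_t: "lat t = {of_int x * of_int p + of_int y * e |x y. True}"
  unfolding t_def lat_simp e_def ..

lemma e_cnj: "cnj e = of_int p - e"
proof -
  have "p = 2 * ((p - 1) div 2) + 1" using pq_odd(1) by presburger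
  then have "(of_int p :: complex) = of_int (2 * ((p - 1) div 2) + 1)" by (rule arg_cong)
  then show ?thesis by (simp add: e_def cnj_w)
qed

lemma t_norm: "(of_int x * of_int p + of_int y * e) * cnj (of_int x * of_int p + of_int y * e)
    = of_int (p * bqf_eval t x y)"
  using norm_form[OF t_mem, of x y] unfolding t_def e_def .

lemma cnj_lat_t: "cnj ` lat t = lat t"
proof -
  have "cnj ` lat t \<subseteq> lat t"
  proof
    fix z assume "z \<in> cnj ` lat t"
    then obtain v where v: "v \<in> lat t" "z = cnj v" by blast
    obtain x y where "v = of_int x * of_int p + of_int y * e" using v(1) unfolding lat_t by blast
    then have "z = of_int (x + y) * of_int p + of_int (-y) * e" using v(2) by (simp add: e_cnj algebra_simps)
    then show "z \<in> lat t" unfolding lat_t by blast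
  qed
  moreover from this have "cnj ` cnj ` lat t \<subseteq> cnj ` lat t" by (rule image_mono)
  ultimately show ?thesis by (simp add: image_image)
qed

text \<open>The ideal is its own conjugate, so its norm relation computes its square.\<close>

lemma lat_t_square: "set_prod (lat t) (lat t) = scale_set (of_int p) Ring"
  using lat_cnj_lat[OF t_mem] cnj_lat_t unfolding t_def by simp

abbreviation \<tau> where "\<tau> \<equiv> lat_class (lat t)"

lemma t_mem': "t \<in> pos_def_forms (-n)" using t_mem by (simp add: t_def)

lemma \<tau>_closed: "\<tau> \<in> carrier Class_group"
  using lat_class_closed[OF lat_in_Lattices[OF t_mem']] .

lemma \<tau>_square: "\<tau> \<otimes>\<^bsub>Class_group\<^esub> \<tau> = \<one>\<^bsub>Class_group\<^esub>"
proof -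
  have "(of_int p :: complex) \<noteq> 0" using pq_ge_3 by simp
  then show ?thesis
    using lat_class_mult[OF lat_in_Lattices[OF t_mem'] lat_in_Lattices[OF t_mem']]
      lat_class_scale[OF is_module_Ring] by (simp add: lat_t_square lat_class_Ring)
qed

text \<open>Otherwise \<open>t\<close> would represent 1 like the principal form, so
  \<open>p X^2 + q Y^2 = 4\<close> with \<open>X = 2a + c\<close> and \<open>Y = c\<close>. If one
  term vanishes, a prime times a square would be 1; if not, the left side is at least 6.\<close>

lemma \<tau>_nontrivial: "\<tau> \<noteq> \<one>\<^bsub>Class_group\<^esub>"
proof
  assume "\<tau> = \<one>\<^bsub>Class_group\<^esub>"
  then have "lat_class (lat t) = lat_class (lat (1,1,M))" by (simp add: lat_one lat_class_Ring)
  then have "bqf_SL2_equiv t (1,1,M)" using lat_class_lat_eq_iff[OF t_mem' one_form_mem] by blast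
  then obtain a c b d :: int where "\<forall>x y :: int. bqf_eval (1,1,M) x y = bqf_eval t (a*x + b*y) (c*x + d*y)"
    unfolding bqf_SL2_equiv_def by blast
  then have "bqf_eval (1,1,M) 1 (0::int) = bqf_eval t (a*1 + b*0) (c*1 + d*0)" by blast
  then have "4 * bqf_eval t a c = 4" by (simp add: bqf_eval_def)
  then have eq: "p * (2*a + c)^2 + q * c^2 = 4" unfolding t_eval .
  have no: "r * k^2 \<noteq> 1" if "prime r" for r k :: int
    using that by (metis dvd_triv_left not_prime_unit)
  show False
  proof (cases "c = 0 \<or> 2*a + c = 0")
    case True
    then show False
    proof
      assume "c = 0"
      then have "4 * (p * a^2) = 4" using eq by (simp add: power_mult_distrib)
      then have "p * a^2 = 1" by linarith
      then show False using no[OF p_prime] by blast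
    next
      assume c: "2*a + c = 0"
      have "q * c^2 = 4" using eq unfolding c by simp
      moreover have "c = -2*a" using c by simp
      then have "q * c^2 = 4 * (q * a^2)" by (simp add: power2_eq_square)
      ultimately have "q * a^2 = 1" by linarith
      then show False using no[OF q_prime] by blast
    qed
  next
    case False
    have "p * 1 \<le> p * (2*a + c)^2" "q * 1 \<le> q * c^2"
      using False pq_ge_3 by (intro mult_left_mono; simp add: int_one_le_iff_zero_less)+
    then show False using eq pq_ge_3 by linarith
  qed
qed

text \<open>The ratios of \<open>u\<close> and \<open>v\<close> are real elements of the ring, that
  is, integers, in both directions. This makes the norm of a lattice well defined.\<close>

lemma scale_Ring_unique:
  assumes "u > 0" "v > 0" "scale_set (of_real u) Ring = scale_set (of_real v) Ring"
  shows "u = v"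
proof -
  have int: "\<exists>k::int. u = v * of_int k" if uv: "u > 0" "v > 0" "scale_set (of_real u) Ring = scale_set (of_real v) Ring" for u v
  proof -
    have "complex_of_real u * 1 \<in> scale_set (of_real u) Ring" using of_int_Ring[of 1] by (intro scale_setI) simp
    then have "complex_of_real u \<in> scale_set (of_real v) Ring" using uv by simp
    then obtain r where r: "complex_of_real u = of_real v * r" "r \<in> Ring" by (auto simp: scale_set_def)
    obtain x y where xy: "r = of_int x + of_int y * w" using r(2) by (auto simp: Ring_def)
    have "Im r = 0" using arg_cong[OF r(1), of Im] uv by simp
    moreover have "Im r = of_int y * sqrt (of_int n) / 2" by (simp add: xy w_def)
    ultimately have "y = 0" using n_pos by simp
    then have "r = of_int x" using xy by simp
    then have "u = v * of_int x" using arg_cong[OF r(1), of Re] by simp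
    then show ?thesis by blast
  qed
  obtain k where k: "u = v * of_int k" using int[OF assms] by blast
  obtain l where l: "v = u * of_int l" using int[OF assms(2,1) assms(3)[symmetric]] by blast
  have "v * 1 = v * (of_int k * of_int l)" using k l by (metis mult.assoc mult.right_neutral)
  then have "real_of_int (k * l) = of_int 1" using assms(2) by simp
  then have kl: "k * l = 1" by (simp only: of_int_eq_iff)
  have "k > 0" using k assms by (simp add: zero_less_mult_iff)
  then have "k = 1" using kl by (simp add: zmult_eq_1_iff)
  then show ?thesis using k by simp
qed

text \<open>Write the ideal of \<open>t\<close> as \<open>s I^2\<close> with \<open>I\<close> of
  norm \<open>a\<close>. Norms give \<open>p = \<bar>s\<bar>^2 a^2\<close>, so the element
  \<open>s a^2\<close> of the ideal has norm \<open>p a^2\<close>. Hence \<open>t\<close> represents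
  \<open>a^2\<close>, which solves the Legendre equation with \<open>z = 2a\<close>.\<close>

lemma QuadRes_if_square:
  assumes x: "x \<in> carrier Class_group" "x \<otimes>\<^bsub>Class_group\<^esub> x = \<tau>"
  shows "QuadRes q p"
proof -
  obtain f where f: "f \<in> reduced_forms n" "x = lat_class (lat f)" using Class_group_cases[OF x(1)] .
  obtain a b c where fe: "f = (a,b,c)" by (cases f)
  have fm: "(a,b,c) \<in> pos_def_forms (-n)" "f \<in> pos_def_forms (-n)" using reduced_mem[OF f(1)] fe by auto
  have a: "a > 0" using form_params(1)[OF fm(1)] .
  let ?S = "set_prod (lat f) (lat f)"
  have "lat_class ?S = \<tau>" using x(2) lat_class_mult[OF lat_in_Lattices[OF fm(2)] lat_in_Lattices[OF fm(2)]] f(2) by simp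
  then obtain s where s: "s \<noteq> 0" "lat t = scale_set s ?S"
    using lat_class_eq_iff[OF is_module_set_prod[OF is_module_lat[OF fm(2)]] is_module_lat[OF t_mem']] by blast
  have cs: "cnj ` scale_set s X = scale_set (cnj s) (cnj ` X)" for X by (simp add: scale_set_def image_image)
  have fN: "set_prod (lat f) (cnj ` lat f) = scale_set (of_int a) Ring" using lat_cnj_lat[OF fm(1)] fe by simp
  have "set_prod ?S (cnj ` ?S) = set_prod (set_prod (lat f) (cnj ` lat f)) (set_prod (lat f) (cnj ` lat f))"
    unfolding cnj_set_prod by (metis set_prod_assoc set_prod_commute)
  also have "\<dots> = scale_set (of_int a * of_int a) Ring"
    unfolding fN set_prod_scale set_prod_Ring[OF is_module_Ring] ..
  finally have SN: "set_prod ?S (cnj ` ?S) = scale_set (of_int a * of_int a) Ring" .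
  have "scale_set (of_int p) Ring = set_prod (lat t) (cnj ` lat t)"
    unfolding cnj_lat_t lat_t_square ..
  also have "\<dots> = scale_set (s * cnj s * (of_int a * of_int a)) Ring"
    unfolding s(2) cs set_prod_scale SN scale_set_scale ..
  finally have "scale_set (of_real (of_int p)) Ring = scale_set (of_real ((cmod s)^2 * (of_int a * of_int a))) Ring"
    unfolding complex_norm_square[symmetric] by simp
  moreover have "real_of_int p > 0" "(cmod s)^2 * (of_int a * of_int a) > 0" using pq_ge_3 s(1) a by simp_all
  ultimately have pr: "of_int p = (cmod s)^2 * (real_of_int a * of_int a)" by (intro scale_Ring_unique)
  have "of_int a * of_int a \<in> ?S" unfolding fe by (intro set_prodI lat_gens)
  then have "s * (of_int a * of_int a) \<in> lat t" unfolding s(2) by (rule scale_setI)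
  then obtain x y where xy: "s * (of_int a * of_int a) = of_int x * of_int p + of_int y * e"
    unfolding lat_t by blast
  have "of_int (p * bqf_eval t x y) = (s * (of_int a * of_int a)) * cnj (s * (of_int a * of_int a))"
    unfolding xy t_norm ..
  also have "\<dots> = (s * cnj s) * (of_int a * of_int a) * (of_int a * of_int a)" by (simp add: mult_ac)
  also have "s * cnj s = of_real ((cmod s)^2)" by (rule complex_norm_square[symmetric])
  also have "of_real ((cmod s)^2) * (of_int a * of_int a) * (of_int a * of_int a)
      = complex_of_real ((cmod s)^2 * (real_of_int a * of_int a)) * of_int (a^2)"
    by (simp add: power2_eq_square)
  also have "\<dots> = of_int (p * a^2)" unfolding pr[symmetric] by simp
  finally have "p * bqf_eval t x y = p * a^2" by (simp only: of_int_eq_iff)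
  then have "bqf_eval t x y = a^2" using pq_ge_3 by simp
  then have "p * (2*x + y)^2 + q * y^2 = (2*a)^2" using t_eval[of x y] by (simp add: power_mult_distrib)
  moreover have "2*a \<noteq> 0" using a by simp
  ultimately show ?thesis using QuadRes_of_solution[OF p_prime q_prime p_neq_q] by blast
qed

text \<open>The coprimality is arranged for the sake of the ideal built from this value:
  \<open>p (2x + y)\<close> will be the trace of the element of norm \<open>p z^2\<close>.\<close>

lemma square_represented:
  assumes "QuadRes q p" "QuadRes p q"
  obtains x y z :: int where "bqf_eval t x y = z^2" "z \<noteq> 0" "coprime (p * (2*x + y)) z"
proof -
  obtain X0 Y0 Z0 where "p*X0^2 + q*Y0^2 = Z0^2" "Z0 \<noteq> 0"
    using legendre_equation[OF p_prime q_prime p_neq_q assms] .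
  then obtain X Y Z where s: "p*X^2 + q*Y^2 = Z^2" "Z \<noteq> 0" "coprime X Z" "\<not> p dvd Z"
    using legendre_coprime[OF p_prime q_prime p_neq_q] by metis
  have cpZ: "coprime p Z" using p_prime s(4) by (rule prime_imp_coprime)
  show thesis
  proof (cases "odd X \<and> odd Y")
    case True
    \<comment> \<open>With both unknowns odd, \<open>Z\<close> is even and \<open>X = 2x + Y\<close>
      can be solved for \<open>x\<close>.\<close>
    then have "even (p*X^2 + q*Y^2)" using pq_odd by simp
    then have "even Z" using s(1) by simp
    then obtain z where z: "Z = 2*z" by blast
    have "even (X - Y)" using True by simp
    then obtain x where x: "X - Y = 2*x" by (rule evenE)
    then have X: "2*x + Y = X" by simp
    have "4 * bqf_eval t x Y = 4 * z^2" using t_eval[of x Y] s(1) unfolding X z by (simp add: power_mult_distrib)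
    then have "bqf_eval t x Y = z^2" by simp
    moreover have "z \<noteq> 0" using s(2) z by simp
    moreover have "coprime (p * (2*x + Y)) z" using cpZ s(3) unfolding X z by simp
    ultimately show thesis using that by blast
  next
    case False
    \<comment> \<open>Here the solution is doubled instead; oddness of \<open>Z\<close> keeps it
      coprime to the doubled \<open>X\<close>.\<close>
    have Zodd: "odd Z"
    proof
      assume ev: "even Z"
      then have "even (p*X^2 + q*Y^2)" using s(1) by simp
      then have "even X" using False pq_odd by auto
      then have "2 dvd (1::int)" using ev s(3) by (metis coprime_common_divisor)
      then show False by simp
    qed
    have X: "2*(X - Y) + 2*Y = 2*X" by simp
    have "4 * bqf_eval t (X - Y) (2*Y) = 4 * Z^2"
      using t_eval[of "X - Y" "2*Y"] s(1) unfolding X by (simp add: power_mult_distrib algebra_simps)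
    then have "bqf_eval t (X - Y) (2*Y) = Z^2" by simp
    moreover have "coprime (p * (2*(X - Y) + 2*Y)) Z" using cpZ s(3) Zodd unfolding X by simp
    ultimately show thesis using that s(2) by blast
  qed
qed

text \<open>An element \<open>\<alpha>\<close> of the ideal \<open>T\<close> of norm \<open>p\<close> with \<open>\<alpha> \<cdot> cnj \<alpha> = p z^2\<close> gives the ideal
  \<open>J = (\<alpha> / p) T\<close> of norm \<open>z^2\<close>. Since \<open>z\<close> is coprime to the trace of \<open>\<alpha>\<close>, \<open>J\<close> is the square of
  \<open>I = z Ring + J\<close>.\<close>

lemma square_if_QuadRes:
  assumes "QuadRes q p" "QuadRes p q"
  shows "\<exists>x \<in> carrier Class_group. x \<otimes>\<^bsub>Class_group\<^esub> x = \<tau>"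
proof -
  obtain x y z :: int where xyz: "bqf_eval t x y = z^2" "z \<noteq> 0" "coprime (p * (2*x + y)) z"
    using square_represented[OF assms] .
  define \<alpha> where "\<alpha> = of_int x * of_int p + of_int y * e"
  define P where "P = (of_int p :: complex)"
  define Z where "Z = (of_int z :: complex)"
  have P0: "P \<noteq> 0" and Z0: "Z \<noteq> 0" using pq_ge_3 xyz(2) by (simp_all add: P_def Z_def)
  have \<alpha>T: "\<alpha> \<in> lat t" unfolding lat_t \<alpha>_def by blast
  have c\<alpha>T: "cnj \<alpha> \<in> lat t" using \<alpha>T cnj_lat_t by blast
  have \<alpha>N: "\<alpha> * cnj \<alpha> = P * (Z * Z)"
    using t_norm[of x y] xyz(1) unfolding \<alpha>_def P_def Z_def by (simp add: power2_eq_square)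
  have \<alpha>0: "\<alpha> \<noteq> 0" using \<alpha>N P0 Z0 by auto
  have tr: "\<alpha> + cnj \<alpha> = of_int (p * (2*x + y))" unfolding \<alpha>_def by (simp add: e_cnj algebra_simps)
  have TT: "u * v / P \<in> Ring" if "u \<in> lat t" "v \<in> lat t" for u v
    using set_prodI[OF that] P0 unfolding lat_t_square P_def by (simp add: mem_scale_set)
  define J where "J = scale_set (\<alpha> / P) (lat t)"
  have Jmod: "is_module J" unfolding J_def by (intro is_module_scale is_module_lat t_mem')
  note Jad = is_moduleD(1)[OF Jmod]
  have JI: "\<alpha> * u / P \<in> J" if "u \<in> lat t" for u using scale_setI[OF that, of "\<alpha> / P"] unfolding J_def by simp
  have JE: "\<exists>u \<in> lat t. j = \<alpha> * u / P" if "j \<in> J" for j using that unfolding J_def scale_set_def by auto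
  have JR: "J \<subseteq> Ring" using JE TT[OF \<alpha>T] by blast
  have P_t: "P \<in> lat t" unfolding P_def t_def by (rule lat_gens)
  have \<alpha>J: "\<alpha> \<in> J" using JI[OF P_t] P0 by simp
  have ZJ: "Z * Z \<in> J" using JI[OF c\<alpha>T] \<alpha>N P0 by simp
  \<comment> \<open>The products with \<open>cnj \<alpha>\<close> fall into \<open>z^2 Ring\<close>,
    which lies in the square of \<open>I\<close>.\<close>
  have cnj\<alpha>: "\<exists>r \<in> Ring. cnj \<alpha> * j = Z * (Z * r)" if "j \<in> J" for j
  proof -
    obtain u where u: "u \<in> lat t" "j = \<alpha> * u / P" using JE \<open>j \<in> J\<close> by blast
    have "cnj \<alpha> * j = (\<alpha> * cnj \<alpha>) * u / P" unfolding u(2) by simp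
    also have "\<dots> = Z * (Z * u)" unfolding \<alpha>N using P0 by simp
    finally show ?thesis using u(1) lat_Ring by blast
  qed
  define I where "I = {Z * r + j |r j. r \<in> Ring \<and> j \<in> J}"
  have Rad: "additive_set Ring" using is_moduleD(1)[OF is_module_Ring] .
  have Imod: "is_module I"
  proof -
    have "Z * 0 + 0 \<in> I" unfolding I_def using additive_setD(1)[OF Rad] additive_setD(1)[OF Jad] by blast
    moreover have "u - v \<in> I" if uv: "u \<in> I" "v \<in> I" for u v
    proof -
      obtain r j r' j' where "u = Z * r + j" "v = Z * r' + j'" and m: "r \<in> Ring" "j \<in> J" "r' \<in> Ring" "j' \<in> J"
        using uv unfolding I_def by blast
      then have "u - v = Z * (r - r') + (j - j')" by (simp add: algebra_simps)
      then show ?thesis unfolding I_def using m additive_setD(2)[OF Rad] additive_setD(2)[OF Jad] by blast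
    qed
    moreover have "w * u \<in> I" if u: "u \<in> I" for u
    proof -
      obtain r j where "u = Z * r + j" and m: "r \<in> Ring" "j \<in> J" using u unfolding I_def by blast
      then have "w * u = Z * (w * r) + w * j" by (simp add: algebra_simps)
      then show ?thesis unfolding I_def using m is_moduleD(2)[OF is_module_Ring] is_moduleD(2)[OF Jmod] by blast
    qed
    ultimately show ?thesis by (simp add: is_module_def additive_set_def)
  qed
  have IJ: "j \<in> I" if "j \<in> J" for j
  proof -
    have "j = Z * 0 + j" by simp
    then show ?thesis unfolding I_def using that additive_setD(1)[OF Rad] by blast
  qed
  have IZ: "Z * r \<in> I" if "r \<in> Ring" for r
  proof -
    have "Z * r = Z * r + 0" by simp
    then show ?thesis unfolding I_def using that additive_setD(1)[OF Jad] by blast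
  qed
  have ZR: "Z \<in> Ring" unfolding Z_def by (rule of_int_Ring)
  have IR: "I \<subseteq> Ring"
    unfolding I_def using JR is_module_Ring_mult[OF is_module_Ring ZR] additive_setD(4)[OF Rad] by blast
  have "\<alpha> \<in> I" using IJ \<alpha>J by blast
  then have IL: "I \<in> carrier Lattices" using module_in_Lattices[OF Imod IR _ \<alpha>0] by blast
  have "set_prod I I = J"
  proof
    show "set_prod I I \<subseteq> J"
    proof (rule set_prod_least[OF Jad])
      fix u v assume uv: "u \<in> I" "v \<in> I"
      obtain r j r' j' where u: "u = Z * r + j" and v: "v = Z * r' + j'"
        and m: "r \<in> Ring" "j \<in> J" "r' \<in> Ring" "j' \<in> J" using uv unfolding I_def by blast
      have RJ: "c * k \<in> J" if "c \<in> Ring" "k \<in> J" for c k using is_module_Ring_mult[OF Jmod that] .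
      have RR: "c * k \<in> Ring" if "c \<in> Ring" "k \<in> Ring" for c k using is_module_Ring_mult[OF is_module_Ring that] .
      \<comment> \<open>Every term has a factor in \<open>J\<close>; for the first one this is
        \<open>z^2 = \<alpha> * cnj \<alpha> / p\<close>.\<close>
      have "u * v = (r * r') * (Z * Z) + ((Z * r) * j' + ((Z * r') * j + j * j'))"
        unfolding u v by (simp add: algebra_simps)
      moreover have "(r * r') * (Z * Z) \<in> J" "(Z * r) * j' \<in> J" "(Z * r') * j \<in> J" "j * j' \<in> J"
        using m JR ZR ZJ RJ RR by blast+
      ultimately show "u * v \<in> J" using additive_setD(4)[OF Jad] by metis
    qed
    show "J \<subseteq> set_prod I I"
    proof
      fix j assume j: "j \<in> J"
      note Pad = additive_set_prod[of I I]
      \<comment> \<open>Since the trace of \<open>\<alpha>\<close> is coprime to \<open>z\<close>,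
        \<open>j\<close> is a combination of \<open>\<alpha> j\<close>,
        \<open>cnj \<alpha> * j\<close> and \<open>z j\<close>, and each of these lies in the square
        of \<open>I\<close>.\<close>
      obtain A B where AB: "A * (p * (2*x + y)) + B * z = 1"
        using xyz(3) bezout_int[of "p * (2*x + y)" z] by (auto simp: coprime_iff_gcd_eq_1)
      have "of_int (A * (p * (2*x + y)) + B * z) * j = (of_int A * of_int (p * (2*x + y)) + of_int B * Z) * j"
        unfolding Z_def by simp
      then have "of_int (A * (p * (2*x + y)) + B * z) * j = of_int A * (\<alpha> * j) + (of_int A * (cnj \<alpha> * j) + of_int B * (Z * j))"
        unfolding tr[symmetric] by (simp only: ring_distribs mult.assoc add.assoc)
      then have eq: "j = of_int A * (\<alpha> * j) + (of_int A * (cnj \<alpha> * j) + of_int B * (Z * j))" unfolding AB by simp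
      have "\<alpha> * j \<in> set_prod I I" using IJ \<alpha>J j by (intro set_prodI) blast+
      moreover have "Z * j \<in> set_prod I I"
        using set_prodI[of "Z * 1" I j I] IZ[of 1] of_int_Ring[of 1] IJ[OF j] by simp
      moreover have "cnj \<alpha> * j \<in> set_prod I I"
      proof -
        obtain r where r: "r \<in> Ring" "cnj \<alpha> * j = Z * (Z * r)" using cnj\<alpha>[OF j] by blast
        then show ?thesis using set_prodI[of "Z * 1" I "Z * r" I] IZ[of 1] IZ[OF r(1)] of_int_Ring[of 1] by simp
      qed
      ultimately show "j \<in> set_prod I I"
        by (subst eq) (intro additive_setD(4)[OF Pad] additive_set_of_int_mult[OF Pad])
    qed
  qed
  then have "lat_class I \<otimes>\<^bsub>Class_group\<^esub> lat_class I = lat_class J" using lat_class_mult[OF IL IL] by simp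
  also have "\<dots> = \<tau>" unfolding J_def
    by (rule lat_class_scale[OF is_module_lat[OF t_mem']]) (use \<alpha>0 P0 in simp)
  finally show ?thesis using lat_class_closed[OF IL] by blast
qed

lemma four_dvd_class_number_iff:
  assumes rec: "QuadRes p q \<longleftrightarrow> QuadRes q p" and two: "num_ambiguous (nat n) = 2"
  shows "4 dvd card (form_classes (-n)) \<longleftrightarrow> QuadRes q p"
proof
  assume "4 dvd card (form_classes (-n))"
  then obtain x where "x \<in> carrier Class_group" "x \<otimes>\<^bsub>Class_group\<^esub> x = \<tau>"
    using C.exists_square_root_of_involution[OF finite_Class_group _ _ \<tau>_closed \<tau>_square \<tau>_nontrivial]
      card_square_roots_of_one two order_Class_group by auto
  then show "QuadRes q p" using QuadRes_if_square by blast
next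
  assume "QuadRes q p"
  then obtain x where "x \<in> carrier Class_group" "x \<otimes>\<^bsub>Class_group\<^esub> x = \<tau>"
    using square_if_QuadRes rec by blast
  then show "4 dvd card (form_classes (-n))"
    using C.four_dvd_order[of x] \<tau>_nontrivial \<tau>_square order_Class_group by simp
qed

end

section \<open>Class numbers modulo 4\<close>

definition class_count :: "nat \<Rightarrow> nat" where
  "class_count m = card (form_classes (- int m))"

lemma nat_mod_4_3:
  assumes "m mod 4 = (3::nat)"
  shows "int m > 0" "[int m = 3] (mod 4)" "odd (int m)" "m > 0" "odd m"
proof -
  have "int m mod 4 = 3" using assms by presburger
  then show "[int m = 3] (mod 4)" by (simp add: cong_def)
  show "odd m" using assms by presburger
  then show "odd (int m)" by simp
  show "m > 0" using assms by (intro Nat.gr0I) simp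
  then show "int m > 0" by simp
qed

lemma class_count_reduced:
  assumes "m mod 4 = 3" shows "class_count m = card (reduced_forms (int m))"
  using bij_betw_same_card[OF bij_reduced_classes[OF nat_mod_4_3(1,3)[OF assms]]]
  by (simp add: class_count_def)

lemma odd_square_mod_4: "odd (l::nat) \<Longrightarrow> l^2 mod 4 = 1"
proof -
  assume "odd l"
  then obtain j where "l = 2*j + 1" by (rule oddE)
  then have "l^2 = 1 + 4*(j^2 + j)" by (simp add: power2_eq_square algebra_simps)
  then show ?thesis by simp
qed

lemma mod_4_square_mult:
  assumes "(l^2 * N) mod 4 = (3::nat)"
  shows "odd l" "N mod 4 = 3"
proof -
  have "odd (l^2 * N)" using assms by presburger
  then show l: "odd l" by simp
  have "(l^2 mod 4) * (N mod 4) mod 4 = 3" using assms by (simp add: mod_mult_eq)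
  then show "N mod 4 = 3" using odd_square_mod_4[OF l] by simp
qed

section \<open>Recursions for the class number modulo 4\<close>

definition primitive_count :: "nat \<Rightarrow> nat \<Rightarrow> nat" where
  "primitive_count l m = card (reduced_primitive_at (int l) (int m))"

lemma class_count_split:
  assumes l: "prime l" and m: "(l^2 * N) mod 4 = 3"
  shows "class_count (l^2 * N) = primitive_count l (l^2 * N) + class_count N"
proof -
  have "N mod 4 = 3" using mod_4_square_mult m by blast
  then show ?thesis
    using card_reduced_forms_split[of "int N" "int l"] l m nat_mod_4_3
    by (simp add: class_count_reduced primitive_count_def prime_gt_0_nat)
qed

lemma class_count_primitive:
  assumes "N mod 4 = 3" "\<not> l^2 dvd N"
  shows "class_count N = primitive_count l N"
proof -
  have "\<not> (int l)^2 dvd int N" using assms(2) by (metis int_dvd_int_iff of_nat_power)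
  then show ?thesis
    using reduced_primitive_at_eq[OF nat_mod_4_3(1)[OF assms(1)]] assms(1)
    by (simp add: class_count_reduced primitive_count_def)
qed

lemma kkk_reduced_primitive:
  assumes "N mod 4 = 3" "(k,k,k) \<in> reduced_primitive_at (int l) (int N)"
  shows "N = 3 * (nat k)^2" "\<not> l dvd nat k"
proof -
  have k: "k > 0" "3*k^2 = int N" "\<not> int l dvd k"
    using assms(2) nat_mod_4_3(1)[OF assms(1)]
    by (auto simp: reduced_primitive_at_def reduced_forms_iff primitive_at_def power2_eq_square)
  have "int (3 * (nat k)^2) = int N" using k by simp
  then show "N = 3 * (nat k)^2" by (simp only: of_nat_eq_iff)
  have "\<not> int l dvd int (nat k)" using k by simp
  then show "\<not> l dvd nat k" by (simp only: int_dvd_int_iff not_False_eq_True)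
qed

text \<open>Hypothesis \<open>nk\<close> rules out forms \<open>(k,k,k)\<close> primitive at
  \<open>l\<close>, whose automorphisms would identify good points.\<close>

lemma primitive_count_raise:
  assumes l: "prime l" and m: "(l^2 * N) mod 4 = 3"
    and nk: "\<And>k. N = 3 * k^2 \<Longrightarrow> l dvd k"
  shows "primitive_count l (l^2 * N) = primitive_count l N * (l + 1 - num_roots (int l) (int N))"
proof -
  have N: "odd l" "N mod 4 = 3" using mod_4_square_mult m by blast+
  have "(k,k,k) \<notin> reduced_primitive_at (int l) (int N)" for k
    using kkk_reduced_primitive[OF N(2)] nk by blast
  then have "card (reduced_primitive_at (int l) ((int l)^2 * int N)) =
    card (reduced_primitive_at (int l) (int N)) * (nat (int l + 1) - num_roots (int l) (int N))"
    using l N nat_mod_4_3[OF N(2)] by (intro card_reduced_primitive_raise_generic) auto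
  moreover have "nat (int l + 1) = l + 1" by simp
  ultimately show ?thesis by (simp add: primitive_count_def)
qed

text \<open>\<open>l + 1\<close> and the number of roots are even, so the primitive part is a
  product of two even numbers.\<close>

lemma class_count_raise_not_dvd:
  assumes l: "prime l" and m: "(l^2 * N) mod 4 = 3"
    and nl: "\<not> l dvd N" and nk: "\<nexists>k. N = 3 * k^2" and ev: "even (class_count N)"
  shows "[class_count (l^2 * N) = class_count N] (mod 4)"
proof -
  have N: "odd l" "N mod 4 = 3" using mod_4_square_mult m by blast+
  have "\<not> l^2 dvd N" using nl by (metis dvd_power dvd_trans pos2)
  then have P: "primitive_count l N = class_count N" using class_count_primitive N(2) by simp
  have "\<not> int l dvd int N" using nl by (simp only: int_dvd_int_iff not_False_eq_True)
  then have "even (num_roots (int l) (int N))" using N(1) l by (intro even_num_roots) (simp_all add: prime_gt_0_nat)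
  then have "even (l + 1 - num_roots (int l) (int N))" using N(1) by simp
  then obtain i where "l + 1 - num_roots (int l) (int N) = 2 * i" by (rule evenE)
  moreover obtain j where "class_count N = 2 * j" using ev by (rule evenE)
  ultimately have "primitive_count l (l^2 * N) = 4 * (i * j)"
    using primitive_count_raise[OF l m] nk P by simp
  then show ?thesis using class_count_split[OF l m] by (simp add: cong_def)
qed

lemma primitive_count_raise_dvd:
  assumes l: "prime l" and m: "(l^2 * N) mod 4 = 3" and dv: "l dvd N"
    and nk: "\<And>k. N = 3 * k^2 \<Longrightarrow> l dvd k"
  shows "primitive_count l (l^2 * N) = l * primitive_count l N"
proof -
  have "int l dvd int N" using dv by (simp only: int_dvd_int_iff)
  then have "num_roots (int l) (int N) = 1" using l by (intro num_roots_dvd) simp_all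
  then show ?thesis using primitive_count_raise[OF l m nk] by simp
qed

lemma class_count_raise_dvd:
  assumes l: "prime l" and m: "(l^2 * N) mod 4 = 3" and dv: "l dvd N" "\<not> l^2 dvd N"
    and nk: "\<And>k. N = 3 * k^2 \<Longrightarrow> l dvd k"
  shows "class_count (l^2 * N) = (l + 1) * class_count N"
  using class_count_split[OF l m] primitive_count_raise_dvd[OF l m dv(1) nk]
    class_count_primitive[OF mod_4_square_mult(2)[OF m] dv(2)] by simp

text \<open>From \<open>l^2 N\<close> to \<open>l^4 N\<close> the primitive count is multiplied by
  \<open>l\<close>. Writing primitive counts as differences of class numbers gives
  \<open>R(l^4 N) + l R(N) = (l+1) R(l^2 N)\<close>. The hypothesis makes
  \<open>(l+1) R(l^2 N)\<close> and \<open>(l+1) R(N)\<close> divisible by 4.\<close>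

lemma class_count_raise_twice:
  assumes l: "prime l" and m: "(l^2 * (l^2 * N)) mod 4 = 3"
    and ev: "(even (class_count (l^2 * N)) \<and> even (class_count N)) \<or> l mod 4 = 3"
  shows "[class_count (l^2 * (l^2 * N)) = class_count N] (mod 4)"
proof -
  have N: "odd l" "(l^2 * N) mod 4 = 3" using mod_4_square_mult m by blast+
  \<comment> \<open>In \<open>l^2 N\<close> no exceptional form is primitive at \<open>l\<close>,
    not even for \<open>l = 3\<close>: otherwise \<open>l^2\<close> would divide 3.\<close>
  have nk: "l dvd k" if "l^2 * N = 3 * k^2" for k
  proof (rule ccontr)
    assume nd: "\<not> l dvd k"
    then have "coprime (l^2) (k^2)" using l prime_imp_coprime by simp
    moreover have "l^2 dvd 3 * k^2" using that by (metis dvd_triv_left)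
    ultimately have l3: "l^2 dvd 3" by (simp add: coprime_dvd_mult_left_iff)
    then have "l^2 \<le> 3" by (rule dvd_imp_le) simp
    moreover have "l \<ge> 2" using l by (rule prime_ge_2_nat)
    then have "l^2 \<ge> 2^2" by (rule power_mono) simp
    ultimately show False by simp
  qed
  have "l dvd l^2 * N" by (simp add: power2_eq_square)
  then have "primitive_count l (l^2 * (l^2 * N)) = l * primitive_count l (l^2 * N)"
    using primitive_count_raise_dvd[OF l m _ nk] by blast
  then have e: "class_count (l^2 * (l^2 * N)) + l * class_count N = (l + 1) * class_count (l^2 * N)"
    using class_count_split[OF l m] class_count_split[OF l N(2)] by (simp add: algebra_simps)
  have "4 dvd (l + 1) * class_count (l^2 * N) \<and> 4 dvd (l + 1) * class_count N"
  proof -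
    have "2 * 2 dvd (l + 1) * class_count (l^2 * N) \<and> 2 * 2 dvd (l + 1) * class_count N"
      if "even (class_count (l^2 * N))" "even (class_count N)"
      using N(1) that by (intro conjI mult_dvd_mono) simp_all
    moreover have "4 dvd (l + 1)" if "l mod 4 = 3" using that by presburger
    ultimately show ?thesis using ev by (metis dvd_mult2 mult_2 numeral_Bit0)
  qed
  then obtain i j where i: "(l + 1) * class_count (l^2 * N) = 4 * i" and j: "(l + 1) * class_count N = 4 * j"
    unfolding dvd_def by blast
  have "class_count (l^2 * (l^2 * N)) + 4 * j = class_count N + 4 * i"
    using e i j by (simp add: algebra_simps)
  then show ?thesis unfolding cong_def by (metis mod_mult_self2)
qed

text \<open>The one step in which an exceptional form counts: the primitive part is
  \<open>3 R(N) - 2\<close>, and the imprimitive forms add \<open>R(N)\<close>.\<close>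

lemma class_count_27:
  assumes "N = 3 * k^2" "(9 * N) mod 4 = 3" "\<not> 3 dvd k"
  shows "class_count (9 * N) + 2 = 4 * class_count N"
proof -
  have p3: "prime (3::nat)" by simp
  have m: "(3^2 * N) mod 4 = 3" using assms(2) by simp
  then have N: "N mod 4 = 3" using mod_4_square_mult by blast
  have "\<not> 3^2 dvd N"
  proof
    assume "3^2 dvd N"
    then have "3 * 3 dvd 3 * k^2" using assms(1) by (simp add: power2_eq_square)
    then have "3 dvd k^2" by simp
    then have "3 dvd k" using p3 prime_dvd_power by blast
    then show False using assms(3) by blast
  qed
  then have P: "class_count N = primitive_count 3 N" using class_count_primitive N by blast
  have "\<not> 3 dvd int k" using assms(3) by presburger
  then have "card (reduced_primitive_at 3 (9 * int N)) + 2 = 3 * card (reduced_primitive_at 3 (int N))"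
    using assms(1) nat_mod_4_3(3)[OF N] by (intro card_reduced_primitive_raise_3[of _ "int k"]) simp_all
  then have "primitive_count 3 (3^2 * N) + 2 = 3 * primitive_count 3 N" by (simp add: primitive_count_def)
  then show ?thesis using class_count_split[OF p3 m] P by simp
qed

lemma not_three_square:
  assumes "prime (p::nat)" "odd e" "\<not> p dvd k" "p \<noteq> 3"
  shows "p^e * k \<noteq> 3 * x^2"
proof
  assume eq: "p^e * k = 3 * x^2"
  have "prime (3::nat)" by simp
  then have "\<not> p dvd 3" using assms(1,4) primes_dvd_imp_eq by blast
  then have "\<not> p dvd 3 * k" using assms(1,3) by (simp add: prime_dvd_mult_iff)
  moreover have "p^e * (3 * k) = (3 * x)^2" using eq by (simp add: power2_eq_square algebra_simps)
  ultimately show False using odd_exponent_nonsquare[OF assms(1,2)] by blast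
qed

lemma two_odd_exponents_not_three_square:
  assumes h: "prime (p::nat)" "prime q" "p \<noteq> q" "odd e" "odd f" "\<not> p dvd k" "\<not> q dvd k"
  shows "p^e * (q^f * k) \<noteq> 3 * x^2"
proof -
  have nd: "\<not> p dvd q^f * k" "\<not> q dvd p^e * k"
    using h(1,2,3,6,7) by (metis prime_dvd_mult_iff prime_dvd_power primes_dvd_imp_eq)+
  show ?thesis
  proof (cases "p = 3")
    case False
    then show ?thesis using not_three_square[OF h(1,4) nd(1)] by blast
  next
    case True
    then have "q \<noteq> 3" using h(3) by simp
    then have "q^f * (p^e * k) \<noteq> 3 * x^2" using not_three_square[OF h(2,5) nd(2)] by blast
    then show ?thesis by (simp add: mult.left_commute)
  qed
qed

text \<open>The remaining case of a single prime of odd exponent. The residue 2 for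
  \<open>p = 3\<close> is cancelled by the correction in \<open>3H\<close>, as
  \<open>3 * 2 - 2 = 4\<close>; so \<open>3H\<close> is divisible by 4 for every such
  \<open>p\<close>. The induction adds 4 to the exponent at a time.\<close>

lemma class_count_one_odd_exponent:
  assumes p: "prime (p::nat)" "p mod 4 = 3" and k: "\<not> p dvd k" and m: "(p^(4*a+3) * k^2) mod 4 = 3"
  shows "[class_count (p^(4*a+3) * k^2) = (if p = 3 then 2 else 0)] (mod 4)"
  using m
proof (induction a)
  case 0
  have e: "p^(4*0+3) * k^2 = p^2 * (p * k^2)" by (simp add: numeral_eq_Suc)
  have m: "(p^2 * (p * k^2)) mod 4 = 3" using 0 unfolding e .
  have nk2: "\<not> p dvd k^2" using p(1) k prime_dvd_power by blast
  show ?case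
  proof (cases "p = 3")
    case True
    have "class_count (9 * (3 * k^2)) + 2 = 4 * class_count (3 * k^2)"
      using m k True by (intro class_count_27[OF refl]) simp_all
    then have "class_count (p^2 * (p * k^2)) + 2 = 4 * class_count (3 * k^2)" using True by simp
    then have "class_count (p^2 * (p * k^2)) mod 4 = 2" by presburger
    then show ?thesis using True unfolding e by (simp add: cong_def)
  next
    case False
    have "\<not> p^2 dvd p * k^2" using nk2 p(1) by (simp add: power2_eq_square)
    moreover have "p * k^2 \<noteq> 3 * x^2" for x using not_three_square[OF p(1) _ nk2 False, of 1] by simp
    ultimately have "class_count (p^2 * (p * k^2)) = (p + 1) * class_count (p * k^2)"
      using class_count_raise_dvd[OF p(1) m] by simp
    moreover have "4 dvd p + 1" using p(2) by presburger
    then have "4 dvd (p + 1) * class_count (p * k^2)" by (rule dvd_mult2)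
    ultimately have "4 dvd class_count (p^2 * (p * k^2))" by metis
    then show ?thesis using False unfolding e by (simp add: cong_0_iff)
  qed
next
  case (Suc a)
  let ?N = "p^(4*a+3) * k^2"
  have e: "p^(4*Suc a+3) * k^2 = p^2 * (p^2 * ?N)" by (simp add: power_add numeral_eq_Suc algebra_simps)
  have m: "(p^2 * (p^2 * ?N)) mod 4 = 3" using Suc.prems unfolding e .
  then have "?N mod 4 = 3" using mod_4_square_mult by blast
  then have "[class_count ?N = (if p = 3 then 2 else 0)] (mod 4)" by (rule Suc.IH)
  moreover have "[class_count (p^2 * (p^2 * ?N)) = class_count ?N] (mod 4)"
    using class_count_raise_twice[OF p(1) m] p(2) by blast
  ultimately show ?case unfolding e using cong_trans by blast
qed

lemma num_ambiguous_two_odd_exponents: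
  assumes p: "prime (p::nat)" "odd e" and q: "prime q" "odd f" "p \<noteq> q"
    and k: "\<not> p dvd k" "\<not> q dvd k" "k > 0"
  shows "2 * num_ambiguous (p^e * (q^f * k)) = (e + 1) * ((f + 1) * num_divisors k)"
    and "p^e * (q^f * k) \<noteq> i^2"
proof -
  have nd: "\<not> p dvd q^f * k"
    using p q k by (metis prime_dvd_mult_iff prime_dvd_power primes_dvd_imp_eq)
  have pos: "q^f * k > 0" using k q prime_gt_0_nat by simp
  have ns: "p^e * (q^f * k) \<noteq> i^2" for i using odd_exponent_nonsquare[OF p nd] .
  then show "p^e * (q^f * k) \<noteq> i^2" .
  have "p^e * (q^f * k) > 0" using pos p prime_gt_0_nat by simp
  then have "2 * num_ambiguous (p^e * (q^f * k)) = num_divisors (p^e * (q^f * k))"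
    using num_divisors_nonsquare ns by simp
  then show "2 * num_ambiguous (p^e * (q^f * k)) = (e + 1) * ((f + 1) * num_divisors k)"
    using num_divisors_prime_power_mult[OF p(1) nd pos] num_divisors_prime_power_mult[OF q(1) k(2,3)] by simp
qed

lemma even_class_count_iff:
  assumes "m mod 4 = 3" shows "even (class_count m) \<longleftrightarrow> even (num_ambiguous m)"
  using card_form_classes_parity[OF nat_mod_4_3(1,2)[OF assms]] by (simp add: class_count_def)

text \<open>One of the primes is 1 modulo 4, so the sign in the reciprocity law is positive.\<close>

lemma reciprocity_mod_4:
  assumes p: "prime (p::int)" and q: "prime q" and pq: "p \<noteq> q" and m: "[p * q = 3] (mod 4)"
  shows "QuadRes p q \<longleftrightarrow> QuadRes q p"
proof -
  have od: "odd (p * q)" using m by (rule mod4_3_odd)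
  have "p > 1" "q > 1" using p q prime_gt_1_int by blast+
  moreover have "p \<noteq> 2" "q \<noteq> 2" using od by auto
  ultimately have g: "2 < p" "2 < q" by linarith+
  have "(p mod 4) * (q mod 4) mod 4 = 3" using m by (simp add: cong_def mod_mult_eq)
  moreover have "p mod 4 \<in> {0,1,2,3}" "q mod 4 \<in> {0,1,2,3}" by (simp_all, presburger+)
  ultimately have "p mod 4 = 1 \<or> q mod 4 = 1" by auto
  then have "even ((p - 1) div 2) \<or> even ((q - 1) div 2)" by presburger
  then have "even (nat ((p - 1) div 2 * ((q - 1) div 2)))" using g by (simp add: even_nat_iff)
  then have "(-1::int) ^ nat ((p - 1) div 2 * ((q - 1) div 2)) = 1" by (rule neg_one_even_power)
  moreover have "prime (nat p)" "prime (nat q)" using p q prime_int_nat_transfer by blast+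
  then have "Legendre p q * Legendre q p = (-1) ^ nat ((p - 1) div 2 * ((q - 1) div 2))"
    using Quadratic_Reciprocity_int g pq by blast
  ultimately have L: "Legendre p q * Legendre q p = 1" by (rule trans[rotated])
  have nd: "\<not> q dvd p" "\<not> p dvd q" using p q pq primes_dvd_imp_eq by blast+
  have "\<not> [p = 0] (mod q)" "\<not> [q = 0] (mod p)" using nd by (simp_all add: cong_0_iff)
  then show ?thesis using L by (auto simp: Legendre_def split: if_splits)
qed

lemma odd_power_mod_4:
  assumes "odd e" "odd (p::nat)" shows "p^e mod 4 = p mod 4"
proof -
  obtain j where j: "e = 2*j + 1" using assms(1) by (rule oddE)
  have "(p^2)^j mod 4 = (p^2 mod 4)^j mod 4" by (simp add: power_mod)
  then have "(p^2)^j mod 4 = 1" using odd_square_mod_4[OF assms(2)] by simp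
  moreover have "p^e = (p^2)^j * p" by (simp add: j power_mult)
  ultimately show ?thesis by (metis mod_mult_left_eq mult_1)
qed

text \<open>The class number modulo 4 for \<open>p^e q^f k\<close>. Admitting a nonsquare
  \<open>k\<close> puts all numbers with two or more primes of odd exponent into one family, stable
  under the descent.\<close>

definition residue_value :: "nat \<Rightarrow> nat \<Rightarrow> nat \<Rightarrow> nat \<Rightarrow> nat \<Rightarrow> nat" where
  "residue_value p q e f k =
    (if (\<exists>j. k = j^2) \<and> e mod 4 = 1 \<and> f mod 4 = 1 \<and> \<not> QuadRes (int q) (int p) then 2 else 0)"

text \<open>Descent by square factors down to squarefree \<open>m\<close>, where the class group
  decides. Two primes of odd exponent guarantee at every stage that the class number is even and
  that the number is not three times a square, which are the conditions of the recursions.\<close>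

lemma class_count_two_odd_exponents:
  assumes "prime p" "prime q" "p \<noteq> q" "odd e" "odd f" "\<not> p dvd k" "\<not> q dvd k" "k > 0"
    and "m = p^e * (q^f * k)" "m mod 4 = 3"
  shows "[class_count m = residue_value p q e f k] (mod 4)"
  using assms
proof (induction m arbitrary: p q e f k rule: less_induct)
  case (less m)
  have fact_even: "even (class_count (p^e * (q^f * k)))"
    and fact_nk: "\<nexists>x. p^e * (q^f * k) = 3 * x^2"
    if h: "prime p" "prime q" "p \<noteq> q" "odd e" "odd f" "\<not> p dvd k" "\<not> q dvd k" "k > 0"
      "(p^e * (q^f * k)) mod 4 = 3" for p q e f k :: nat
  proof -
    obtain i j where ij: "e + 1 = 2 * i" "f + 1 = 2 * j" using h(4,5) by (metis even_plus_one_iff evenE)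
    have "2 * num_ambiguous (p^e * (q^f * k)) = 2 * (2 * (i * (j * num_divisors k)))"
      using num_ambiguous_two_odd_exponents(1)[OF h(1,4,2,5,3,6,7,8)] unfolding ij by (simp add: algebra_simps)
    then have "num_ambiguous (p^e * (q^f * k)) = 2 * (i * (j * num_divisors k))" by (simp only: mult_cancel_left) simp
    then show "even (class_count (p^e * (q^f * k)))" using even_class_count_iff[OF h(9)] by simp
    show "\<nexists>x. p^e * (q^f * k) = 3 * x^2"
      using two_odd_exponents_not_three_square[OF h(1-7)] by blast
  qed
  note pq = less.prems(1-8) and m = less.prems(9) and m4 = less.prems(10)
  have p0: "p > 1" "q > 1" using pq(1,2) prime_gt_1_nat by blast+
  have podd: "odd p" "odd q"
  proof -
    have "odd m" using nat_mod_4_3(5)[OF m4] .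
    then show "odd p" "odd q" unfolding m using pq(4,5) by (auto simp: odd_pos)
  qed
  show ?case
  proof (cases "squarefree (int m)")
    case True
    have sf: "x = 1" if "x^2 dvd m" for x :: nat
    proof -
      have "(int x)^2 dvd int m" using that by (metis int_dvd_int_iff of_nat_power)
      then have "int x dvd 1" using True squarefreeD by blast
      then show ?thesis by simp
    qed
    interpret squarefree_discriminant "int m" by unfold_locales (use nat_mod_4_3[OF m4] True in auto)
    have exp1: "i = 1" if "odd i" "\<And>x. x = r^i \<Longrightarrow> x dvd m" "r > 1" for i r :: nat
    proof (rule ccontr)
      assume "i \<noteq> 1"
      then have "2 \<le> i" using \<open>odd i\<close> by (cases i) auto
      then have "r^2 dvd m" using that(2) by (metis dvd_trans le_imp_power_dvd)
      then show False using sf \<open>r > 1\<close> by fastforce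
    qed
    have e1: "e = 1" by (rule exp1[OF pq(4) _ p0(1)]) (simp add: m)
    have f1: "f = 1" by (rule exp1[OF pq(5) _ p0(2)]) (simp add: m)
    have A: "num_ambiguous m = 2 * num_divisors k"
      using num_ambiguous_two_odd_exponents(1)[OF pq(1,4,2,5,3,6,7,8)] unfolding m e1 f1 by simp
    show ?thesis
    proof (cases "\<exists>j. k = j^2")
      case False
      \<comment> \<open>A further prime of odd exponent doubles the 2-torsion once more, and its
        order divides the class number.\<close>
      then have "even (num_divisors k)" using odd_num_divisors_iff[OF pq(8)] by blast
      then have "4 dvd num_ambiguous m" unfolding A by (auto elim!: evenE)
      then have "4 dvd class_count m" using num_ambiguous_dvd_class_number by (simp add: class_count_def dvd_trans)
      then show ?thesis using False by (simp add: residue_value_def cong_0_iff)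
    next
      case k: True
      then obtain j where j: "k = j^2" by blast
      have "j^2 dvd m" unfolding m j by simp
      then have "j = 1" by (rule sf)
      then have k1: "k = 1" using j by simp
      have mpq: "m = p * q" using m e1 f1 k1 by simp
      interpret two_prime_discriminant "int m" "int p" "int q"
        by unfold_locales (use pq mpq in auto)
      have "num_divisors 1 = 1" by (simp add: num_divisors_def)
      then have two: "num_ambiguous (nat (int m)) = 2" using A k1 by simp
      have rec: "QuadRes (int p) (int q) \<longleftrightarrow> QuadRes (int q) (int p)"
        using reciprocity_mod_4[of "int p" "int q"] pq nat_mod_4_3(2)[OF m4] mpq by simp
      have four: "4 dvd class_count m \<longleftrightarrow> QuadRes (int q) (int p)"
        using four_dvd_class_number_iff[OF rec two] by (simp add: class_count_def)
      have "even (class_count m)" using fact_even[OF pq] m m4 by simp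
      then have "class_count m mod 4 = (if QuadRes (int q) (int p) then 0 else 2)"
        using four by presburger
      then show ?thesis using k e1 f1 by (simp add: residue_value_def cong_def)
    qed
  next
    case False
    have "int m \<noteq> 0" using nat_mod_4_3(1)[OF m4] by simp
    then obtain L where L: "prime L" "L^2 dvd int m" using False squarefree_factorial_semiring by blast
    define l where "l = nat L"
    have "prime l" unfolding l_def using L(1) prime_int_nat_transfer by blast
    moreover have "int l = L" unfolding l_def using prime_ge_0_int[OF L(1)] by simp
    ultimately have l: "prime l" "int l = L" .
    have ldvd: "l^2 dvd m" using L(2) unfolding l(2)[symmetric] by (metis int_dvd_int_iff of_nat_power)
    have l1: "l > 1" using l(1) prime_gt_1_nat by blast
    have small: "N < l^2 * N" if "N > 0" for N
      using that one_less_power[OF l1, of 2] by simp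
    have small2: "N < l^2 * (l^2 * N)" if "N > 0" for N
      using small[OF that] small[of "l^2 * N"] that by linarith
    \<comment> \<open>The square to be removed belongs to one of the two distinguished primes, here
      called \<open>r\<close>.\<close>
    have step: "[class_count m = residue_value r s i j k] (mod 4)"
      if h: "prime r" "prime s" "r \<noteq> s" "odd i" "odd j" "\<not> r dvd k" "\<not> s dvd k" "m = r^i * (s^j * k)" and lr: "l = r"
      for r s i j :: nat
    proof -
      have nd: "\<not> r dvd s^j * k" using h by (metis prime_dvd_mult_iff prime_dvd_power primes_dvd_imp_eq)
      have pos: "s^j * k > 0" using h pq(8) prime_gt_0_nat by simp
      have r0: "r > 0" using h prime_gt_0_nat by blast
      have "i \<noteq> 1"
      proof
        assume "i = 1"
        then have "r * r dvd r * (s^j * k)" using ldvd h(8) lr by (simp add: power2_eq_square)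
        then have "r dvd s^j * k" using r0 by simp
        then show False using nd by blast
      qed
      then have "i = (i - 2) + 2" "odd (i - 2)" using h(4) by presburger+
      then obtain i' where i': "i = i' + 2" "odd i'" by blast
      let ?N = "r^i' * (s^j * k)"
      have mN: "m = l^2 * ?N" unfolding h(8) lr i' by (simp add: power_add power2_eq_square)
      have N4: "?N mod 4 = 3" using m4 unfolding mN by (rule mod_4_square_mult)
      have evN: "even (class_count ?N)" using fact_even[OF h(1-3) i'(2) h(5-7) pq(8) N4] .
      show ?thesis
      proof (cases "i' = 1")
        case True
        \<comment> \<open>The exponent is 3: both \<open>l + 1\<close> and the smaller class number
          are even, so the residue is 0, as \<open>residue_value\<close> demands.\<close>
        have "l dvd ?N" "\<not> l^2 dvd ?N" using nd r0 unfolding lr True by (simp_all add: power2_eq_square)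
        then have "class_count m = (l + 1) * class_count ?N"
          unfolding mN using fact_nk[OF h(1-3) i'(2) h(5-7) pq(8) N4] m4[unfolded mN]
          by (intro class_count_raise_dvd[OF l(1)]) blast+
        moreover have "even (l + 1)" using mod_4_square_mult(1)[OF m4[unfolded mN]] by simp
        then have "2 * 2 dvd (l + 1) * class_count ?N" using evN by (intro mult_dvd_mono)
        ultimately have "4 dvd class_count m" by simp
        then show ?thesis using i' True by (simp add: residue_value_def cong_0_iff)
      next
        case False
        then have "i' = (i' - 2) + 2" using i'(2) by presburger
        then obtain i2 where i2: "i' = i2 + 2" by blast
        then have i2o: "odd i2" using i'(2) by simp
        let ?M = "r^i2 * (s^j * k)"
        have NM: "?N = l^2 * ?M" unfolding lr i2 by (simp add: power_add power2_eq_square)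
        have M4: "?M mod 4 = 3" using N4 unfolding NM by (rule mod_4_square_mult)
        have evM: "even (class_count ?M)" using fact_even[OF h(1-3) i2o h(5-7) pq(8) M4] .
        have "[class_count m = class_count ?M] (mod 4)"
          unfolding mN unfolding NM using m4 evN evM unfolding mN unfolding NM
          by (intro class_count_raise_twice[OF l(1)]) blast+
        moreover have "?M > 0" using pos r0 by simp
        then have "?M < m" unfolding mN NM by (rule small2)
        then have "[class_count ?M = residue_value r s i2 j k] (mod 4)"
          by (rule less.IH[OF _ h(1-3) i2o h(5-7) pq(8) refl M4])
        moreover have "residue_value r s i2 j k = residue_value r s i j k"
        proof -
          have "i2 mod 4 = 1 \<longleftrightarrow> i mod 4 = 1" unfolding i' i2 by presburger
          then show ?thesis by (simp add: residue_value_def)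
        qed
        ultimately show ?thesis using cong_trans by metis
      qed
    qed
    consider "l = p" | "l = q" | "l \<noteq> p" "l \<noteq> q" by blast
    then show ?thesis
    proof cases
      case 1
      then show ?thesis using step pq m by blast
    next
      case 2
      have "m = q^f * (p^e * k)" using m by (simp add: mult.left_commute)
      then have s: "[class_count m = residue_value q p f e k] (mod 4)" using step pq 2 by metis
      show ?thesis
      proof (cases "\<exists>j. k = j^2")
        case False
        then show ?thesis using s by (simp add: residue_value_def)
      next
        case True
        then obtain j where j: "k = j^2" by blast
        have "odd k" using nat_mod_4_3(5)[OF m4] m by simp
        then have "odd j" using j by simp
        \<comment> \<open>As \<open>k\<close> is an odd square, \<open>m\<close> and
          \<open>p q\<close> agree modulo 4. Reciprocity then makes \<open>residue_value\<close>
          symmetric in the two primes.\<close>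
        have "[p^e * (q^f * j^2) = p * (q * 1)] (mod 4)"
          using odd_power_mod_4[OF pq(4) podd(1)] odd_power_mod_4[OF pq(5) podd(2)] odd_square_mod_4[OF \<open>odd j\<close>]
          by (intro cong_mult) (simp_all add: cong_def)
        then have "(p * q) mod 4 = 3" using m4 unfolding m j cong_def by simp
        then have "[int (p * q) = 3] (mod 4)" by (rule nat_mod_4_3)
        then have "QuadRes (int p) (int q) \<longleftrightarrow> QuadRes (int q) (int p)"
          using reciprocity_mod_4[of "int p" "int q"] pq(1-3) by simp
        then have "residue_value q p f e k = residue_value p q e f k" by (auto simp: residue_value_def)
        then show ?thesis using s by simp
      qed
    next
      case 3
      have "coprime (l^2) (p^e)" "coprime (l^2) (q^f)" using 3 l(1) pq(1,2) by (simp_all add: primes_coprime)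
      then have "l^2 dvd k" using ldvd unfolding m by (metis coprime_dvd_mult_right_iff)
      then obtain k1 where k1: "k = l^2 * k1" unfolding dvd_def by blast
      have k1': "\<not> p dvd k1" "\<not> q dvd k1" "k1 > 0" using pq(6-8) unfolding k1 by auto
      let ?N = "p^e * (q^f * k1)"
      have mN: "m = l^2 * ?N" unfolding m k1 by (simp add: algebra_simps)
      have N4: "?N mod 4 = 3" using m4 unfolding mN by (rule mod_4_square_mult)
      have evN: "even (class_count ?N)" using fact_even[OF pq(1-5) k1' N4] .
      have nkN: "\<nexists>x. ?N = 3 * x^2" using fact_nk[OF pq(1-5) k1' N4] .
      have dk: "l dvd ?N \<longleftrightarrow> l dvd k1"
        using 3 l(1) pq(1,2) by (metis dvd_mult prime_dvd_mult_iff prime_dvd_power primes_dvd_imp_eq)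
      have sq: "(\<exists>j. l^2 * u = j^2) \<longleftrightarrow> (\<exists>j. u = j^2)" for u
      proof
        assume "\<exists>j. l^2 * u = j^2"
        then obtain j where j: "l^2 * u = j^2" by blast
        then have "l^2 dvd j^2" by (metis dvd_triv_left)
        then have "l dvd j" by (simp add: pow_divides_pow_iff)
        then obtain i where "j = l * i" unfolding dvd_def by blast
        then have "l^2 * u = l^2 * i^2" using j by (simp add: power_mult_distrib)
        then show "\<exists>j. u = j^2" using l1 by auto
      next
        assume "\<exists>j. u = j^2"
        then show "\<exists>j. l^2 * u = j^2" by (metis power_mult_distrib)
      qed
      \<comment> \<open>The exponent of \<open>l\<close> in \<open>k\<close> is 2, 3 or at least
        4.\<close>
      consider "\<not> l dvd k1" | "l dvd k1" "\<not> l^2 dvd k1" | "l^2 dvd k1" by blast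
      then show ?thesis
      proof cases
        case 1
        then have "[class_count m = class_count ?N] (mod 4)"
          unfolding mN using class_count_raise_not_dvd[OF l(1) m4[unfolded mN] _ nkN evN] dk by blast
        moreover have "?N > 0" using nat_mod_4_3(4)[OF N4] .
        then have "?N < m" unfolding mN by (rule small)
        then have "[class_count ?N = residue_value p q e f k1] (mod 4)"
          by (rule less.IH[OF _ pq(1-5) k1' refl N4])
        moreover have "residue_value p q e f k1 = residue_value p q e f k"
          unfolding residue_value_def k1 sq ..
        ultimately show ?thesis using cong_trans by metis
      next
        case 2
        have "\<not> l^2 dvd ?N"
          using 2(2) \<open>coprime (l^2) (p^e)\<close> \<open>coprime (l^2) (q^f)\<close> by (metis coprime_dvd_mult_right_iff)
        then have "class_count m = (l + 1) * class_count ?N"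
          unfolding mN using class_count_raise_dvd[OF l(1) m4[unfolded mN]] dk 2(1) nkN by blast
        moreover have "even (l + 1)" using mod_4_square_mult(1)[OF m4[unfolded mN]] by simp
        then have "2 * 2 dvd (l + 1) * class_count ?N" using evN by (intro mult_dvd_mono)
        ultimately have c4: "4 dvd class_count m" by simp
        obtain u where u: "k1 = l * u" using 2(1) unfolding dvd_def by blast
        then have nu: "\<not> l dvd u" using 2(2) by (auto simp: power2_eq_square)
        \<comment> \<open>Exponent 3 in \<open>k\<close> makes \<open>k\<close> a nonsquare, which
          agrees with the class number being 0 modulo 4.\<close>
        have "k1 \<noteq> j^2" for j using odd_exponent_nonsquare[OF l(1) _ nu, of 1 j] u by simp
        then have "\<nexists>j. k = j^2" using sq[of k1] k1 by simp
        then show ?thesis using c4 by (simp add: residue_value_def cong_0_iff)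
      next
        case 3
        then obtain k2 where k2: "k1 = l^2 * k2" unfolding dvd_def by blast
        have k2': "\<not> p dvd k2" "\<not> q dvd k2" "k2 > 0" using k1' unfolding k2 by auto
        let ?M = "p^e * (q^f * k2)"
        have NM: "?N = l^2 * ?M" unfolding k2 by (simp add: algebra_simps)
        have M4: "?M mod 4 = 3" using N4 unfolding NM by (rule mod_4_square_mult)
        have evM: "even (class_count ?M)" using fact_even[OF pq(1-5) k2' M4] .
        have "[class_count m = class_count ?M] (mod 4)"
          unfolding mN unfolding NM using m4 evN evM unfolding mN unfolding NM
          by (intro class_count_raise_twice[OF l(1)]) blast+
        moreover have "?M > 0" using nat_mod_4_3(4)[OF M4] .
        then have "?M < m" unfolding mN NM by (rule small2)
        then have "[class_count ?M = residue_value p q e f k2] (mod 4)"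
          by (rule less.IH[OF _ pq(1-5) k2' refl M4])
        moreover have "residue_value p q e f k2 = residue_value p q e f k"
          unfolding residue_value_def k1 k2 sq ..
        ultimately show ?thesis using cong_trans by metis
      qed
    qed
  qed
qed

section \<open>The Kronecker symbol and the two equivalences\<close>

lemma kronecker_prime_eq_Legendre:
  assumes "prime q" "odd (q::int)" shows "kronecker a q = Legendre a q"
proof -
  have "q > 0" "q \<noteq> 2" using assms prime_gt_0_int by auto
  then show ?thesis using assms(1)
    by (simp add: kronecker_def prime_prime_factors kronecker_prime_def)
qed

lemma Legendre_eq_minus_one_iff:
  assumes "prime p" "prime q" "p \<noteq> (q::int)"
  shows "Legendre p q = -1 \<longleftrightarrow> \<not> QuadRes q p"
proof -
  have "\<not> q dvd p" using assms primes_dvd_imp_eq by blast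
  then show ?thesis by (simp add: Legendre_def cong_0_iff)
qed

lemma num_ambiguous_one_odd_exponent:
  assumes "prime (p::nat)" "odd e" "\<not> p dvd k" "k > 0"
  shows "2 * num_ambiguous (p^e * k) = (e + 1) * num_divisors k"
proof -
  have "p^e * k > 0" using assms prime_gt_0_nat by simp
  then have "num_divisors (p^e * k) = 2 * num_ambiguous (p^e * k)"
    using odd_exponent_nonsquare[OF assms(1-3)] by (intro num_divisors_nonsquare) auto
  then show ?thesis using num_divisors_prime_power_mult[OF assms(1,3,4)] by simp
qed

lemma nat_square_of_int:
  assumes "n = int m" shows "(\<exists>k. n = 3 * k^2) \<longleftrightarrow> (\<exists>k. m = 3 * k^2)"
proof
  assume "\<exists>k. n = 3 * k^2"
  then obtain k where "n = 3 * k^2" by blast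
  then have "int m = int (3 * (nat \<bar>k\<bar>)^2)" using assms by simp
  then have "m = 3 * (nat \<bar>k\<bar>)^2" by (simp only: of_nat_eq_iff)
  then show "\<exists>k. m = 3 * k^2" by blast
next
  assume "\<exists>k. m = 3 * k^2"
  then obtain k where "m = 3 * k^2" by blast
  then have "n = 3 * (int k)^2" using assms by simp
  then show "\<exists>k. n = 3 * k^2" by blast
qed

lemma prime_int_as_nat:
  assumes "prime (p::int)" shows "p = int (nat p)" "prime (nat p)"
proof -
  show "p = int (nat p)" using prime_ge_0_int[OF assms] by simp
  show "prime (nat p)" using assms prime_int_nat_transfer by blast
qed

lemma odd_class_count_iff:
  assumes n: "n = int m" and m: "m mod 4 = 3"
  shows "odd (class_count m) \<longleftrightarrow>
    (\<exists>(p :: int) (k :: int) (a :: nat). prime p \<and> coprime k p \<and> n = p ^ (4 * a + 1) * k ^ 2)"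
proof -
  have nsq: "\<nexists>k. m = k^2"
  proof
    assume "\<exists>k. m = k^2"
    then obtain k where "m = k^2" by blast
    then show False using nat_mod_4_3(5)[OF m] odd_square_mod_4[of k] m by simp
  qed
  have "odd (class_count m) \<longleftrightarrow> (\<exists>p a k. prime p \<and> \<not> p dvd k \<and> m = p^(4*a+1) * k^2)"
    using even_class_count_iff[OF m] odd_num_ambiguous_iff[OF nat_mod_4_3(4)[OF m] nsq] by blast
  also have "\<dots> \<longleftrightarrow> (\<exists>(p :: int) (k :: int) (a :: nat). prime p \<and> coprime k p \<and> n = p ^ (4 * a + 1) * k ^ 2)"
  proof
    assume "\<exists>p a k. prime p \<and> \<not> p dvd k \<and> m = p^(4*a+1) * k^2"
    then obtain p a k where h: "prime p" "\<not> p dvd k" "m = p^(4*a+1) * k^2" by blast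
    have "coprime (int k) (int p)" using h(1,2) by (metis coprime_commute coprime_int_iff prime_imp_coprime)
    moreover have "n = int p ^ (4*a+1) * int k ^ 2" unfolding n h(3) by simp
    moreover have "prime (int p)" using h(1) by simp
    ultimately show "\<exists>(p :: int) (k :: int) (a :: nat). prime p \<and> coprime k p \<and> n = p ^ (4 * a + 1) * k ^ 2" by blast
  next
    assume "\<exists>(p :: int) (k :: int) (a :: nat). prime p \<and> coprime k p \<and> n = p ^ (4 * a + 1) * k ^ 2"
    then obtain p k :: int and a where h: "prime p" "coprime k p" "n = p ^ (4 * a + 1) * k ^ 2" by blast
    note p = prime_int_as_nat(1)[OF h(1)] and p' = prime_int_as_nat(2)[OF h(1)]
    have "int ((nat p)^(4*a+1) * (nat \<bar>k\<bar>)^2) = p ^ (4*a+1) * k^2"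
      using prime_ge_0_int[OF h(1)] by simp
    then have "int m = int ((nat p)^(4*a+1) * (nat \<bar>k\<bar>)^2)" using h(3) n by metis
    then have "m = (nat p)^(4*a+1) * (nat \<bar>k\<bar>)^2" by (simp only: of_nat_eq_iff)
    moreover have "\<not> nat p dvd nat \<bar>k\<bar>"
    proof
      assume "nat p dvd nat \<bar>k\<bar>"
      then have "int (nat p) dvd int (nat \<bar>k\<bar>)" by (simp only: int_dvd_int_iff)
      then have "p dvd k" using p by simp
      then have "p dvd 1" using h(2) by (metis coprime_common_divisor dvd_refl)
      then show False using h(1) not_prime_unit by blast
    qed
    ultimately show "\<exists>p a k. prime p \<and> \<not> p dvd k \<and> m = p^(4*a+1) * k^2" using p' by blast
  qed
  finally show ?thesis .
qed

lemma two_prime_form_value: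
  assumes n: "n = int m" and m: "m mod 4 = 3"
    and h: "prime (p :: int)" "prime q" "kronecker p q = -1" "coprime k (p * q)"
      "n = p ^ (4 * a + 1) * q ^ (4 * b + 1) * k ^ 2"
  shows "[class_count m = 2] (mod 4)" "\<nexists>x. m = 3 * x^2"
proof -
  define P where "P = nat p"
  define Q where "Q = nat q"
  define K where "K = nat \<bar>k\<bar>"
  have p: "p = int P" "prime P" and q: "q = int Q" "prime Q"
    unfolding P_def Q_def using prime_int_as_nat h(1,2) by blast+
  have K: "k^2 = int (K^2)" unfolding K_def by simp
  have "int m = int (P^(4*a+1) * (Q^(4*b+1) * K^2))" using h(5) n unfolding p(1) q(1) K by (simp add: mult.assoc)
  then have me: "m = P^(4*a+1) * (Q^(4*b+1) * K^2)" by (simp only: of_nat_eq_iff)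
  \<comment> \<open>At 2 the Kronecker symbol differs from the Legendre symbol; \<open>m\<close> is
    odd, so this does not arise.\<close>
  have odd_pq: "odd q" using nat_mod_4_3(5)[OF m] unfolding me q(1) by simp
  then have L: "Legendre p q = -1" using h(2,3) kronecker_prime_eq_Legendre by simp
  have "p \<noteq> q" using L by (auto simp: Legendre_def cong_0_iff)
  then have pq: "P \<noteq> Q" "\<not> QuadRes (int Q) (int P)"
    using Legendre_eq_minus_one_iff[OF h(1,2)] L p q by auto
  have nd: "\<not> r dvd K" if r: "prime r" "int r = p \<or> int r = q" for r
  proof
    assume "r dvd K"
    then have "int r dvd int K" by (simp only: int_dvd_int_iff)
    then have "int r dvd k" by (simp add: K_def)
    moreover have "int r dvd p * q" using r(2) by auto
    ultimately have "int r dvd 1" using h(4) by (metis coprime_common_divisor)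
    then show False using r(1) by simp
  qed
  have nK: "\<not> P dvd K^2" "\<not> Q dvd K^2" using nd p q prime_dvd_power by blast+
  have K0: "K^2 > 0" using nK(1) by (intro Nat.gr0I) simp
  have "[class_count m = residue_value P Q (4*a+1) (4*b+1) (K^2)] (mod 4)"
    by (rule class_count_two_odd_exponents[OF p(2) q(2) pq(1) _ _ nK K0 me m]) simp_all
  moreover have "residue_value P Q (4*a+1) (4*b+1) (K^2) = 2"
    using pq(2) by (auto simp: residue_value_def mod_Suc)
  ultimately show "[class_count m = 2] (mod 4)" by simp
  show "\<nexists>x. m = 3 * x^2"
  proof -
    have "odd (4*a+1)" "odd (4*b+1)" by simp_all
    then show ?thesis unfolding me using two_odd_exponents_not_three_square[OF p(2) q(2) pq(1) _ _ nK] by blast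
  qed
qed

text \<open>If only one prime had odd exponent, evenness of the class number would make that
  exponent 3 modulo 4, and then \<open>3H\<close> is divisible by 4. So a second such prime exists,
  and \<open>residue_value\<close> can be read off.\<close>

lemma two_prime_form_exists:
  assumes n: "n = int m" and m: "m mod 4 = 3"
    and h: "[3 * int (class_count m) - (if \<exists>k. n = 3 * k^2 then 2 else 0) = 2] (mod 4)"
  shows "\<exists>(p :: int) (q :: int) (k :: int) (a :: nat) (b :: nat).
    prime p \<and> prime q \<and> kronecker p q = -1 \<and> coprime k (p * q) \<and>
    n = p ^ (4 * a + 1) * q ^ (4 * b + 1) * k ^ 2"
proof -
  have "even (class_count m)" using h unfolding cong_def by (auto split: if_splits) presburger+
  then have evA: "even (num_ambiguous m)" using even_class_count_iff[OF m] by simp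
  have nsq: "\<nexists>k. m = k^2"
  proof
    assume "\<exists>k. m = k^2"
    then obtain k where "m = k^2" by blast
    then show False using nat_mod_4_3(5)[OF m] odd_square_mod_4[of k] m by simp
  qed
  obtain p e k where p: "prime p" "odd e" "\<not> p dvd k" "k > 0" "m = p^e * k"
    using nonsquare_odd_exponent[OF nat_mod_4_3(4)[OF m] nsq] by blast
  have podd: "odd p" "odd k" using nat_mod_4_3(5)[OF m] p(2) unfolding p(5) by (auto simp: odd_pos)
  have "\<nexists>j. k = j^2"
  proof
    assume "\<exists>j. k = j^2"
    then obtain j where j: "k = j^2" by blast
    obtain i where i: "e = 2*i + 1" using p(2) by (rule oddE)
    have "2 * num_ambiguous m = 2 * ((i + 1) * num_divisors k)"
      using num_ambiguous_one_odd_exponent[OF p(1-4)] unfolding p(5) i by simp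
    then have "num_ambiguous m = (i + 1) * num_divisors k" by linarith
    moreover have "odd (num_divisors k)" using odd_num_divisors_iff[OF p(4)] j by blast
    ultimately have "odd i" using evA by simp
    then obtain a where "i = 2*a + 1" by (rule oddE)
    then have e: "e = 4*a + 3" using i by simp
    have oj: "odd j" using podd(2) j by simp
    \<comment> \<open>The cofactor is an odd square and \<open>e\<close> is odd, so \<open>p\<close>
      inherits the residue 3 of \<open>m\<close>.\<close>
    have "[p^e * j^2 = p * 1] (mod 4)"
      using odd_power_mod_4[OF p(2) podd(1)] odd_square_mod_4[OF oj] by (intro cong_mult) (simp_all add: cong_def)
    then have p3: "p mod 4 = 3" using m unfolding p(5) j cong_def by simp
    have "\<not> p dvd j" using p(3) j by (metis dvd_trans dvd_power pos2)
    then have c: "[class_count m = (if p = 3 then 2 else 0)] (mod 4)"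
      using class_count_one_odd_exponent[OF p(1) p3 _ , of j a] m unfolding p(5) j e by blast
    have three: "(\<exists>k. n = 3 * k^2) \<longleftrightarrow> p = 3"
    proof
      assume "\<exists>k. n = 3 * k^2"
      then obtain x where "m = 3 * x^2" using nat_square_of_int[OF n] by blast
      then have "p^e * k = 3 * x^2" using p(5) by simp
      then show "p = 3" using not_three_square[OF p(1-3)] by blast
    next
      assume p3: "p = 3"
      have "m = 3 * (3^i * j)^2" unfolding p(5) j i p3 by (simp add: power_mult_distrib power_mult[symmetric] mult.commute)
      then show "\<exists>k. n = 3 * k^2" using nat_square_of_int[OF n] by blast
    qed
    show False
    proof (cases "p = 3")
      case True
      then have "class_count m mod 4 = 2" using c by (simp add: cong_def)
      then have "(3 * int (class_count m) - 2) mod 4 = 0" by presburger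
      then show False using h three True by (simp add: cong_def)
    next
      case False
      then have "class_count m mod 4 = 0" using c by (simp add: cong_def)
      then have "(3 * int (class_count m)) mod 4 = 0" by presburger
      then show False using h three False by (simp add: cong_def)
    qed
  qed
  then obtain q f k' where q: "prime q" "odd f" "\<not> q dvd k'" "k' > 0" "k = q^f * k'"
    using nonsquare_odd_exponent[OF p(4)] by blast
  have "q dvd k" unfolding q(5) using q(2) by (simp add: odd_pos)
  then have pq: "p \<noteq> q" using p(3) by blast
  have pk': "\<not> p dvd k'" using p(3) dvd_mult unfolding q(5) by blast
  have me: "m = p^e * (q^f * k')" using p(5) q(5) by simp
  have "[class_count m = residue_value p q e f k'] (mod 4)"
    by (rule class_count_two_odd_exponents[OF p(1) q(1) pq p(2) q(2) pk' q(3,4) me m])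
  moreover have "\<nexists>k. n = 3 * k^2"
    unfolding nat_square_of_int[OF n] me
    using two_odd_exponents_not_three_square[OF p(1) q(1) pq p(2) q(2) pk' q(3)] by blast
  then have "class_count m mod 4 = 2" using h unfolding cong_def by simp presburger
  ultimately have "residue_value p q e f k' \<noteq> 0" unfolding cong_def by auto
  then have r: "\<exists>j. k' = j^2" "e mod 4 = 1" "f mod 4 = 1" "\<not> QuadRes (int q) (int p)"
    by (auto simp: residue_value_def split: if_splits)
  obtain j where j: "k' = j^2" using r(1) by blast
  obtain a b where ab: "e = 4*a + 1" "f = 4*b + 1" using r(2,3) by (metis add.commute mult_div_mod_eq)
  have "odd q" using podd(2) q(2) unfolding q(5) by (simp add: odd_pos)
  then have "kronecker (int p) (int q) = -1"
    using kronecker_prime_eq_Legendre[of "int q"] Legendre_eq_minus_one_iff[of "int p" "int q"] p(1) q(1) pq r(4) by simp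
  moreover have "\<not> p dvd j" "\<not> q dvd j" using pk' q(3) dvd_mult[of _ j j] unfolding j power2_eq_square by blast+
  then have "coprime (int j) (int p * int q)"
    using prime_imp_coprime[OF p(1), of j] prime_imp_coprime[OF q(1), of j]
    by (simp add: coprime_commute)
  moreover have "n = int p ^ (4*a+1) * int q ^ (4*b+1) * int j ^ 2"
    unfolding n me j ab by (simp add: mult.assoc)
  moreover have "prime (int p)" "prime (int q)" using p(1) q(1) by simp_all
  ultimately show ?thesis by blast
qed

theorem theorem2p5:
  fixes n :: int
  assumes "n > 0" and "[n = 3] (mod 4)"
  shows "\<exists>h :: int. 3 * hurwitz_class_number n = of_int h \<and>
    (odd h \<longleftrightarrow>
       (\<exists>(p :: int) (m :: int) (a :: nat).
          prime p \<and> coprime m p \<and> n = p ^ (4 * a + 1) * m ^ 2)) \<and>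
    ([h = 2] (mod 4) \<longleftrightarrow>
       (\<exists>(p\<^sub>1 :: int) (p\<^sub>2 :: int) (m :: int) (a :: nat) (b :: nat).
          prime p\<^sub>1 \<and> prime p\<^sub>2 \<and> kronecker p\<^sub>1 p\<^sub>2 = -1 \<and> coprime m (p\<^sub>1 * p\<^sub>2) \<and>
          n = p\<^sub>1 ^ (4 * a + 1) * p\<^sub>2 ^ (4 * b + 1) * m ^ 2))"
proof -
  define m where "m = nat n"
  have n: "n = int m" using assms(1) by (simp add: m_def)
  have "int m mod 4 = 3" using assms(2) n by (simp add: cong_def)
  then have m4: "m mod 4 = 3" by presburger
  define h where "h = 3 * int (class_count m) - (if \<exists>k. n = 3 * k^2 then 2 else 0)"
  have "3 * hurwitz_class_number n = of_int h"
    using hurwitz_eq[OF assms] unfolding h_def class_count_def n .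
  moreover have "odd h \<longleftrightarrow> odd (class_count m)" unfolding h_def by simp
  moreover have "[h = 2] (mod 4)" if ex: "\<exists>p q k a b. prime (p::int) \<and> prime q \<and> kronecker p q = -1 \<and>
      coprime k (p * q) \<and> n = p ^ (4 * a + 1) * q ^ (4 * b + 1) * k ^ 2"
  proof -
    obtain p q k :: int and a b where "prime p" "prime q" "kronecker p q = -1" "coprime k (p * q)"
      "n = p ^ (4 * a + 1) * q ^ (4 * b + 1) * k ^ 2" using ex by blast
    note two_prime_form_value[OF n m4 this]
    then have "class_count m mod 4 = 2" "\<nexists>x. m = 3 * x^2" unfolding cong_def by simp_all
    then show ?thesis
      using nat_square_of_int[OF n] unfolding h_def cong_def by simp presburger
  qed
  moreover note two_prime_form_exists[OF n m4, folded h_def] odd_class_count_iff[OF n m4]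
  ultimately show ?thesis by (intro exI[of _ h]) blast
qed

end
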